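(* There is a lax monoidal functor $$\mathsf{SF} : \left(\mathsf{dDWD}, +, \left(\tbinom{0}{0}, !\right)\right) \to (\mathsf{Set}, \times, 1)$$ which on objects takes $\left(\binom{X_{\rm in}}{X_{\rm out}}, d_X\right)$ to the set of all open stock-flow diagrams with this interface, and which on morphisms $f$ takes the open stock-flow diagram $(F,\varphi)$ to the open stock-flow diagram $(\mathsf{SF}(f)(F), \mathsf{SF}(f)(\varphi))$.
   Context: **Maps induced by functions and spans.** For finite sets $A,B$ and a map $f:A\to B$, an element of $\mathbb{R}^A$ is a function $A\to\mathbb{R}$; $f^*:\mathbb{R}^B\to\mathbb{R}^A$ is $f^*(x)=x\circ f$ and $f_*:\mathbb{R}^A\to\mathbb{R}^B$ is $f_*(x)(b)=\sum_{a\in f^{-1}(b)}x(a)$. For a span $A\xleftarrow{s}R\xrightarrow{t}B$ write $R^*:=t_*\circ s^*:\mathbb{R}^A\to\mathbb{R}^B$. A function $\phi:\mathbb{R}^A\to\mathbb{R}^B$ respects the span $A\xleftarrow{s}R\xrightarrow{t}B$ if for every $b\in B$ and $x\in\mathbb{R}^A$, the value $\phi(x)(b)$ depends only on the restriction of $x$ to $s(t^{-1}(b))\subseteq A$. **Directed wiring diagrams.** $\mathsf{DWD}$ is the symmetric monoidal category whose objects are pairs $\binom{X_{\rm in}}{X_{\rm out}}$ of finite sets (input ports, output ports), and whose morphisms $f:\binom{X_{\rm in}}{X_{\rm out}}\to\binom{Y_{\rm in}}{Y_{\rm out}}$ are diagrams of finite sets consisting of three spans $$Y_{\rm in}\xleftarrow{s}f(W_{\rm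 in})\xrightarrow{t}X_{\rm in},\qquad X_{\rm out}\xleftarrow{s}f(W)\xrightarrow{t}X_{\rm in},\qquad X_{\rm out}\xleftarrow{s}f(W_{\rm out})\xrightarrow{t}Y_{\rm out}$$ (input, trace and output wires). The composite of $f$ with $g:\binom{Y_{\rm in}}{Y_{\rm out}}\to\binom{Z_{\rm in}}{Z_{\rm out}}$ is given by $(g\circ f)(W_{\rm in})=g(W_{\rm in})\times_{Y_{\rm in}}f(W_{\rm in})$, $(g\circ f)(W)=f(W)+f(W_{\rm out})\times_{Y_{\rm out}}g(W)\times_{Y_{\rm in}}f(W_{\rm in})$, $(g\circ f)(W_{\rm out})=g(W_{\rm out})\times_{Y_{\rm out}}f(W_{\rm out})$, with the evident source and target maps. The monoidal product $+$ is given by coproducts of finite sets, with unit $\binom{0}{0}$. **Dependencies.** A dependency $d_X$ on $\binom{X_{\rm in}}{X_{\rm out}}$ is a relation between $X_{\rm in}$ and $X_{\rm out}$, written as a span $X_{\rm in}\xleftarrow{s}d_X\xrightarrow{t}X_{\rm out}$; dependencies are ordered by inclusion. For $f:\binom{X_{\rm in}}{X_{\rm out}}\to\binom{Y_{\rm in}}{Y_{\rm out}}$, put $X=X_{\rm in}+X_{\rm out}$ and let $f(W)+_Xd_X$ be the directed graph with vertex set $X$ and edge set $f(W)+d_X$ (each element directed from its source to its target). For a directed graph $G$, $\mathsf{Path}(G)$ is the graph with the same vertices as $G$ whose edges are the paths of edges in $G$ (including the trivial path at each vertex); in fibre products it stands for its set of edges. $R(f)(d_X)$ is the relation between $Y_{\rm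 in}$ and $Y_{\rm out}$ induced by the span $Y_{\rm in}\leftarrow f(W_{\rm in})\times_X\mathsf{Path}(f(W)+_Xd_X)\times_Xf(W_{\rm out})\to Y_{\rm out}$. **The category $\mathsf{dDWD}$.** Objects are pairs $\left(\binom{X_{\rm in}}{X_{\rm out}},d_X\right)$ with $d_X$ a dependency on $\binom{X_{\rm in}}{X_{\rm out}}$. Morphisms $\left(\binom{X_{\rm in}}{X_{\rm out}},d_X\right)\to\left(\binom{Y_{\rm in}}{Y_{\rm out}},d_Y\right)$ are morphisms $f:\binom{X_{\rm in}}{X_{\rm out}}\to\binom{Y_{\rm in}}{Y_{\rm out}}$ of $\mathsf{DWD}$ with $R(f)(d_X)\leq d_Y$ and such that the graph $f(W)+_Xd_X$ is acyclic. Composition is as in $\mathsf{DWD}$; the monoidal product $+$ is the coproduct on ports, wires and dependencies, with unit $\left(\binom00,!\right)$, where $!$ is the unique dependency on $\binom00$. **Open stock-flow diagrams.** Let $\mathsf{H_f}$ be the free category on the graph with vertices stock, flow, inflow, outflow, var, sum var, stock link, sum link, stock sum link, var link, in link, out link, in port, out port, and arrows: is: inflow→stock, if: inflow→flow, os: outflow→stock, of: outflow→flow, fv: flow→var, and source/target arrows $(s,t)$: stock link→(stock, var), sum link→(sum var, var), stock sum link→(stock, sum var), var link→(var, var), in link→(in port, var), out link→(var, out port). An open stock-flow diagram with interface $\left(\binom{X_{\rm in}}{X_{\rm out}},d_X\right)$ consists of a functor $F:\mathsf{H_f}\to\mathsf{Set}$ such that (1) $F(\text{if})$ and $F(\text{of})$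 are injective; (2) the graph whose edges are $F(\text{var link})$ and whose vertices are $F(\text{var})$ is acyclic; (3) $F(\text{in port})=X_{\rm in}$ and $F(\text{out port})=X_{\rm out}$; (4) the relation $d_X$ contains the relation induced by the span $X_{\rm in}=F(\text{in port})\leftarrow F(\text{in link})\times_{F(\text{var})}\mathsf{Path}(F(\text{var link}))\times_{F(\text{var})}F(\text{out link})\to F(\text{out port})=X_{\rm out}$, where $\mathsf{Path}(F(\text{var link}))$ is the path graph of the graph in (2); together with an auxiliary function $\varphi:\mathbb{R}^{F(\text{stock})}\times\mathbb{R}^{F(\text{sum var})}\times\mathbb{R}^{F(\text{var})}\times\mathbb{R}^{F(\text{in port})}\to\mathbb{R}^{F(\text{var})}$ respecting the span $$F(\text{stock})+F(\text{sum var})+F(\text{var})+F(\text{in port})\xleftarrow{s}F(\text{stock link})+F(\text{sum link})+F(\text{var link})+F(\text{in link})\xrightarrow{t}F(\text{var}).$$ **Action on morphisms.** For $f:\left(\binom{X_{\rm in}}{X_{\rm out}},d_X\right)\to\left(\binom{Y_{\rm in}}{Y_{\rm out}},d_Y\right)$ in $\mathsf{dDWD}$ and $(F,\varphi)$ an open stock-flow diagram with interface $\left(\binom{X_{\rm in}}{X_{\rm out}},d_X\right)$, $\mathsf{SF}(f)(F):\mathsf{H_f}\to\mathsf{Set}$ is identical to $F$ on all objects and morphisms except that its in ports and out ports are $Y_{\rm in}$ and $Y_{\rm out}$, and except for the following links and their (evident) source and target maps: $$\mathsf{SF}(f)(F)(\text{in link})=f(W_{\rm in})\times_{X_{\rm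 in}}F(\text{in link}),\quad \mathsf{SF}(f)(F)(\text{out link})=F(\text{out link})\times_{X_{\rm out}}f(W_{\rm out}),$$ $$\mathsf{SF}(f)(F)(\text{var link})=F(\text{var link})+\left(F(\text{out link})\times_{X_{\rm out}}f(W)\times_{X_{\rm in}}F(\text{in link})\right).$$ The function $\mathsf{SF}(f)(\varphi):\mathbb{R}^{F(\text{stock})}\times\mathbb{R}^{F(\text{sum var})}\times\mathbb{R}^{F(\text{var})}\times\mathbb{R}^{Y_{\rm in}}\to\mathbb{R}^{F(\text{var})}$ sends $(x_{\rm stock},x_{\rm sumvar},x_{\rm var},y_{\rm in})$ to $$\varphi\left(x_{\rm stock},x_{\rm sumvar},x_{\rm var},\ f(W_{\rm in})^*(y_{\rm in})+(f(W)^*\circ F(\text{out link})^* )(x_{\rm var})\right).$$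
   Formalization: Morphisms of dDWD and open stock-flow diagrams are taken up to isomorphism fixing the ports, since fibre products make the laws fail strictly; all sets F(v) are assumed finite, so that the sums over links and the set of all diagrams exist. *)

theory Defs
  imports Complex_Main "HOL-Library.FuncSet" "Graph_Theory.Arc_Walk"
begin

section \<open>Categories, monoidal categories, lax monoidal functors\<close>

record ('o, 'm) category =
  Ob :: "'o set"
  Arr :: "'m set"
  Dom :: "'m \<Rightarrow> 'o"
  Cod :: "'m \<Rightarrow> 'o"
  Idn :: "'o \<Rightarrow> 'm"
  Comp :: "'m \<Rightarrow> 'm \<Rightarrow> 'm"  (infixr \<open>\<cdot>\<index>\<close> 70)

definition hom :: "('o, 'm, 'z) category_scheme \<Rightarrow> 'o \<Rightarrow> 'o \<Rightarrow> 'm set" where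
  "hom C A B = {f \<in> Arr C. Dom C f = A \<and> Cod C f = B}"

definition is_iso :: "('o, 'm, 'z) category_scheme \<Rightarrow> 'm \<Rightarrow> bool" where
  "is_iso C f \<longleftrightarrow> f \<in> Arr C \<and>
     (\<exists>g \<in> hom C (Cod C f) (Dom C f).
        g \<cdot>\<^bsub>C\<^esub> f = Idn C (Dom C f) \<and> f \<cdot>\<^bsub>C\<^esub> g = Idn C (Cod C f))"

locale is_category =
  fixes C :: "('o, 'm, 'z) category_scheme"
  assumes Dom_in: "f \<in> Arr C \<Longrightarrow> Dom C f \<in> Ob C"
    and Cod_in: "f \<in> Arr C \<Longrightarrow> Cod C f \<in> Ob C"
    and Idn_in: "A \<in> Ob C \<Longrightarrow> Idn C A \<in> hom C A A"
    and Comp_in: "\<lbrakk>f \<in> hom C A B; g \<in> hom C B D\<rbrakk> \<Longrightarrow> g \<cdot>\<^bsub>C\<^esub> f \<in> hom C A D"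
    and Idn_left: "f \<in> hom C A B \<Longrightarrow> Idn C B \<cdot>\<^bsub>C\<^esub> f = f"
    and Idn_right: "f \<in> hom C A B \<Longrightarrow> f \<cdot>\<^bsub>C\<^esub> Idn C A = f"
    and Comp_assoc: "\<lbrakk>f \<in> hom C A B; g \<in> hom C B D; h \<in> hom C D E\<rbrakk>
      \<Longrightarrow> (h \<cdot>\<^bsub>C\<^esub> g) \<cdot>\<^bsub>C\<^esub> f = h \<cdot>\<^bsub>C\<^esub> (g \<cdot>\<^bsub>C\<^esub> f)"

record ('o, 'm) moncat = "('o, 'm) category" +
  tenO :: "'o \<Rightarrow> 'o \<Rightarrow> 'o"  (infixr \<open>\<otimes>\<index>\<close> 75)
  tenA :: "'m \<Rightarrow> 'm \<Rightarrow> 'm"  (infixr \<open>\<odot>\<index>\<close> 75)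
  tunit :: "'o"
  assoc :: "'o \<Rightarrow> 'o \<Rightarrow> 'o \<Rightarrow> 'm"
  lunit :: "'o \<Rightarrow> 'm"
  runit :: "'o \<Rightarrow> 'm"

locale is_moncat = is_category C for C :: "('o, 'm, 'z) moncat_scheme" +
  assumes tenO_in: "\<lbrakk>A \<in> Ob C; B \<in> Ob C\<rbrakk> \<Longrightarrow> A \<otimes>\<^bsub>C\<^esub> B \<in> Ob C"
    and tenA_in: "\<lbrakk>f \<in> hom C A B; g \<in> hom C A' B'\<rbrakk>
      \<Longrightarrow> f \<odot>\<^bsub>C\<^esub> g \<in> hom C (A \<otimes>\<^bsub>C\<^esub> A') (B \<otimes>\<^bsub>C\<^esub> B')"
    and tenA_Idn: "\<lbrakk>A \<in> Ob C; B \<in> Ob C\<rbrakk>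
      \<Longrightarrow> Idn C A \<odot>\<^bsub>C\<^esub> Idn C B = Idn C (A \<otimes>\<^bsub>C\<^esub> B)"
    and tenA_Comp: "\<lbrakk>f \<in> hom C A B; g \<in> hom C B D; f' \<in> hom C A' B'; g' \<in> hom C B' D'\<rbrakk>
      \<Longrightarrow> (g \<cdot>\<^bsub>C\<^esub> f) \<odot>\<^bsub>C\<^esub> (g' \<cdot>\<^bsub>C\<^esub> f') = (g \<odot>\<^bsub>C\<^esub> g') \<cdot>\<^bsub>C\<^esub> (f \<odot>\<^bsub>C\<^esub> f')"
    and tunit_in: "tunit C \<in> Ob C"
    and assoc_in: "\<lbrakk>A \<in> Ob C; B \<in> Ob C; D \<in> Ob C\<rbrakk>
      \<Longrightarrow> assoc C A B D \<in> hom C ((A \<otimes>\<^bsub>C\<^esub> B) \<otimes>\<^bsub>C\<^esub> D) (A \<otimes>\<^bsub>C\<^esub> (B \<otimes>\<^bsub>C\<^esub> D))"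
    and assoc_iso: "\<lbrakk>A \<in> Ob C; B \<in> Ob C; D \<in> Ob C\<rbrakk> \<Longrightarrow> is_iso C (assoc C A B D)"
    and assoc_nat: "\<lbrakk>f \<in> hom C A A'; g \<in> hom C B B'; h \<in> hom C D D'\<rbrakk>
      \<Longrightarrow> assoc C A' B' D' \<cdot>\<^bsub>C\<^esub> ((f \<odot>\<^bsub>C\<^esub> g) \<odot>\<^bsub>C\<^esub> h)
         = (f \<odot>\<^bsub>C\<^esub> (g \<odot>\<^bsub>C\<^esub> h)) \<cdot>\<^bsub>C\<^esub> assoc C A B D"
    and lunit_in: "A \<in> Ob C \<Longrightarrow> lunit C A \<in> hom C (tunit C \<otimes>\<^bsub>C\<^esub> A) A"
    and lunit_iso: "A \<in> Ob C \<Longrightarrow> is_iso C (lunit C A)"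
    and lunit_nat: "f \<in> hom C A B
      \<Longrightarrow> lunit C B \<cdot>\<^bsub>C\<^esub> (Idn C (tunit C) \<odot>\<^bsub>C\<^esub> f) = f \<cdot>\<^bsub>C\<^esub> lunit C A"
    and runit_in: "A \<in> Ob C \<Longrightarrow> runit C A \<in> hom C (A \<otimes>\<^bsub>C\<^esub> tunit C) A"
    and runit_iso: "A \<in> Ob C \<Longrightarrow> is_iso C (runit C A)"
    and runit_nat: "f \<in> hom C A B
      \<Longrightarrow> runit C B \<cdot>\<^bsub>C\<^esub> (f \<odot>\<^bsub>C\<^esub> Idn C (tunit C)) = f \<cdot>\<^bsub>C\<^esub> runit C A"
    and pentagon: "\<lbrakk>A \<in> Ob C; B \<in> Ob C; D \<in> Ob C; E \<in> Ob C\<rbrakk>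
      \<Longrightarrow> (Idn C A \<odot>\<^bsub>C\<^esub> assoc C B D E) \<cdot>\<^bsub>C\<^esub> assoc C A (B \<otimes>\<^bsub>C\<^esub> D) E
            \<cdot>\<^bsub>C\<^esub> (assoc C A B D \<odot>\<^bsub>C\<^esub> Idn C E)
         = assoc C A B (D \<otimes>\<^bsub>C\<^esub> E) \<cdot>\<^bsub>C\<^esub> assoc C (A \<otimes>\<^bsub>C\<^esub> B) D E"
    and triangle: "\<lbrakk>A \<in> Ob C; B \<in> Ob C\<rbrakk>
      \<Longrightarrow> (Idn C A \<odot>\<^bsub>C\<^esub> lunit C B) \<cdot>\<^bsub>C\<^esub> assoc C A (tunit C) B
         = runit C A \<odot>\<^bsub>C\<^esub> Idn C B"

record ('o, 'm, 'p, 'n) functor_data =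
  fob :: "'o \<Rightarrow> 'p"
  far :: "'m \<Rightarrow> 'n"

locale is_functor = dom: is_category C + cod: is_category D
  for C :: "('o, 'm, 'z) category_scheme" and D :: "('p, 'n, 'y) category_scheme" +
  fixes F :: "('o, 'm, 'p, 'n) functor_data"
  assumes fob_in: "A \<in> Ob C \<Longrightarrow> fob F A \<in> Ob D"
    and far_in: "f \<in> hom C A B \<Longrightarrow> far F f \<in> hom D (fob F A) (fob F B)"
    and far_Idn: "A \<in> Ob C \<Longrightarrow> far F (Idn C A) = Idn D (fob F A)"
    and far_Comp: "\<lbrakk>f \<in> hom C A B; g \<in> hom C B E\<rbrakk>
      \<Longrightarrow> far F (g \<cdot>\<^bsub>C\<^esub> f) = far F g \<cdot>\<^bsub>D\<^esub> far F f"

definition natural_iso ::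
  "('o, 'm, 'z) category_scheme \<Rightarrow> ('p, 'n, 'y) category_scheme \<Rightarrow>
   ('o, 'm, 'p, 'n) functor_data \<Rightarrow> ('o, 'm, 'p, 'n) functor_data \<Rightarrow> ('o \<Rightarrow> 'n) \<Rightarrow> bool" where
  "natural_iso C D F G \<eta> \<longleftrightarrow>
     (\<forall>A \<in> Ob C. \<eta> A \<in> hom D (fob F A) (fob G A) \<and> is_iso D (\<eta> A)) \<and>
     (\<forall>f \<in> Arr C. \<eta> (Cod C f) \<cdot>\<^bsub>D\<^esub> far F f = far G f \<cdot>\<^bsub>D\<^esub> \<eta> (Dom C f))"

locale lax_monoidal_functor =
  dom: is_moncat C + cod: is_moncat D + is_functor C D F
  for C :: "('o, 'm, 'z) moncat_scheme" and D :: "('p, 'n, 'y) moncat_scheme" and F +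
  fixes \<mu> :: "'o \<Rightarrow> 'o \<Rightarrow> 'n" and \<epsilon> :: 'n
  assumes lax_unit_in: "\<epsilon> \<in> hom D (tunit D) (fob F (tunit C))"
    and lax_mult_in: "\<lbrakk>X \<in> Ob C; Y \<in> Ob C\<rbrakk>
      \<Longrightarrow> \<mu> X Y \<in> hom D (fob F X \<otimes>\<^bsub>D\<^esub> fob F Y) (fob F (X \<otimes>\<^bsub>C\<^esub> Y))"
    and lax_mult_nat: "\<lbrakk>f \<in> hom C X X'; g \<in> hom C Y Y'\<rbrakk>
      \<Longrightarrow> far F (f \<odot>\<^bsub>C\<^esub> g) \<cdot>\<^bsub>D\<^esub> \<mu> X Y = \<mu> X' Y' \<cdot>\<^bsub>D\<^esub> (far F f \<odot>\<^bsub>D\<^esub> far F g)"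
    and lax_assoc: "\<lbrakk>X \<in> Ob C; Y \<in> Ob C; Z \<in> Ob C\<rbrakk>
      \<Longrightarrow> far F (assoc C X Y Z) \<cdot>\<^bsub>D\<^esub> \<mu> (X \<otimes>\<^bsub>C\<^esub> Y) Z \<cdot>\<^bsub>D\<^esub> (\<mu> X Y \<odot>\<^bsub>D\<^esub> Idn D (fob F Z))
         = \<mu> X (Y \<otimes>\<^bsub>C\<^esub> Z) \<cdot>\<^bsub>D\<^esub> (Idn D (fob F X) \<odot>\<^bsub>D\<^esub> \<mu> Y Z)
             \<cdot>\<^bsub>D\<^esub> assoc D (fob F X) (fob F Y) (fob F Z)"
    and lax_lunit: "X \<in> Ob C
      \<Longrightarrow> far F (lunit C X) \<cdot>\<^bsub>D\<^esub> \<mu> (tunit C) X \<cdot>\<^bsub>D\<^esub> (\<epsilon> \<odot>\<^bsub>D\<^esub> Idn D (fob F X))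
         = lunit D (fob F X)"
    and lax_runit: "X \<in> Ob C
      \<Longrightarrow> far F (runit C X) \<cdot>\<^bsub>D\<^esub> \<mu> X (tunit C) \<cdot>\<^bsub>D\<^esub> (Idn D (fob F X) \<odot>\<^bsub>D\<^esub> \<epsilon>)
         = runit D (fob F X)"

section \<open>Sets\<close>

text \<open>
  A type has no room for the binary products and coproducts of its own subsets, so sets are taken
  to be subsets of a type closed under pairing and two injections. Its finite subsets include, up
  to bijection, all finite sets.
\<close>

datatype 'a univ = Atom 'a | Star | In1 "'a univ" | In2 "'a univ"
  | Pr (pfst: "'a univ") (psnd: "'a univ")

definition uprod :: "'a univ set \<Rightarrow> 'a univ set \<Rightarrow> 'a univ set" where
  "uprod A B = {Pr a b | a b. a \<in> A \<and> b \<in> B}"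

definition usum :: "'a univ set \<Rightarrow> 'a univ set \<Rightarrow> 'a univ set" where
  "usum A B = In1 ` A \<union> In2 ` B"

definition copair :: "('a univ \<Rightarrow> 'b) \<Rightarrow> ('a univ \<Rightarrow> 'b) \<Rightarrow> 'a univ \<Rightarrow> 'b" where
  "copair f g z = (case z of In1 x \<Rightarrow> f x | In2 y \<Rightarrow> g y | _ \<Rightarrow> undefined)"

type_synonym 'a set_arrow = "'a univ set \<times> ('a univ \<Rightarrow> 'a univ) \<times> 'a univ set"

definition set_arrow :: "'a univ set \<Rightarrow> ('a univ \<Rightarrow> 'a univ) \<Rightarrow> 'a univ set \<Rightarrow> 'a set_arrow" where
  "set_arrow A f B = (A, restrict f A, B)"

definition arrow_fun :: "'a set_arrow \<Rightarrow> 'a univ \<Rightarrow> 'a univ" where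
  "arrow_fun u = fst (snd u)"

definition SET :: "('a univ set, 'a set_arrow) moncat" where
  "SET = \<lparr> Ob = UNIV,
     Arr = {(A, f, B). f \<in> A \<rightarrow>\<^sub>E B},
     Dom = (\<lambda>(A, f, B). A),
     Cod = (\<lambda>(A, f, B). B),
     Idn = (\<lambda>A. set_arrow A (\<lambda>x. x) A),
     Comp = (\<lambda>(B', g, D) (A, f, B). set_arrow A (\<lambda>x. g (f x)) D),
     tenO = uprod,
     tenA = (\<lambda>(A, f, B) (A', f', B').
       set_arrow (uprod A A') (\<lambda>z. Pr (f (pfst z)) (f' (psnd z))) (uprod B B')),
     tunit = {Star},
     assoc = (\<lambda>A B D. set_arrow (uprod (uprod A B) D)
       (\<lambda>z. Pr (pfst (pfst z)) (Pr (psnd (pfst z)) (psnd z))) (uprod A (uprod B D))),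
     lunit = (\<lambda>A. set_arrow (uprod {Star} A) psnd A),
     runit = (\<lambda>A. set_arrow (uprod A {Star}) pfst A) \<rparr>"

section \<open>Spans\<close>

record ('r, 'p, 'q) fspan =
  apex :: "'r set"
  src :: "'r \<Rightarrow> 'p"
  tgt :: "'r \<Rightarrow> 'q"

type_synonym 'a uspan = "('a univ, 'a univ, 'a univ) fspan"

definition is_fspan :: "'p set \<Rightarrow> ('r, 'p, 'q) fspan \<Rightarrow> 'q set \<Rightarrow> bool" where
  "is_fspan A S B \<longleftrightarrow> finite (apex S) \<and> src S \<in> apex S \<rightarrow> A \<and> tgt S \<in> apex S \<rightarrow> B"

definition id_span :: "'a univ set \<Rightarrow> 'a uspan" where
  "id_span A = \<lparr> apex = A, src = (\<lambda>x. x), tgt = (\<lambda>x. x) \<rparr>"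

definition empty_span :: "'a uspan" where
  "empty_span = \<lparr> apex = {}, src = (\<lambda>x. x), tgt = (\<lambda>x. x) \<rparr>"

definition fibre_span :: "'a uspan \<Rightarrow> 'a uspan \<Rightarrow> 'a uspan"  (infixr \<open>\<Zcomp>\<close> 70) where
  "S \<Zcomp> T = \<lparr> apex = {Pr a b | a b. a \<in> apex S \<and> b \<in> apex T \<and> tgt S a = src T b},
     src = (\<lambda>z. src S (pfst z)), tgt = (\<lambda>z. tgt T (psnd z)) \<rparr>"

text \<open>Two sums of spans: with common feet, and with the coproducts of the feet as feet.\<close>

definition join_span :: "'a uspan \<Rightarrow> 'a uspan \<Rightarrow> 'a uspan"  (infixr \<open>\<squnion>\<^sub>s\<close> 65) where
  "S \<squnion>\<^sub>s T = \<lparr> apex = usum (apex S) (apex T),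
     src = copair (src S) (src T), tgt = copair (tgt S) (tgt T) \<rparr>"

definition sum_span :: "'a uspan \<Rightarrow> 'a uspan \<Rightarrow> 'a uspan"  (infixr \<open>+\<^sub>s\<close> 65) where
  "S +\<^sub>s T = \<lparr> apex = usum (apex S) (apex T),
     src = copair (\<lambda>x. In1 (src S x)) (\<lambda>y. In2 (src T y)),
     tgt = copair (\<lambda>x. In1 (tgt S x)) (\<lambda>y. In2 (tgt T y)) \<rparr>"

definition span_iso :: "'a uspan \<Rightarrow> 'a uspan \<Rightarrow> bool" where
  "span_iso S T \<longleftrightarrow> (\<exists>h. bij_betw h (apex S) (apex T) \<and>
     (\<forall>r \<in> apex S. src T (h r) = src S r \<and> tgt T (h r) = tgt S r))"

abbreviation rvec :: "'p set \<Rightarrow> ('p \<Rightarrow> real) set" where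
  "rvec A \<equiv> A \<rightarrow>\<^sub>E (UNIV :: real set)"

definition pullback :: "'p set \<Rightarrow> ('p \<Rightarrow> 'q) \<Rightarrow> ('q \<Rightarrow> real) \<Rightarrow> 'p \<Rightarrow> real" where
  "pullback A f x = (\<lambda>a\<in>A. x (f a))"

definition pushforward :: "'p set \<Rightarrow> ('p \<Rightarrow> 'q) \<Rightarrow> 'q set \<Rightarrow> ('p \<Rightarrow> real) \<Rightarrow> 'q \<Rightarrow> real" where
  "pushforward A f B x = (\<lambda>b\<in>B. \<Sum>a\<in>{a \<in> A. f a = b}. x a)"

text \<open>The map from functions on the left foot to functions on the right foot \<open>B\<close>.\<close>

definition span_map :: "('r, 'p, 'q) fspan \<Rightarrow> 'q set \<Rightarrow> ('p \<Rightarrow> real) \<Rightarrow> 'q \<Rightarrow> real" where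
  "span_map S B x = pushforward (apex S) (tgt S) B (pullback (apex S) (src S) x)"

definition respects_span ::
  "'p set \<Rightarrow> ('r, 'p, 'q) fspan \<Rightarrow> 'q set \<Rightarrow> (('p \<Rightarrow> real) \<Rightarrow> 'q \<Rightarrow> real) \<Rightarrow> bool" where
  "respects_span A S B \<phi> \<longleftrightarrow>
     (\<forall>b \<in> B. \<forall>x \<in> rvec A. \<forall>y \<in> rvec A.
        restrict x (src S ` {r \<in> apex S. tgt S r = b}) =
        restrict y (src S ` {r \<in> apex S. tgt S r = b}) \<longrightarrow> \<phi> x b = \<phi> y b)"

section \<open>Graphs\<close>

definition acyclic_graph :: "('v, 'e) pre_digraph \<Rightarrow> bool" where
  "acyclic_graph G \<longleftrightarrow> (\<nexists>p. pre_digraph.cycle G p)"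

definition free_category :: "('v, 'e) pre_digraph \<Rightarrow> ('v, 'v \<times> 'e list \<times> 'v) category" where
  "free_category G = \<lparr> Ob = verts G,
     Arr = {(u, p, v). pre_digraph.awalk G u p v},
     Dom = (\<lambda>(u, p, v). u),
     Cod = (\<lambda>(u, p, v). v),
     Idn = (\<lambda>u. (u, [], u)),
     Comp = (\<lambda>(v', q, w) (u, p, v). (u, p @ q, w)) \<rparr>"

definition generator :: "('v, 'e) pre_digraph \<Rightarrow> 'e \<Rightarrow> 'v \<times> 'e list \<times> 'v" where
  "generator G e = (tail G e, [e], head G e)"

primrec walk_arrow :: "('v, 'e) pre_digraph \<Rightarrow> ('v \<Rightarrow> 'a univ set) \<Rightarrow> ('e \<Rightarrow> 'a univ \<Rightarrow> 'a univ) \<Rightarrow>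
    'v \<Rightarrow> 'e list \<Rightarrow> 'a set_arrow" where
  "walk_arrow G A f u [] = Idn SET (A u)"
| "walk_arrow G A f u (e # p) =
     walk_arrow G A f (head G e) p \<cdot>\<^bsub>SET\<^esub> set_arrow (A (tail G e)) (f e) (A (head G e))"

text \<open>The functor out of the free category with prescribed sets and maps on the generators.\<close>

definition free_functor :: "('v, 'e) pre_digraph \<Rightarrow> ('v \<Rightarrow> 'a univ set) \<Rightarrow> ('e \<Rightarrow> 'a univ \<Rightarrow> 'a univ) \<Rightarrow>
    ('v, 'v \<times> 'e list \<times> 'v, 'a univ set, 'a set_arrow) functor_data" where
  "free_functor G A f = \<lparr> fob = A, far = (\<lambda>(u, p, v). walk_arrow G A f u p) \<rparr>"

section \<open>Dependent directed wiring diagrams\<close>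

record 'a interface =
  in_ports :: "'a univ set"
  out_ports :: "'a univ set"
  dep :: "('a univ \<times> 'a univ) set"

definition is_interface :: "'a interface \<Rightarrow> bool" where
  "is_interface X \<longleftrightarrow> finite (in_ports X) \<and> finite (out_ports X) \<and>
     dep X \<subseteq> in_ports X \<times> out_ports X"

record 'a wiring =
  win :: "'a uspan"
  wtrace :: "'a uspan"
  wout :: "'a uspan"

definition is_wiring :: "'a interface \<Rightarrow> 'a interface \<Rightarrow> 'a wiring \<Rightarrow> bool" where
  "is_wiring X Y f \<longleftrightarrow>
     is_fspan (in_ports Y) (win f) (in_ports X) \<and>
     is_fspan (out_ports X) (wtrace f) (in_ports X) \<and>
     is_fspan (out_ports X) (wout f) (out_ports Y)"

text \<open>The graph with edges the trace wires and the dependencies; input ports are tagged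
  \<open>Inl\<close> and output ports \<open>Inr\<close>.\<close>

definition wiring_graph :: "'a interface \<Rightarrow> 'a wiring \<Rightarrow>
    ('a univ + 'a univ, 'a univ + 'a univ \<times> 'a univ) pre_digraph" where
  "wiring_graph X f = \<lparr> verts = in_ports X <+> out_ports X,
     arcs = apex (wtrace f) <+> dep X,
     tail = case_sum (\<lambda>w. Inr (src (wtrace f) w)) (\<lambda>d. Inl (fst d)),
     head = case_sum (\<lambda>w. Inl (tgt (wtrace f) w)) (\<lambda>d. Inr (snd d)) \<rparr>"

definition induced_dep :: "'a interface \<Rightarrow> 'a wiring \<Rightarrow> ('a univ \<times> 'a univ) set" where
  "induced_dep X f = {(src (win f) w, tgt (wout f) w') | w p w'.
     w \<in> apex (win f) \<and> w' \<in> apex (wout f) \<and>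
     pre_digraph.awalk (wiring_graph X f) (Inl (tgt (win f) w)) p (Inr (src (wout f) w'))}"

definition is_dep_wiring :: "'a interface \<Rightarrow> 'a interface \<Rightarrow> 'a wiring \<Rightarrow> bool" where
  "is_dep_wiring X Y f \<longleftrightarrow> is_interface X \<and> is_interface Y \<and> is_wiring X Y f \<and>
     induced_dep X f \<subseteq> dep Y \<and> acyclic_graph (wiring_graph X f)"

definition id_wiring :: "'a interface \<Rightarrow> 'a wiring" where
  "id_wiring X = \<lparr> win = id_span (in_ports X), wtrace = empty_span, wout = id_span (out_ports X) \<rparr>"

definition comp_wiring :: "'a wiring \<Rightarrow> 'a wiring \<Rightarrow> 'a wiring" where
  "comp_wiring g f = \<lparr> win = win g \<Zcomp> win f,
     wtrace = wtrace f \<squnion>\<^sub>s (wout f \<Zcomp> wtrace g \<Zcomp> win f),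
     wout = wout f \<Zcomp> wout g \<rparr>"

definition sum_wiring :: "'a wiring \<Rightarrow> 'a wiring \<Rightarrow> 'a wiring" where
  "sum_wiring f g = \<lparr> win = win f +\<^sub>s win g, wtrace = wtrace f +\<^sub>s wtrace g, wout = wout f +\<^sub>s wout g \<rparr>"

text \<open>The wiring from \<open>X\<close> to its relabelling along an injection \<open>p\<close> on its ports.\<close>

definition relabel_wiring :: "('a univ \<Rightarrow> 'a univ) \<Rightarrow> 'a interface \<Rightarrow> 'a wiring" where
  "relabel_wiring p X = \<lparr> win = \<lparr> apex = in_ports X, src = p, tgt = (\<lambda>x. x) \<rparr>,
     wtrace = empty_span,
     wout = \<lparr> apex = out_ports X, src = (\<lambda>x. x), tgt = p \<rparr> \<rparr>"

definition sum_interface :: "'a interface \<Rightarrow> 'a interface \<Rightarrow> 'a interface" where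
  "sum_interface X Y = \<lparr> in_ports = usum (in_ports X) (in_ports Y),
     out_ports = usum (out_ports X) (out_ports Y),
     dep = (\<lambda>(i, j). (In1 i, In1 j)) ` dep X \<union> (\<lambda>(i, j). (In2 i, In2 j)) ` dep Y \<rparr>"

definition empty_interface :: "'a interface" where
  "empty_interface = \<lparr> in_ports = {}, out_ports = {}, dep = {} \<rparr>"

text \<open>
  Fibre products are associative and unital only up to canonical bijection, so composition of
  wirings satisfies the category laws only after identifying wirings that differ by a renaming
  of wires. An arrow is therefore an isomorphism class of wirings, along with its domain and
  codomain; operations on arrows are lifted by taking unions over representatives.
\<close>

definition wiring_iso :: "'a wiring \<Rightarrow> 'a wiring \<Rightarrow> bool" where
  "wiring_iso f g \<longleftrightarrow> span_iso (win f) (win g) \<and> span_iso (wtrace f) (wtrace g) \<and>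
     span_iso (wout f) (wout g)"

definition wiring_class :: "'a interface \<Rightarrow> 'a interface \<Rightarrow> 'a wiring \<Rightarrow> 'a wiring set" where
  "wiring_class X Y f = {g. is_wiring X Y g \<and> wiring_iso f g}"

type_synonym 'a dwd_arrow = "'a interface \<times> 'a wiring set \<times> 'a interface"

definition dwd_arrow :: "'a interface \<Rightarrow> 'a wiring \<Rightarrow> 'a interface \<Rightarrow> 'a dwd_arrow" where
  "dwd_arrow X f Y = (X, wiring_class X Y f, Y)"

definition dDWD :: "('a interface, 'a dwd_arrow) moncat" where
  "dDWD = \<lparr> Ob = {X. is_interface X},
     Arr = {dwd_arrow X f Y | X f Y. is_dep_wiring X Y f},
     Dom = (\<lambda>(X, \<Phi>, Y). X),
     Cod = (\<lambda>(X, \<Phi>, Y). Y),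
     Idn = (\<lambda>X. dwd_arrow X (id_wiring X) X),
     Comp = (\<lambda>(Y', \<Psi>, Z) (X, \<Phi>, Y).
       (X, \<Union>g\<in>\<Psi>. \<Union>f\<in>\<Phi>. wiring_class X Z (comp_wiring g f), Z)),
     tenO = sum_interface,
     tenA = (\<lambda>(X, \<Phi>, Y) (X', \<Phi>', Y').
       (sum_interface X X',
        \<Union>f\<in>\<Phi>. \<Union>f'\<in>\<Phi>'. wiring_class (sum_interface X X') (sum_interface Y Y') (sum_wiring f f'),
        sum_interface Y Y')),
     tunit = empty_interface,
     assoc = (\<lambda>X Y Z. dwd_arrow (sum_interface (sum_interface X Y) Z)
       (relabel_wiring (copair (copair In1 (\<lambda>y. In2 (In1 y))) (\<lambda>z. In2 (In2 z)))
          (sum_interface (sum_interface X Y) Z))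
       (sum_interface X (sum_interface Y Z))),
     lunit = (\<lambda>X. dwd_arrow (sum_interface empty_interface X)
       (relabel_wiring (copair (\<lambda>_. undefined) (\<lambda>x. x)) (sum_interface empty_interface X)) X),
     runit = (\<lambda>X. dwd_arrow (sum_interface X empty_interface)
       (relabel_wiring (copair (\<lambda>x. x) (\<lambda>_. undefined)) (sum_interface X empty_interface)) X) \<rparr>"

section \<open>Open stock-flow diagrams\<close>

datatype hf_link = StockLink | SumLink | StockSumLink | VarLink | InLink | OutLink

datatype hf_ob = Stock | Flow | Inflow | Outflow | Var | SumVar | InPort | OutPort | Link hf_link

datatype hf_arrow = InflowStock | InflowFlow | OutflowStock | OutflowFlow | FlowVar
  | LinkSrc hf_link | LinkTgt hf_link

fun link_src :: "hf_link \<Rightarrow> hf_ob" where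
  "link_src StockLink = Stock"
| "link_src SumLink = SumVar"
| "link_src StockSumLink = Stock"
| "link_src VarLink = Var"
| "link_src InLink = InPort"
| "link_src OutLink = Var"

fun link_tgt :: "hf_link \<Rightarrow> hf_ob" where
  "link_tgt StockLink = Var"
| "link_tgt SumLink = Var"
| "link_tgt StockSumLink = SumVar"
| "link_tgt VarLink = Var"
| "link_tgt InLink = Var"
| "link_tgt OutLink = OutPort"

fun hf_tail :: "hf_arrow \<Rightarrow> hf_ob" where
  "hf_tail InflowStock = Inflow"
| "hf_tail InflowFlow = Inflow"
| "hf_tail OutflowStock = Outflow"
| "hf_tail OutflowFlow = Outflow"
| "hf_tail FlowVar = Flow"
| "hf_tail (LinkSrc l) = Link l"
| "hf_tail (LinkTgt l) = Link l"

fun hf_head :: "hf_arrow \<Rightarrow> hf_ob" where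
  "hf_head InflowStock = Stock"
| "hf_head InflowFlow = Flow"
| "hf_head OutflowStock = Stock"
| "hf_head OutflowFlow = Flow"
| "hf_head FlowVar = Var"
| "hf_head (LinkSrc l) = link_src l"
| "hf_head (LinkTgt l) = link_tgt l"

definition hf_graph :: "(hf_ob, hf_arrow) pre_digraph" where
  "hf_graph = \<lparr> verts = UNIV, arcs = UNIV, tail = hf_tail, head = hf_head \<rparr>"

type_synonym hf_path = "hf_ob \<times> hf_arrow list \<times> hf_ob"

definition Hf :: "(hf_ob, hf_path) category" where
  "Hf = free_category hf_graph"

type_synonym 'a vec = "'a univ \<Rightarrow> real"

record 'a diagram =
  schema :: "(hf_ob, hf_path, 'a univ set, 'a set_arrow) functor_data"
  aux :: "'a vec \<times> 'a vec \<times> 'a vec \<times> 'a vec \<Rightarrow> 'a vec"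

abbreviation part :: "'a diagram \<Rightarrow> hf_ob \<Rightarrow> 'a univ set" where
  "part D v \<equiv> fob (schema D) v"

definition part_map :: "'a diagram \<Rightarrow> hf_arrow \<Rightarrow> 'a univ \<Rightarrow> 'a univ" where
  "part_map D a = arrow_fun (far (schema D) (generator hf_graph a))"

definition link_span :: "'a diagram \<Rightarrow> hf_link \<Rightarrow> 'a uspan" where
  "link_span D l = \<lparr> apex = part D (Link l), src = part_map D (LinkSrc l),
     tgt = part_map D (LinkTgt l) \<rparr>"

definition var_graph :: "'a diagram \<Rightarrow> ('a univ, 'a univ) pre_digraph" where
  "var_graph D = \<lparr> verts = part D Var, arcs = part D (Link VarLink),
     tail = part_map D (LinkSrc VarLink), head = part_map D (LinkTgt VarLink) \<rparr>"

definition diagram_dep :: "'a diagram \<Rightarrow> ('a univ \<times> 'a univ) set" where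
  "diagram_dep D = {(src (link_span D InLink) l, tgt (link_span D OutLink) l') | l p l'.
     l \<in> apex (link_span D InLink) \<and> l' \<in> apex (link_span D OutLink) \<and>
     pre_digraph.awalk (var_graph D) (tgt (link_span D InLink) l) p (src (link_span D OutLink) l')}"

definition aux_dom :: "'a diagram \<Rightarrow> ('a vec \<times> 'a vec \<times> 'a vec \<times> 'a vec) set" where
  "aux_dom D = rvec (part D Stock) \<times> rvec (part D SumVar) \<times> rvec (part D Var) \<times> rvec (part D InPort)"

text \<open>The span that the auxiliary function respects has the fourfold coproduct of stocks,
  sum variables, variables and in ports as its left foot, so the auxiliary function is precomposed
  with the identification of functions on that coproduct with quadruples of functions.\<close>

definition aux_span :: "'a diagram \<Rightarrow>
    ('a univ + 'a univ + 'a univ + 'a univ, 'a univ + 'a univ + 'a univ + 'a univ, 'a univ) fspan" where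
  "aux_span D = \<lparr>
     apex = part D (Link StockLink) <+> part D (Link SumLink) <+> part D (Link VarLink)
       <+> part D (Link InLink),
     src = map_sum (part_map D (LinkSrc StockLink)) (map_sum (part_map D (LinkSrc SumLink))
       (map_sum (part_map D (LinkSrc VarLink)) (part_map D (LinkSrc InLink)))),
     tgt = case_sum (part_map D (LinkTgt StockLink)) (case_sum (part_map D (LinkTgt SumLink))
       (case_sum (part_map D (LinkTgt VarLink)) (part_map D (LinkTgt InLink)))) \<rparr>"

definition aux_respects :: "'a diagram \<Rightarrow> bool" where
  "aux_respects D \<longleftrightarrow>
     respects_span (part D Stock <+> part D SumVar <+> part D Var <+> part D InPort)
       (aux_span D) (part D Var)
       (\<lambda>x. aux D (\<lambda>s. x (Inl s), \<lambda>q. x (Inr (Inl q)), \<lambda>v. x (Inr (Inr (Inl v))),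
                   \<lambda>i. x (Inr (Inr (Inr i)))))"

text \<open>Diagrams are finite: \<open>rvec\<close> and \<open>span_map\<close> are meant for finite sets, and only
  then is there a set of all diagrams, up to isomorphism, with a given interface.\<close>

definition open_diagram :: "'a interface \<Rightarrow> 'a diagram \<Rightarrow> bool" where
  "open_diagram X D \<longleftrightarrow>
     is_functor Hf SET (schema D) \<and>
     (\<forall>v. finite (part D v)) \<and>
     inj_on (part_map D InflowFlow) (part D Inflow) \<and>
     inj_on (part_map D OutflowFlow) (part D Outflow) \<and>
     acyclic_graph (var_graph D) \<and>
     part D InPort = in_ports X \<and> part D OutPort = out_ports X \<and>
     diagram_dep D \<subseteq> dep X \<and>
     aux D \<in> aux_dom D \<rightarrow> rvec (part D Var) \<and>
     aux_respects D"

text \<open>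
  The action of wirings on diagrams is functorial only up to the canonical bijections of fibre
  products and coproducts of links, so diagrams are identified when they differ by a renaming of
  everything but the ports.
\<close>

definition diagram_iso :: "'a diagram \<Rightarrow> 'a diagram \<Rightarrow> bool" where
  "diagram_iso D E \<longleftrightarrow> (\<exists>\<eta>. natural_iso Hf SET (schema D) (schema E) \<eta> \<and>
     \<eta> InPort = Idn SET (part D InPort) \<and> \<eta> OutPort = Idn SET (part D OutPort) \<and>
     (\<forall>(s, q, v, i) \<in> aux_dom E.
        pullback (part D Var) (arrow_fun (\<eta> Var)) (aux E (s, q, v, i)) =
        aux D (pullback (part D Stock) (arrow_fun (\<eta> Stock)) s,
               pullback (part D SumVar) (arrow_fun (\<eta> SumVar)) q,
               pullback (part D Var) (arrow_fun (\<eta> Var)) v,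
               i)))"

definition diagram_class :: "'a interface \<Rightarrow> 'a diagram \<Rightarrow> 'a diagram set" where
  "diagram_class X D = {E. open_diagram X E \<and> diagram_iso D E}"

definition act_links :: "'a wiring \<Rightarrow> 'a diagram \<Rightarrow> hf_link \<Rightarrow> 'a uspan" where
  "act_links f D = (link_span D)(
     InLink := win f \<Zcomp> link_span D InLink,
     OutLink := link_span D OutLink \<Zcomp> wout f,
     VarLink := link_span D VarLink \<squnion>\<^sub>s (link_span D OutLink \<Zcomp> wtrace f \<Zcomp> link_span D InLink))"

definition act_part :: "'a interface \<Rightarrow> 'a wiring \<Rightarrow> 'a diagram \<Rightarrow> hf_ob \<Rightarrow> 'a univ set" where
  "act_part Y f D v = (case v of
       InPort \<Rightarrow> in_ports Y
     | OutPort \<Rightarrow> out_ports Y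
     | Link l \<Rightarrow> apex (act_links f D l)
     | _ \<Rightarrow> part D v)"

definition act_map :: "'a wiring \<Rightarrow> 'a diagram \<Rightarrow> hf_arrow \<Rightarrow> 'a univ \<Rightarrow> 'a univ" where
  "act_map f D a = (case a of
       LinkSrc l \<Rightarrow> src (act_links f D l)
     | LinkTgt l \<Rightarrow> tgt (act_links f D l)
     | _ \<Rightarrow> part_map D a)"

definition act_aux :: "'a wiring \<Rightarrow> 'a diagram \<Rightarrow>
    'a vec \<times> 'a vec \<times> 'a vec \<times> 'a vec \<Rightarrow> 'a vec" where
  "act_aux f D = (\<lambda>(s, q, v, y). aux D (s, q, v,
     (\<lambda>i \<in> part D InPort.
        span_map (win f) (part D InPort) y i +
        span_map (wtrace f) (part D InPort) (span_map (link_span D OutLink) (part D OutPort) v) i)))"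

text \<open>The action of a wiring with codomain \<open>Y\<close> on a diagram.\<close>

definition act :: "'a interface \<Rightarrow> 'a wiring \<Rightarrow> 'a diagram \<Rightarrow> 'a diagram" where
  "act Y f D = \<lparr> schema = free_functor hf_graph (act_part Y f D) (act_map f D),
     aux = act_aux f D \<rparr>"

end

theory Submission
  imports Defs
begin

text \<open>
  A finite span from \<open>A\<close> to \<open>B\<close> is determined, up to a renaming of its wires, by the matrix
  that counts the wires from each \<open>a\<close> to each \<open>b\<close> (\<open>span_iso_iff_matrix\<close>). Fibre products
  of spans multiply matrices, the two sums of spans give sums and block sums, and the map of a span
  applies its matrix to a vector. So equations that hold for wirings only up to a renaming of wires
  are identities of matrices over the natural numbers: associativity of composition, for instance,
  comes from associativity and distributivity of the matrix product. The structural arrows of the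
  category of wirings relabel ports along bijections. They compose as these bijections do, which
  settles the pentagon and the triangle, and they are natural because multiplying by the matrix of
  a bijection permutes rows or columns (\<open>relabelling_natural\<close>).

  Diagrams are compared in the same way. Links with the same ends are interchangeable, so two
  diagrams are isomorphic if and only if their other parts correspond under bijections that respect
  the maps between them, the numbers of links and the auxiliary functions
  (\<open>diagram_iso_iff\<close>). A wiring changes nothing but the ports, the links that carry them
  and the var links: the matrices \<open>I\<close>, \<open>V\<close>, \<open>O\<close> of in, var and out links become
  \<open>W\<^sub>i\<^sub>n I\<close>, \<open>V + O W I\<close>, \<open>O W\<^sub>o\<^sub>u\<^sub>t\<close>, and the vector of inputs is obtained from
  the same matrices. Functoriality is again matrix algebra (\<open>act_comp\<close>).

  What is not formal is that composites of wirings, and the diagrams that wirings act on, stay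
  acyclic and within their dependencies. Both come down to one fact about relations. Let an inner
  graph \<open>L\<close> be entered by \<open>I\<close>, left by \<open>O\<close>, and fed back through \<open>W\<close>. Cut at its
  passages through \<open>W\<close>, a path of the whole is an alternation of steps in \<open>W\<close> and steps in
  \<open>E = I L\<^sup>* O\<close>. As \<open>E\<close> lies in the dependency of the interface in between, a path of the
  whole from \<open>I\<close> to \<open>O\<close> is a path of the wiring graph of the outer wiring, and so is a cycle
  that leaves \<open>L\<close> (\<open>feedback_paths\<close>, \<open>feedback_acyclic\<close>).

  The lax structure puts two diagrams side by side, and its unit is the empty diagram.
\<close>

section \<open>Feedback loops in relations\<close>

text \<open>Each passage through \<open>W\<close> cuts the path; the pieces run from \<open>I\<close> to \<open>O\<^sub>0\<close> inside \<open>L\<close>,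
  so they are steps of \<open>E\<close>.\<close>

lemma feedback_paths:
  fixes I L O\<^sub>0 W :: "('a \<times> 'a) set"
  defines "E \<equiv> I O L\<^sup>* O O\<^sub>0"
  shows "I O (L \<union> O\<^sub>0 O W O I)\<^sup>* O O\<^sub>0 \<subseteq> (E O W)\<^sup>* O E"
proof -
  have "(i, y) \<in> (E O W)\<^sup>* O I O L\<^sup>*" if "(x, y) \<in> (L \<union> O\<^sub>0 O W O I)\<^sup>*" "(i, x) \<in> I" for i x y
    using that
  proof (induction rule: rtrancl_induct)
    case base
    then show ?case by blast
  next
    case (step y z)
    then obtain k j where kj: "(i, k) \<in> (E O W)\<^sup>*" "(k, j) \<in> I" "(j, y) \<in> L\<^sup>*" by blast
    from step.hyps(2) show ?case
    proof
      assume "(y, z) \<in> L"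
      with kj show ?thesis by (meson relcomp.relcompI rtrancl.rtrancl_into_rtrancl)
    next
      assume "(y, z) \<in> O\<^sub>0 O W O I"
      then obtain o' w where ow: "(y, o') \<in> O\<^sub>0" "(o', w) \<in> W" "(w, z) \<in> I" by blast
      have "(k, w) \<in> E O W" using kj(2,3) ow(1,2) by (auto simp: E_def)
      with kj(1) have "(i, w) \<in> (E O W)\<^sup>*" by (rule rtrancl_into_rtrancl)
      with ow(3) show ?thesis by blast
    qed
  qed
  then show ?thesis by (fastforce simp: E_def)
qed

text \<open>A cycle that leaves \<open>L\<close> passes through \<open>W\<close>. Started there, it is an alternation of steps
  of \<open>W\<close> and \<open>E\<close>.\<close>

lemma feedback_acyclic:
  fixes I L O\<^sub>0 W :: "('a \<times> 'a) set"
  defines "E \<equiv> I O L\<^sup>* O O\<^sub>0"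
  assumes L: "acyclic L" and EW: "acyclic (E O W)"
  shows "acyclic (L \<union> O\<^sub>0 O W O I)"
proof (rule acyclicI, intro allI notI)
  \<comment> \<open>\<open>q\<close> and \<open>r\<close> are the heads of the first and the last step in \<open>W\<close>\<close>
  have passes: "(x, y) \<in> L\<^sup>+ \<or> (\<exists>q r. (x, q) \<in> L\<^sup>* O O\<^sub>0 O W \<and> (q, r) \<in> (E O W)\<^sup>* \<and> (r, y) \<in> I O L\<^sup>*)"
    if "(x, y) \<in> (L \<union> O\<^sub>0 O W O I)\<^sup>+" for x y
    using that
  proof (induction rule: trancl_induct)
    case (base y)
    then show ?case by blast
  next
    case (step y z)
    show ?case
    proof (cases "(y, z) \<in> L")
      case True
      with step.IH show ?thesis
        by (meson relcomp.cases relcomp.relcompI rtrancl.rtrancl_into_rtrancl trancl.trancl_into_trancl)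
    next
      case False
      then obtain o' w where ow: "(y, o') \<in> O\<^sub>0" "(o', w) \<in> W" "(w, z) \<in> I" using step.hyps(2) by blast
      from step.IH show ?thesis
      proof (elim disjE exE conjE)
        assume "(x, y) \<in> L\<^sup>+"
        then have "(x, w) \<in> L\<^sup>* O O\<^sub>0 O W" using ow by (meson relcomp.relcompI trancl_into_rtrancl)
        with ow(3) show ?thesis by blast
      next
        fix q r assume qr: "(x, q) \<in> L\<^sup>* O O\<^sub>0 O W" "(q, r) \<in> (E O W)\<^sup>*" "(r, y) \<in> I O L\<^sup>*"
        then have "(r, w) \<in> E O W" using ow by (auto simp: E_def)
        with qr(2) have "(q, w) \<in> (E O W)\<^sup>*" by (rule rtrancl_into_rtrancl)
        with qr(1) ow(3) show ?thesis by blast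
      qed
    qed
  qed
  fix x assume "(x, x) \<in> (L \<union> O\<^sub>0 O W O I)\<^sup>+"
  from passes[OF this] L obtain q r where qr: "(x, q) \<in> L\<^sup>* O O\<^sub>0 O W" "(q, r) \<in> (E O W)\<^sup>*"
    "(r, x) \<in> I O L\<^sup>*" by (auto simp: acyclic_def)
  then obtain a b c where "(x, a) \<in> L\<^sup>*" "(a, b) \<in> O\<^sub>0" "(b, q) \<in> W" "(r, c) \<in> I" "(c, x) \<in> L\<^sup>*" by blast
  then have "(r, q) \<in> E O W" unfolding E_def by (meson relcomp.relcompI rtrancl_trans)
  with qr(2) have "(q, q) \<in> (E O W)\<^sup>+" by (rule rtrancl_into_trancl1)
  with EW show False by (auto simp: acyclic_def)
qed

text \<open>Both composites of wirings and the action on diagrams are of this form: \<open>d\<close> is the dependency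
  of the interface in between, and \<open>d O W\<close> describes the wiring graph of the outer wiring.\<close>

lemma feedback_within:
  fixes I L O\<^sub>0 W d :: "('a \<times> 'a) set"
  assumes E: "I O L\<^sup>* O O\<^sub>0 \<subseteq> d" and L: "acyclic L" and dW: "acyclic (d O W)"
  shows "acyclic (L \<union> O\<^sub>0 O W O I)"
    and "P O I O (L \<union> O\<^sub>0 O W O I)\<^sup>* O O\<^sub>0 O Q \<subseteq> P O (d O W)\<^sup>* O d O Q"
proof -
  have "acyclic ((I O L\<^sup>* O O\<^sub>0) O W)" using E by (intro acyclic_subset[OF dW] relcomp_mono) auto
  then show "acyclic (L \<union> O\<^sub>0 O W O I)" by (rule feedback_acyclic[OF L])
  have "P O (I O (L \<union> O\<^sub>0 O W O I)\<^sup>* O O\<^sub>0) O Q \<subseteq> P O (((I O L\<^sup>* O O\<^sub>0) O W)\<^sup>* O I O L\<^sup>* O O\<^sub>0) O Q"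
    by (intro relcomp_mono order_refl feedback_paths)
  also have "\<dots> \<subseteq> P O ((d O W)\<^sup>* O d) O Q"
    using E by (intro relcomp_mono order_refl rtrancl_mono)
  finally show "P O I O (L \<union> O\<^sub>0 O W O I)\<^sup>* O O\<^sub>0 O Q \<subseteq> P O (d O W)\<^sup>* O d O Q"
    by (simp add: O_assoc)
qed

section \<open>Walks as reachability\<close>

text \<open>Multiplicities of edges play a part in counting wires, but not in reachability and acyclicity,
  which are properties of the relation between the ends of edges.\<close>

lemma awalk_iff_reachable:
  assumes "wf_digraph G"
  shows "(\<exists>p. pre_digraph.awalk G u p v) \<longleftrightarrow> u \<in> verts G \<and> (u, v) \<in> (arcs_ends G)\<^sup>*"
proof -
  interpret wf_digraph G by (fact assms)
  have "(\<exists>p. awalk u p v) \<longleftrightarrow> u \<in> verts G \<and> (u = v \<or> (\<exists>p. awalk u p v \<and> p \<noteq> []))"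
    by (metis awalk_Nil_iff awalk_hd_in_verts)
  also have "\<dots> \<longleftrightarrow> u \<in> verts G \<and> (u, v) \<in> (arcs_ends G)\<^sup>*"
    unfolding reachable1_awalk[symmetric] rtrancl_eq_or_trancl by blast
  finally show ?thesis .
qed

lemma acyclic_graph_iff:
  assumes "wf_digraph G"
  shows "acyclic_graph G \<longleftrightarrow> acyclic (arcs_ends G)"
proof -
  interpret wf_digraph G by (fact assms)
  have "(\<exists>p. cycle p) \<longleftrightarrow> (\<exists>u. (u, u) \<in> (arcs_ends G)\<^sup>+)"
    unfolding reachable1_awalk using closed_w_imp_cycle by (auto simp: cycle_def closed_w_def)
  then show ?thesis by (auto simp: acyclic_graph_def acyclic_def)
qed

section \<open>Spans as matrices\<close>

definition span_matrix :: "('r, 'p, 'q) fspan \<Rightarrow> 'p \<Rightarrow> 'q \<Rightarrow> nat" where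
  "span_matrix S a b = card {r \<in> apex S. src S r = a \<and> tgt S r = b}"

definition span_rel :: "('r, 'p, 'q) fspan \<Rightarrow> ('p \<times> 'q) set" where
  "span_rel S = (\<lambda>r. (src S r, tgt S r)) ` apex S"

definition mmul :: "'q set \<Rightarrow> ('p \<Rightarrow> 'q \<Rightarrow> nat) \<Rightarrow> ('q \<Rightarrow> 's \<Rightarrow> nat) \<Rightarrow> 'p \<Rightarrow> 's \<Rightarrow> nat" where
  "mmul B M N a c = (\<Sum>b\<in>B. M a b * N b c)"

definition madd :: "('p \<Rightarrow> 'q \<Rightarrow> nat) \<Rightarrow> ('p \<Rightarrow> 'q \<Rightarrow> nat) \<Rightarrow> 'p \<Rightarrow> 'q \<Rightarrow> nat" where
  "madd M N a b = M a b + N a b"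

text \<open>The block diagonal matrix on coproducts of index sets.\<close>

definition mdiag :: "('a univ \<Rightarrow> 'a univ \<Rightarrow> nat) \<Rightarrow> ('a univ \<Rightarrow> 'a univ \<Rightarrow> nat) \<Rightarrow>
    'a univ \<Rightarrow> 'a univ \<Rightarrow> nat" where
  "mdiag M N a b = (case (a, b) of (In1 x, In1 y) \<Rightarrow> M x y | (In2 x, In2 y) \<Rightarrow> N x y | _ \<Rightarrow> 0)"

definition mzero :: "'p \<Rightarrow> 'q \<Rightarrow> nat" where
  "mzero a b = 0"

text \<open>The matrix of a map and, below, its transpose.\<close>

definition mgraph :: "('p \<Rightarrow> 'q) \<Rightarrow> 'p set \<Rightarrow> 'p \<Rightarrow> 'q \<Rightarrow> nat" where
  "mgraph p A a b = (if a \<in> A \<and> b = p a then 1 else 0)"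

definition mcograph :: "('p \<Rightarrow> 'q) \<Rightarrow> 'p set \<Rightarrow> 'q \<Rightarrow> 'p \<Rightarrow> nat" where
  "mcograph p A b a = mgraph p A a b"

definition msupp :: "'p set \<Rightarrow> 'q set \<Rightarrow> ('p \<Rightarrow> 'q \<Rightarrow> nat) \<Rightarrow> bool" where
  "msupp A B M \<longleftrightarrow> (\<forall>a b. M a b \<noteq> 0 \<longrightarrow> a \<in> A \<and> b \<in> B)"

lemma usum_simps [simp]:
  "In1 x \<in> usum A B \<longleftrightarrow> x \<in> A" "In2 y \<in> usum A B \<longleftrightarrow> y \<in> B"
  "Star \<notin> usum A B" "Atom c \<notin> usum A B" "Pr x y \<notin> usum A B"
  by (auto simp: usum_def)

lemma uprod_simps [simp]:
  "Pr x y \<in> uprod A B \<longleftrightarrow> x \<in> A \<and> y \<in> B"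
  by (auto simp: uprod_def)

lemma uprodE [elim!]:
  assumes "z \<in> uprod A B" obtains x y where "z = Pr x y" "x \<in> A" "y \<in> B"
  using assms by (auto simp: uprod_def)

lemma usumE [elim!, consumes 1, case_names In1 In2]:
  assumes "z \<in> usum A B" obtains x where "z = In1 x" "x \<in> A" | y where "z = In2 y" "y \<in> B"
  using assms by (auto simp: usum_def)

lemma copair_simps [simp]: "copair f g (In1 x) = f x" "copair f g (In2 y) = g y"
  by (simp_all add: copair_def)

lemma finite_usum [simp]: "finite (usum A B) \<longleftrightarrow> finite A \<and> finite B"
  by (auto simp: usum_def finite_image_iff inj_on_def)

lemma sum_usum:
  assumes "finite A" "finite B"
  shows "sum f (usum A B) = (\<Sum>x\<in>A. f (In1 x)) + (\<Sum>y\<in>B. f (In2 y))"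
proof -
  have "sum f (usum A B) = sum f (In1 ` A) + sum f (In2 ` B)"
    unfolding usum_def using assms by (intro sum.union_disjoint) auto
  also have "sum f (In1 ` A) = (\<Sum>x\<in>A. f (In1 x))" by (subst sum.reindex) (auto simp: inj_on_def)
  also have "sum f (In2 ` B) = (\<Sum>x\<in>B. f (In2 x))" by (subst sum.reindex) (auto simp: inj_on_def)
  finally show ?thesis .
qed

lemma span_matrix_nonzero:
  "finite (apex S) \<Longrightarrow> span_matrix S a b \<noteq> 0 \<longleftrightarrow> (\<exists>r\<in>apex S. src S r = a \<and> tgt S r = b)"
  unfolding span_matrix_def by (subst card_eq_0_iff) auto

lemma span_rel_matrix: "finite (apex S) \<Longrightarrow> span_rel S = {(a, b). span_matrix S a b \<noteq> 0}"
  by (auto simp: span_matrix_nonzero span_rel_def simp del: neq0_conv)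

lemma msupp_span_matrix: "is_fspan A S B \<Longrightarrow> msupp A B (span_matrix S)"
  by (auto simp: msupp_def is_fspan_def span_matrix_nonzero Pi_iff simp del: neq0_conv)

text \<open>Wires with the same ends are interchangeable: bijections between the sets of wires over each
  pair of ends can be chosen arbitrarily, and together they form an isomorphism of spans.\<close>

lemma span_iso_iff_matrix:
  assumes "finite (apex S)" "finite (apex T)"
  shows "span_iso S T \<longleftrightarrow> span_matrix S = span_matrix T"
proof
  assume "span_iso S T"
  then obtain h where h: "bij_betw h (apex S) (apex T)"
    "\<And>r. r \<in> apex S \<Longrightarrow> src T (h r) = src S r \<and> tgt T (h r) = tgt S r"
    by (auto simp: span_iso_def)
  show "span_matrix S = span_matrix T"
  proof (intro ext)
    fix a b
    have "bij_betw h {r \<in> apex S. src S r = a \<and> tgt S r = b} {r \<in> apex T. src T r = a \<and> tgt T r = b}"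
      using h by (intro bij_betw_Collect) auto
    then show "span_matrix S a b = span_matrix T a b" unfolding span_matrix_def by (rule bij_betw_same_card)
  qed
next
  assume eq: "span_matrix S = span_matrix T"
  let ?F = "\<lambda>U :: 'a uspan. \<lambda>(a, b). {r \<in> apex U. src U r = a \<and> tgt U r = b}"
  have "\<exists>k. bij_betw k (?F S ab) (?F T ab)" for ab
    using eq assms by (cases ab) (intro finite_same_card_bij, auto simp: span_matrix_def fun_eq_iff)
  then have "\<forall>ab. \<exists>k. bij_betw k (?F S ab) (?F T ab)" by blast
  from choice[OF this] obtain k where k: "\<And>ab. bij_betw (k ab) (?F S ab) (?F T ab)" by blast
  define h where "h r = k (src S r, tgt S r) r" for r
  have h_in: "h r \<in> apex T \<and> src T (h r) = src S r \<and> tgt T (h r) = tgt S r" if "r \<in> apex S" for r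
    using bij_betw_apply[OF k[of "(src S r, tgt S r)"], of r] that by (auto simp: h_def)
  have "inj_on h (apex S)"
  proof (rule inj_onI)
    fix r r' assume r: "r \<in> apex S" "r' \<in> apex S" "h r = h r'"
    then have ends: "src S r = src S r'" "tgt S r = tgt S r'" using h_in by metis+
    have "k (src S r', tgt S r') r = k (src S r', tgt S r') r'" using r(3) ends by (simp add: h_def)
    then show "r = r'"
      using bij_betw_imp_inj_on[OF k[of "(src S r', tgt S r')"]] r ends by (auto dest: inj_onD)
  qed
  moreover have "h ` apex S = apex T"
  proof
    show "h ` apex S \<subseteq> apex T" using h_in by blast
    show "apex T \<subseteq> h ` apex S"
    proof
      fix t assume "t \<in> apex T"
      then have "t \<in> k (src T t, tgt T t) ` ?F S (src T t, tgt T t)"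
        using bij_betw_imp_surj_on[OF k[of "(src T t, tgt T t)"]] by auto
      then obtain r where "r \<in> apex S" "src S r = src T t" "tgt S r = tgt T t" "t = k (src T t, tgt T t) r"
        by auto
      then show "t \<in> h ` apex S" by (metis h_def image_eqI)
    qed
  qed
  ultimately show "span_iso S T" using h_in by (auto simp: span_iso_def bij_betw_def)
qed

lemma is_fspan_fibre [intro]:
  assumes "is_fspan A S B" "is_fspan B T C" shows "is_fspan A (S \<Zcomp> T) C"
proof -
  have "apex (S \<Zcomp> T) \<subseteq> (\<lambda>(a, b). Pr a b) ` (apex S \<times> apex T)" by (auto simp: fibre_span_def)
  then have "finite (apex (S \<Zcomp> T))" using assms by (meson finite_SigmaI finite_imageI finite_subset is_fspan_def)
  then show ?thesis using assms by (auto simp: is_fspan_def fibre_span_def)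
qed

text \<open>A wire of the composite is a pair of wires that meet at a port of the middle foot.\<close>

lemma span_matrix_fibre:
  assumes S: "is_fspan A S B" and T: "is_fspan B T C" and B: "finite B"
  shows "span_matrix (S \<Zcomp> T) = mmul B (span_matrix S) (span_matrix T)"
proof (intro ext)
  fix a c
  let ?S = "\<lambda>b. {r \<in> apex S. src S r = a \<and> tgt S r = b}"
  let ?T = "\<lambda>b. {r \<in> apex T. src T r = b \<and> tgt T r = c}"
  have "{r \<in> apex (S \<Zcomp> T). src (S \<Zcomp> T) r = a \<and> tgt (S \<Zcomp> T) r = c}
      = (\<Union>b\<in>B. (\<lambda>(r, t). Pr r t) ` (?S b \<times> ?T b))"
    using S by (auto simp: fibre_span_def is_fspan_def image_iff)
  then have "span_matrix (S \<Zcomp> T) a c = card (\<Union>b\<in>B. (\<lambda>(r, t). Pr r t) ` (?S b \<times> ?T b))"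
    by (simp add: span_matrix_def)
  also have "\<dots> = (\<Sum>b\<in>B. card ((\<lambda>(r, t). Pr r t) ` (?S b \<times> ?T b)))"
    using S T B by (intro card_UN_disjoint) (auto simp: is_fspan_def)
  also have "\<dots> = (\<Sum>b\<in>B. card (?S b) * card (?T b))"
    by (intro sum.cong refl) (subst card_image, auto simp: inj_on_def card_cartesian_product)
  finally show "span_matrix (S \<Zcomp> T) a c = mmul B (span_matrix S) (span_matrix T) a c"
    by (simp add: span_matrix_def mmul_def)
qed

lemma is_fspan_join [intro]:
  "is_fspan A S B \<Longrightarrow> is_fspan A T B \<Longrightarrow> is_fspan A (S \<squnion>\<^sub>s T) B"
  by (auto simp: is_fspan_def join_span_def)

lemma span_matrix_join:
  assumes "finite (apex S)" "finite (apex T)"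
  shows "span_matrix (S \<squnion>\<^sub>s T) = madd (span_matrix S) (span_matrix T)"
proof (intro ext)
  fix a b
  have "{r \<in> apex (S \<squnion>\<^sub>s T). src (S \<squnion>\<^sub>s T) r = a \<and> tgt (S \<squnion>\<^sub>s T) r = b}
    = In1 ` {r \<in> apex S. src S r = a \<and> tgt S r = b} \<union> In2 ` {r \<in> apex T. src T r = a \<and> tgt T r = b}"
    by (auto simp: join_span_def)
  then have "span_matrix (S \<squnion>\<^sub>s T) a b = card (In1 ` {r \<in> apex S. src S r = a \<and> tgt S r = b}
      \<union> In2 ` {r \<in> apex T. src T r = a \<and> tgt T r = b})"
    by (simp add: span_matrix_def)
  also have "\<dots> = madd (span_matrix S) (span_matrix T) a b"
    using assms by (subst card_Un_disjoint) (auto simp: madd_def span_matrix_def card_image inj_on_def)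
  finally show "span_matrix (S \<squnion>\<^sub>s T) a b = madd (span_matrix S) (span_matrix T) a b" .
qed

lemma is_fspan_sum [intro]:
  "is_fspan A S B \<Longrightarrow> is_fspan A' T B' \<Longrightarrow> is_fspan (usum A A') (S +\<^sub>s T) (usum B B')"
  by (auto simp: is_fspan_def sum_span_def)

lemma span_matrix_sum: "span_matrix (S +\<^sub>s T) = mdiag (span_matrix S) (span_matrix T)"
proof (intro ext)
  fix a b
  let ?R = "{r \<in> apex (S +\<^sub>s T). src (S +\<^sub>s T) r = a \<and> tgt (S +\<^sub>s T) r = b}"
  have off: "?R = {} \<and> mdiag (span_matrix S) (span_matrix T) a b = 0"
    if "\<nexists>x y. a = In1 x \<and> b = In1 y" "\<nexists>x y. a = In2 x \<and> b = In2 y"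
    using that by (auto simp: sum_span_def mdiag_def split: univ.splits)
  consider x y where "a = In1 x" "b = In1 y" | x y where "a = In2 x" "b = In2 y"
    | "?R = {}" "mdiag (span_matrix S) (span_matrix T) a b = 0"
  proof (cases "(\<exists>x y. a = In1 x \<and> b = In1 y) \<or> (\<exists>x y. a = In2 x \<and> b = In2 y)")
    case True
    then show thesis using that(1,2) by blast
  next
    case False
    with off that(3) show thesis by simp
  qed
  then show "span_matrix (S +\<^sub>s T) a b = mdiag (span_matrix S) (span_matrix T) a b"
  proof cases
    case (1 x y)
    then have "?R = In1 ` {r \<in> apex S. src S r = x \<and> tgt S r = y}" by (auto simp: sum_span_def)
    then show ?thesis using 1 by (simp add: span_matrix_def mdiag_def card_image inj_on_def)
  next
    case (2 x y)
    then have "?R = In2 ` {r \<in> apex T. src T r = x \<and> tgt T r = y}" by (auto simp: sum_span_def)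
    then show ?thesis using 2 by (simp add: span_matrix_def mdiag_def card_image inj_on_def)
  next
    case 3
    have "span_matrix (S +\<^sub>s T) a b = card ?R" by (rule span_matrix_def)
    then show ?thesis by (simp only: 3 card.empty)
  qed
qed

lemma span_matrix_empty [simp]: "span_matrix empty_span = mzero"
  by (intro ext) (simp add: span_matrix_def empty_span_def mzero_def)

lemma span_matrix_fun:
  "span_matrix \<lparr> apex = A, src = (\<lambda>x. x), tgt = p \<rparr> = mgraph p A"
proof (intro ext)
  fix a b
  have "{r \<in> A. r = a \<and> p r = b} = (if a \<in> A \<and> b = p a then {a} else {})" by auto
  then show "span_matrix \<lparr> apex = A, src = (\<lambda>x. x), tgt = p \<rparr> a b = mgraph p A a b"
    by (simp add: span_matrix_def mgraph_def)
qed

lemma span_matrix_cofun: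
  "span_matrix \<lparr> apex = A, src = p, tgt = (\<lambda>x. x) \<rparr> = mcograph p A"
proof (intro ext)
  fix a b
  have "{r \<in> A. p r = b \<and> r = a} = (if a \<in> A \<and> b = p a then {a} else {})" by auto
  then show "span_matrix \<lparr> apex = A, src = p, tgt = (\<lambda>x. x) \<rparr> b a = mcograph p A b a"
    by (simp add: span_matrix_def mgraph_def mcograph_def)
qed

lemma mmul_assoc: "mmul B M (mmul C N P) = mmul C (mmul B M N) P"
  unfolding mmul_def sum_distrib_left sum_distrib_right
  by (intro ext, subst sum.swap) (simp add: mult.assoc)

lemma mmul_madd: "mmul B (madd M M') N = madd (mmul B M N) (mmul B M' N)"
  "mmul B N (madd M M') = madd (mmul B N M) (mmul B N M')"
  by (simp_all add: fun_eq_iff mmul_def madd_def algebra_simps sum.distrib)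

lemma madd_assoc: "madd (madd M N) P = madd M (madd N P)"
  by (simp add: fun_eq_iff madd_def)

lemma mzero_simps [simp]: "mmul B mzero M = mzero" "mmul B M mzero = mzero"
  "madd mzero M = M" "madd M mzero = M" "mdiag mzero mzero = mzero"
  by (auto simp: fun_eq_iff mmul_def madd_def mzero_def mdiag_def split: univ.splits)

lemma mmul_mgraph_left:
  assumes "finite B" "p \<in> A \<rightarrow> B"
  shows "mmul B (mgraph p A) N a c = (if a \<in> A then N (p a) c else 0)"
proof -
  have "mmul B (mgraph p A) N a c = (\<Sum>b\<in>B. if p a = b then (if a \<in> A then N b c else 0) else 0)"
    unfolding mmul_def by (intro sum.cong) (auto simp: mgraph_def)
  also have "\<dots> = (if a \<in> A then N (p a) c else 0)" using assms by (simp add: sum.delta') auto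
  finally show ?thesis .
qed

lemma mmul_mcograph_right:
  assumes "finite B" "p \<in> A \<rightarrow> B"
  shows "mmul B M (mcograph p A) c a = (if a \<in> A then M c (p a) else 0)"
proof -
  have "mmul B M (mcograph p A) c a = mmul B (mgraph p A) (\<lambda>b c. M c b) a c"
    by (simp add: mmul_def mcograph_def mult.commute)
  also have "\<dots> = (if a \<in> A then M c (p a) else 0)" by (rule mmul_mgraph_left[OF assms])
  finally show ?thesis .
qed

lemma mmul_mgraph_right:
  assumes "finite B"
  shows "mmul B M (mgraph p B) a c = (\<Sum>b\<in>{b\<in>B. p b = c}. M a b)"
proof -
  have "mmul B M (mgraph p B) a c = (\<Sum>b\<in>B. if p b = c then M a b else 0)"
    unfolding mmul_def by (intro sum.cong) (auto simp: mgraph_def)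
  also have "\<dots> = (\<Sum>b\<in>{b\<in>B. p b = c}. M a b)" using assms by (rule sum.inter_filter[symmetric])
  finally show ?thesis .
qed

lemma mmul_mcograph_left:
  assumes "finite B"
  shows "mmul B (mcograph p B) M c a = (\<Sum>b\<in>{b\<in>B. p b = c}. M b a)"
  using mmul_mgraph_right[OF assms, of "\<lambda>a b. M b a" p a c]
  by (simp add: mmul_def mcograph_def mult.commute)

lemma mmul_id_left: "finite A \<Longrightarrow> msupp A B M \<Longrightarrow> mmul A (mgraph (\<lambda>x. x) A) M = M"
  by (intro ext) (subst mmul_mgraph_left, auto simp: msupp_def)

lemma mmul_id_right: "finite B \<Longrightarrow> msupp A B M \<Longrightarrow> mmul B M (mcograph (\<lambda>x. x) B) = M"
  by (intro ext) (subst mmul_mcograph_right, auto simp: msupp_def)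

lemma mcograph_id: "mcograph (\<lambda>x. x) A = mgraph (\<lambda>x. x) A"
  by (auto simp: fun_eq_iff mcograph_def mgraph_def)

lemma mdiag_mmul:
  assumes "finite B" "finite B'"
  shows "mmul (usum B B') (mdiag M M') (mdiag N N') = mdiag (mmul B M N) (mmul B' M' N')"
proof (intro ext)
  fix a c
  show "mmul (usum B B') (mdiag M M') (mdiag N N') a c = mdiag (mmul B M N) (mmul B' M' N') a c"
    by (cases a; cases c) (simp_all add: mmul_def sum_usum assms mdiag_def)
qed

lemma mdiag_madd: "mdiag (madd M N) (madd M' N') = madd (mdiag M M') (mdiag N N')"
  by (auto simp: fun_eq_iff mdiag_def madd_def split: univ.splits)

lemma mdiag_mgraph:
  "mdiag (mgraph p A) (mgraph q B) = mgraph (copair (\<lambda>x. In1 (p x)) (\<lambda>y. In2 (q y))) (usum A B)"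
proof (intro ext)
  fix a b show "mdiag (mgraph p A) (mgraph q B) a b = mgraph (copair (\<lambda>x. In1 (p x)) (\<lambda>y. In2 (q y))) (usum A B) a b"
    by (cases a; cases b) (auto simp: mdiag_def mgraph_def)
qed

lemma mdiag_mcograph:
  "mdiag (mcograph p A) (mcograph q B) = mcograph (copair (\<lambda>x. In1 (p x)) (\<lambda>y. In2 (q y))) (usum A B)"
proof -
  have "mdiag (mcograph p A) (mcograph q B) = (\<lambda>a b. mdiag (mgraph p A) (mgraph q B) b a)"
    by (auto simp: fun_eq_iff mdiag_def mcograph_def split: univ.splits)
  then show ?thesis unfolding mdiag_mgraph by (auto simp: fun_eq_iff mcograph_def)
qed

text \<open>Wires into \<open>b\<close> are grouped by their sources.\<close>

lemma span_map_matrix: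
  assumes S: "is_fspan A S B" and A: "finite A" and b: "b \<in> B"
  shows "span_map S B x b = (\<Sum>a\<in>A. real (span_matrix S a b) * x a)"
proof -
  have "span_map S B x b = (\<Sum>r\<in>{r \<in> apex S. tgt S r = b}. x (src S r))"
    using b by (simp add: span_map_def pushforward_def pullback_def)
  also have "\<dots> = (\<Sum>a\<in>A. \<Sum>r\<in>{r \<in> {r \<in> apex S. tgt S r = b}. src S r = a}. x (src S r))"
    using S A by (intro sum.group[symmetric]) (auto simp: is_fspan_def)
  also have "\<dots> = (\<Sum>a\<in>A. real (span_matrix S a b) * x a)"
  proof (intro sum.cong refl)
    fix a
    have "{r \<in> {r \<in> apex S. tgt S r = b}. src S r = a} = {r \<in> apex S. src S r = a \<and> tgt S r = b}" by auto
    then show "(\<Sum>r\<in>{r \<in> {r \<in> apex S. tgt S r = b}. src S r = a}. x (src S r)) = real (span_matrix S a b) * x a"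
      by (simp add: span_matrix_def)
  qed
  finally show ?thesis .
qed

text \<open>In view of \<open>span_map_matrix\<close>, this is the functoriality of \<open>span_map\<close>: the matrix of a
  composite is applied by applying its factors in turn.\<close>

lemma sum_mmul:
  fixes x :: "'p \<Rightarrow> real"
  shows "(\<Sum>a\<in>A. real (mmul B M N a c) * x a) = (\<Sum>b\<in>B. real (N b c) * (\<Sum>a\<in>A. real (M a b) * x a))"
  unfolding mmul_def of_nat_sum sum_distrib_left sum_distrib_right
  by (subst sum.swap) (simp add: algebra_simps)


section \<open>The monoidal category of sets\<close>

lemma is_isoI:
  assumes "u \<in> hom C A B" "v \<in> hom C B A" "v \<cdot>\<^bsub>C\<^esub> u = Idn C A" "u \<cdot>\<^bsub>C\<^esub> v = Idn C B"
  shows "is_iso C u"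
  using assms by (auto simp: is_iso_def hom_def intro!: bexI[of _ v])

lemma arrow_fun_simp [simp]: "arrow_fun (A, f, B) = f"
  by (simp add: arrow_fun_def)

lemma arrow_fun_set_arrow [simp]: "x \<in> A \<Longrightarrow> arrow_fun (set_arrow A f B) x = f x"
  by (simp add: set_arrow_def)

lemma hom_SET: "u \<in> hom SET A B \<longleftrightarrow> (\<exists>f. u = (A, f, B) \<and> f \<in> A \<rightarrow>\<^sub>E B)"
  by (cases u) (auto simp: hom_def SET_def)

lemma hom_SET_cases:
  assumes "u \<in> hom SET A B"
  obtains f where "u = (A, f, B)" "f \<in> A \<rightarrow>\<^sub>E B"
  using assms by (auto simp: hom_SET)

lemma arrow_fun_in: "u \<in> hom SET A B \<Longrightarrow> x \<in> A \<Longrightarrow> arrow_fun u x \<in> B"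
  by (auto simp: hom_SET PiE_iff)

lemma set_arrow_in: "f \<in> A \<rightarrow> B \<Longrightarrow> set_arrow A f B \<in> hom SET A B"
  by (auto simp: hom_SET set_arrow_def)

lemma hom_SET_eqI:
  assumes "u \<in> hom SET A B" "v \<in> hom SET A B" "\<And>x. x \<in> A \<Longrightarrow> arrow_fun u x = arrow_fun v x"
  shows "u = v"
  using assms by (auto simp: hom_SET intro: PiE_ext)

lemma set_arrow_cong:
  "(\<And>x. x \<in> A \<Longrightarrow> f x = g x) \<Longrightarrow> set_arrow A f B = set_arrow A g B"
  by (auto simp: set_arrow_def fun_eq_iff)

lemma SET_comp: "(B', g, D) \<cdot>\<^bsub>SET\<^esub> (A, f, B) = set_arrow A (\<lambda>x. g (f x)) D"
  by (simp add: SET_def)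

lemma SET_tenA: "(A, f, B) \<odot>\<^bsub>SET\<^esub> (A', f', B') =
    set_arrow (uprod A A') (\<lambda>z. Pr (f (pfst z)) (f' (psnd z))) (uprod B B')"
  by (simp add: SET_def)

lemma SET_simps:
  "Ob SET = UNIV" "Idn SET A = set_arrow A (\<lambda>x. x) A" "A \<otimes>\<^bsub>SET\<^esub> B = uprod A B" "tunit SET = {Star}"
  "assoc SET A B D = set_arrow (uprod (uprod A B) D)
       (\<lambda>z. Pr (pfst (pfst z)) (Pr (psnd (pfst z)) (psnd z))) (uprod A (uprod B D))"
  "lunit SET A = set_arrow (uprod {Star} A) psnd A"
  "runit SET A = set_arrow (uprod A {Star}) pfst A"
  by (simp_all add: SET_def)

lemma set_arrow_comp:
  assumes "f \<in> A \<rightarrow> B"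
  shows "set_arrow B g D \<cdot>\<^bsub>SET\<^esub> set_arrow A f B = set_arrow A (\<lambda>x. g (f x)) D"
  using assms unfolding set_arrow_def SET_comp by (auto simp: fun_eq_iff Pi_iff)

lemma set_arrow_tenA:
  "set_arrow A f B \<odot>\<^bsub>SET\<^esub> set_arrow A' f' B' =
    set_arrow (uprod A A') (\<lambda>z. Pr (f (pfst z)) (f' (psnd z))) (uprod B B')"
  unfolding set_arrow_def SET_tenA by (auto simp: fun_eq_iff)

lemma SET_comp_in:
  assumes "u \<in> hom SET A B" "v \<in> hom SET B D"
  shows "v \<cdot>\<^bsub>SET\<^esub> u \<in> hom SET A D"
  using assms by (elim hom_SET_cases) (auto simp: SET_comp intro!: set_arrow_in)

lemma arrow_fun_comp:
  assumes "u \<in> hom SET A B" "v \<in> hom SET B D" "x \<in> A"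
  shows "arrow_fun (v \<cdot>\<^bsub>SET\<^esub> u) x = arrow_fun v (arrow_fun u x)"
  using assms by (elim hom_SET_cases) (auto simp: SET_comp)

lemma SET_Idn_in: "Idn SET A \<in> hom SET A A"
  by (auto simp: SET_simps intro!: set_arrow_in)

lemma arrow_fun_Idn: "x \<in> A \<Longrightarrow> arrow_fun (Idn SET A) x = x"
  by (simp add: SET_simps)

lemma SET_tenA_in:
  assumes "u \<in> hom SET A B" "v \<in> hom SET A' B'"
  shows "u \<odot>\<^bsub>SET\<^esub> v \<in> hom SET (uprod A A') (uprod B B')"
  using assms by (elim hom_SET_cases) (auto simp: SET_tenA intro!: set_arrow_in)

lemma arrow_fun_tenA:
  assumes "u \<in> hom SET A B" "v \<in> hom SET A' B'" "x \<in> A" "y \<in> A'"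
  shows "arrow_fun (u \<odot>\<^bsub>SET\<^esub> v) (Pr x y) = Pr (arrow_fun u x) (arrow_fun v y)"
  using assms by (elim hom_SET_cases) (auto simp: SET_tenA)

lemma SET_struct_in:
  "assoc SET A B D \<in> hom SET (uprod (uprod A B) D) (uprod A (uprod B D))"
  "lunit SET A \<in> hom SET (uprod {Star} A) A"
  "runit SET A \<in> hom SET (uprod A {Star}) A"
  by (auto simp: SET_simps intro!: set_arrow_in)

lemma SET_iso_iff:
  assumes u: "u \<in> hom SET A B"
  shows "is_iso SET u \<longleftrightarrow> bij_betw (arrow_fun u) A B"
proof
  assume "is_iso SET u"
  with u obtain v where v: "v \<in> hom SET B A" "v \<cdot>\<^bsub>SET\<^esub> u = Idn SET A" "u \<cdot>\<^bsub>SET\<^esub> v = Idn SET B"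
    by (auto simp: is_iso_def hom_def)
  show "bij_betw (arrow_fun u) A B"
  proof (rule bij_betw_byWitness[where f' = "arrow_fun v"])
    show "\<forall>x\<in>A. arrow_fun v (arrow_fun u x) = x" using v u by (metis arrow_fun_comp arrow_fun_Idn)
    show "\<forall>y\<in>B. arrow_fun u (arrow_fun v y) = y" using v u by (metis arrow_fun_comp arrow_fun_Idn)
  qed (use u v in \<open>auto simp: arrow_fun_in\<close>)
next
  assume b: "bij_betw (arrow_fun u) A B"
  let ?v = "set_arrow B (inv_into A (arrow_fun u)) A"
  have v: "?v \<in> hom SET B A" using b by (auto intro!: set_arrow_in bij_betw_apply[OF bij_betw_inv_into])
  have "?v \<cdot>\<^bsub>SET\<^esub> u = Idn SET A"
    using b u v by (intro hom_SET_eqI[OF SET_comp_in[OF u v] SET_Idn_in])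
      (simp add: arrow_fun_comp arrow_fun_Idn arrow_fun_in bij_betw_inv_into_left)
  moreover have "u \<cdot>\<^bsub>SET\<^esub> ?v = Idn SET B"
    using b u v by (intro hom_SET_eqI[OF SET_comp_in[OF v u] SET_Idn_in])
      (simp add: arrow_fun_comp[OF v u] arrow_fun_Idn bij_betw_inv_into_right)
  ultimately show "is_iso SET u" using is_isoI[OF u v] by simp
qed

lemma SET_category: "is_category SET"
proof
  fix f g h :: "'a set_arrow" and A B D E :: "'a univ set"
  show "Idn SET A \<in> hom SET A A" by (rule SET_Idn_in)
  assume f: "f \<in> hom SET A B"
  show "Idn SET B \<cdot>\<^bsub>SET\<^esub> f = f"
    by (rule hom_SET_eqI[OF SET_comp_in[OF f SET_Idn_in] f])
      (simp add: arrow_fun_comp[OF f SET_Idn_in] arrow_fun_Idn arrow_fun_in[OF f])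
  show "f \<cdot>\<^bsub>SET\<^esub> Idn SET A = f"
    by (rule hom_SET_eqI[OF SET_comp_in[OF SET_Idn_in f] f])
      (simp add: arrow_fun_comp[OF SET_Idn_in f] arrow_fun_Idn)
  assume g: "g \<in> hom SET B D"
  show "g \<cdot>\<^bsub>SET\<^esub> f \<in> hom SET A D" using f g by (rule SET_comp_in)
  assume h: "h \<in> hom SET D E"
  show "(h \<cdot>\<^bsub>SET\<^esub> g) \<cdot>\<^bsub>SET\<^esub> f = h \<cdot>\<^bsub>SET\<^esub> (g \<cdot>\<^bsub>SET\<^esub> f)"
    by (rule hom_SET_eqI[OF SET_comp_in[OF f SET_comp_in[OF g h]] SET_comp_in[OF SET_comp_in[OF f g] h]])
      (simp add: arrow_fun_comp[OF f SET_comp_in[OF g h]] arrow_fun_comp[OF SET_comp_in[OF f g] h]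
        arrow_fun_comp[OF f g] arrow_fun_comp[OF g h] arrow_fun_in[OF f])
qed (auto simp: SET_def)

lemma SET_moncat: "is_moncat SET"
proof -
  interpret is_category SET by (rule SET_category)
  show ?thesis
  proof
    fix f g h f' g' :: "'a set_arrow" and A B A' B' D D' E :: "'a univ set"
    show "f \<odot>\<^bsub>SET\<^esub> g \<in> hom SET (A \<otimes>\<^bsub>SET\<^esub> A') (B \<otimes>\<^bsub>SET\<^esub> B')" if "f \<in> hom SET A B" "g \<in> hom SET A' B'"
      using that SET_tenA_in by (simp add: SET_simps)
    show "Idn SET A \<odot>\<^bsub>SET\<^esub> Idn SET B = Idn SET (A \<otimes>\<^bsub>SET\<^esub> B)" for A B :: "'a univ set"
      by (auto simp: SET_simps SET_def set_arrow_def fun_eq_iff)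
    show "(g \<cdot>\<^bsub>SET\<^esub> f) \<odot>\<^bsub>SET\<^esub> (g' \<cdot>\<^bsub>SET\<^esub> f') = (g \<odot>\<^bsub>SET\<^esub> g') \<cdot>\<^bsub>SET\<^esub> (f \<odot>\<^bsub>SET\<^esub> f')"
      if "f \<in> hom SET A B" "g \<in> hom SET B D" "f' \<in> hom SET A' B'" "g' \<in> hom SET B' D'"
      using that by (elim hom_SET_cases) (auto simp: SET_tenA SET_comp set_arrow_def fun_eq_iff)
    show "assoc SET A B D \<in> hom SET ((A \<otimes>\<^bsub>SET\<^esub> B) \<otimes>\<^bsub>SET\<^esub> D) (A \<otimes>\<^bsub>SET\<^esub> (B \<otimes>\<^bsub>SET\<^esub> D))"
      for A B D :: "'a univ set" using SET_struct_in by (simp add: SET_simps)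
    show "is_iso SET (assoc SET A B D)" for A B D :: "'a univ set"
      unfolding SET_iso_iff[OF SET_struct_in(1)]
      by (rule bij_betw_byWitness[where f' = "\<lambda>z. Pr (Pr (pfst z) (pfst (psnd z))) (psnd (psnd z))"])
        (auto simp: SET_simps)
    show "assoc SET A' B' D' \<cdot>\<^bsub>SET\<^esub> ((f \<odot>\<^bsub>SET\<^esub> g) \<odot>\<^bsub>SET\<^esub> h) = (f \<odot>\<^bsub>SET\<^esub> (g \<odot>\<^bsub>SET\<^esub> h)) \<cdot>\<^bsub>SET\<^esub> assoc SET A B D"
      if "f \<in> hom SET A A'" "g \<in> hom SET B B'" "h \<in> hom SET D D'"
      using that by (elim hom_SET_cases) (auto simp: SET_tenA SET_comp SET_simps set_arrow_def fun_eq_iff)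
    show "lunit SET A \<in> hom SET (tunit SET \<otimes>\<^bsub>SET\<^esub> A) A" "runit SET A \<in> hom SET (A \<otimes>\<^bsub>SET\<^esub> tunit SET) A"
      for A :: "'a univ set" using SET_struct_in by (simp_all add: SET_simps)
    show "is_iso SET (lunit SET A)" for A :: "'a univ set"
      unfolding SET_iso_iff[OF SET_struct_in(2)]
      by (rule bij_betw_byWitness[where f' = "Pr Star"]) (auto simp: SET_simps)
    show "is_iso SET (runit SET A)" for A :: "'a univ set"
      unfolding SET_iso_iff[OF SET_struct_in(3)]
      by (rule bij_betw_byWitness[where f' = "\<lambda>x. Pr x Star"]) (auto simp: SET_simps)
    show "lunit SET B \<cdot>\<^bsub>SET\<^esub> (Idn SET (tunit SET) \<odot>\<^bsub>SET\<^esub> f) = f \<cdot>\<^bsub>SET\<^esub> lunit SET A"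
      "runit SET B \<cdot>\<^bsub>SET\<^esub> (f \<odot>\<^bsub>SET\<^esub> Idn SET (tunit SET)) = f \<cdot>\<^bsub>SET\<^esub> runit SET A"
      if "f \<in> hom SET A B"
      using that by (auto elim!: hom_SET_cases simp: PiE_iff SET_tenA SET_comp SET_simps set_arrow_def fun_eq_iff)
    show "(Idn SET A \<odot>\<^bsub>SET\<^esub> assoc SET B D E) \<cdot>\<^bsub>SET\<^esub> assoc SET A (B \<otimes>\<^bsub>SET\<^esub> D) E
            \<cdot>\<^bsub>SET\<^esub> (assoc SET A B D \<odot>\<^bsub>SET\<^esub> Idn SET E)
         = assoc SET A B (D \<otimes>\<^bsub>SET\<^esub> E) \<cdot>\<^bsub>SET\<^esub> assoc SET (A \<otimes>\<^bsub>SET\<^esub> B) D E" for A B D E :: "'a univ set"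
      unfolding SET_simps set_arrow_tenA
      by ((subst set_arrow_comp, force)+, auto intro!: set_arrow_cong)
    show "(Idn SET A \<odot>\<^bsub>SET\<^esub> lunit SET B) \<cdot>\<^bsub>SET\<^esub> assoc SET A (tunit SET) B = runit SET A \<odot>\<^bsub>SET\<^esub> Idn SET B"
      for A B :: "'a univ set"
      unfolding SET_simps set_arrow_tenA
      by ((subst set_arrow_comp, force)+, auto intro!: set_arrow_cong)
  qed (auto simp: SET_simps)
qed


section \<open>Sums and loops of relations\<close>

text \<open>The disjoint union of two relations, in the form it takes for the dependencies of a sum of
  interfaces.\<close>

definition rsum :: "('a univ \<times> 'a univ) set \<Rightarrow> ('a univ \<times> 'a univ) set \<Rightarrow> ('a univ \<times> 'a univ) set" where
  "rsum r s = (\<lambda>(i, j). (In1 i, In1 j)) ` r \<union> (\<lambda>(i, j). (In2 i, In2 j)) ` s"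

lemma rsum_iff [simp]:
  "(In1 x, z) \<in> rsum r s \<longleftrightarrow> (\<exists>y. z = In1 y \<and> (x, y) \<in> r)"
  "(In2 x, z) \<in> rsum r s \<longleftrightarrow> (\<exists>y. z = In2 y \<and> (x, y) \<in> s)"
  "(z, In1 y) \<in> rsum r s \<longleftrightarrow> (\<exists>x. z = In1 x \<and> (x, y) \<in> r)"
  "(z, In2 y) \<in> rsum r s \<longleftrightarrow> (\<exists>x. z = In2 x \<and> (x, y) \<in> s)"
  "(Star, z) \<notin> rsum r s" "(Atom a, z) \<notin> rsum r s" "(Pr a' b', z) \<notin> rsum r s"
  by (auto simp: rsum_def)

lemma rsumE [elim!, consumes 1, case_names In1 In2]:
  assumes "(a, b) \<in> rsum r s"
  obtains x y where "a = In1 x" "b = In1 y" "(x, y) \<in> r" | x y where "a = In2 x" "b = In2 y" "(x, y) \<in> s"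
  using assms by (auto simp: rsum_def)

lemma rsum_relcomp: "rsum r s O rsum r' s' = rsum (r O r') (s O s')"
proof (intro equalityI subrelI)
  fix a c assume "(a, c) \<in> rsum (r O r') (s O s')"
  then show "(a, c) \<in> rsum r s O rsum r' s'"
  proof (cases rule: rsumE)
    case (In1 x y)
    then obtain m where "(x, m) \<in> r" "(m, y) \<in> r'" by blast
    with In1 show ?thesis by (intro relcompI[of _ "In1 m"]) auto
  next
    case (In2 x y)
    then obtain m where "(x, m) \<in> s" "(m, y) \<in> s'" by blast
    with In2 show ?thesis by (intro relcompI[of _ "In2 m"]) auto
  qed
qed auto

lemma rsum_mono: "r \<subseteq> r' \<Longrightarrow> s \<subseteq> s' \<Longrightarrow> rsum r s \<subseteq> rsum r' s'"
  by (auto simp: rsum_def)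

lemma rsum_trancl: "(rsum r s)\<^sup>+ = rsum (r\<^sup>+) (s\<^sup>+)"
proof (intro equalityI subrelI)
  fix a b assume "(a, b) \<in> (rsum r s)\<^sup>+"
  then show "(a, b) \<in> rsum (r\<^sup>+) (s\<^sup>+)"
    by (induction rule: trancl_induct) (auto intro: trancl_into_trancl)
next
  have 1: "(In1 x, In1 y) \<in> (rsum r s)\<^sup>+" if "(x, y) \<in> r\<^sup>+" for x y
    using that by (induction rule: trancl_induct) (auto intro: trancl_into_trancl)
  have 2: "(In2 x, In2 y) \<in> (rsum r s)\<^sup>+" if "(x, y) \<in> s\<^sup>+" for x y
    using that by (induction rule: trancl_induct) (auto intro: trancl_into_trancl)
  fix a b assume "(a, b) \<in> rsum (r\<^sup>+) (s\<^sup>+)"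
  then show "(a, b) \<in> (rsum r s)\<^sup>+" using 1 2 by auto
qed

lemma rsum_acyclic: "acyclic (rsum r s) \<longleftrightarrow> acyclic r \<and> acyclic s"
proof -
  have "(z, z) \<in> rsum (r\<^sup>+) (s\<^sup>+) \<longleftrightarrow>
      (\<exists>x. z = In1 x \<and> (x, x) \<in> r\<^sup>+) \<or> (\<exists>x. z = In2 x \<and> (x, x) \<in> s\<^sup>+)" for z
    by auto
  then show ?thesis unfolding acyclic_def rsum_trancl by blast
qed

lemma rsum_rtrancl_relcomp: "(rsum r s)\<^sup>* O rsum a b = rsum (r\<^sup>* O a) (s\<^sup>* O b)"
proof -
  have "rsum a b \<union> (rsum r s)\<^sup>+ O rsum a b = rsum (a \<union> r\<^sup>+ O a) (b \<union> s\<^sup>+ O b)"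
    unfolding rsum_trancl rsum_relcomp by (auto simp: rsum_def)
  then show ?thesis
    by (simp add: rtrancl_trancl_reflcl relcomp_distrib2 Un_commute)
qed

text \<open>In a wiring graph, dependencies lead from in ports to out ports and trace wires lead back.
  Taking two edges at a time leaves a relation on the in ports only.\<close>

lemma two_sided_loop:
  fixes d W :: "('a \<times> 'a) set"
  defines "R \<equiv> (\<lambda>(a, b). (Inl a, Inr b)) ` d \<union> (\<lambda>(a, b). (Inr a, Inl b)) ` W"
  shows "(Inl i, Inr j) \<in> R\<^sup>* \<longleftrightarrow> (i, j) \<in> (d O W)\<^sup>* O d"
    and "acyclic R \<longleftrightarrow> acyclic (d O W)"
proof -
  have fwd: "case z of Inl k \<Rightarrow> (i, k) \<in> (d O W)\<^sup>+ | Inr k \<Rightarrow> (i, k) \<in> (d O W)\<^sup>* O d"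
    if "(Inl i, z) \<in> R\<^sup>+" for i z
    using that
  proof (induction rule: trancl_induct)
    case (base z)
    then show ?case by (auto simp: R_def)
  next
    case (step y z)
    from step.hyps(2) consider k l where "y = Inl k" "z = Inr l" "(k, l) \<in> d"
      | k l where "y = Inr k" "z = Inl l" "(k, l) \<in> W"
      by (auto simp: R_def)
    then show ?case
    proof cases
      case 1
      with step.IH have "(i, k) \<in> (d O W)\<^sup>*" by simp
      with 1 show ?thesis by auto
    next
      case 2
      with step.IH obtain m where "(i, m) \<in> (d O W)\<^sup>*" "(m, k) \<in> d" by auto
      with 2 show ?thesis by (auto intro: rtrancl_into_trancl1)
    qed
  qed
  have two: "(Inl i, Inl k) \<in> R\<^sup>+" if "(i, k) \<in> d O W" for i k
    using that unfolding R_def by (fastforce intro: trancl_into_trancl)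
  have bwd: "(Inl i, Inl k) \<in> R\<^sup>+" if "(i, k) \<in> (d O W)\<^sup>+" for i k
    using that
  proof (induction rule: trancl_induct)
    case (base y)
    then show ?case by (rule two)
  next
    case (step y z)
    then show ?case using two by (meson trancl_trans)
  qed
  show "(Inl i, Inr j) \<in> R\<^sup>* \<longleftrightarrow> (i, j) \<in> (d O W)\<^sup>* O d"
  proof
    assume "(Inl i, Inr j) \<in> R\<^sup>*"
    then have "(Inl i, Inr j) \<in> R\<^sup>+" by (auto simp: rtrancl_eq_or_trancl)
    from fwd[OF this] show "(i, j) \<in> (d O W)\<^sup>* O d" by simp
  next
    assume "(i, j) \<in> (d O W)\<^sup>* O d"
    then obtain k where k: "(i, k) \<in> (d O W)\<^sup>*" "(k, j) \<in> d" by blast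
    then have "(Inl i, Inl k) \<in> R\<^sup>*" using bwd by (auto simp: rtrancl_eq_or_trancl)
    moreover have "(Inl k, Inr j) \<in> R" using k(2) by (auto simp: R_def)
    ultimately show "(Inl i, Inr j) \<in> R\<^sup>*" by (rule rtrancl_into_rtrancl)
  qed
  have no_loop: "(Inl i, Inl i) \<notin> R\<^sup>+" if "acyclic (d O W)" for i
    using fwd[of i "Inl i"] that by (auto simp: acyclic_def)
  show "acyclic R \<longleftrightarrow> acyclic (d O W)"
  proof
    assume "acyclic R"
    then show "acyclic (d O W)" using bwd by (auto simp: acyclic_def)
  next
    assume ac: "acyclic (d O W)"
    show "acyclic R"
    proof (rule acyclicI, intro allI notI)
      fix z assume z: "(z, z) \<in> R\<^sup>+"
      show False
      proof (cases z)
        case (Inl i)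
        with z no_loop[OF ac] show ?thesis by blast
      next
        case (Inr j)
        from z obtain y where y: "(z, y) \<in> R" "(y, z) \<in> R\<^sup>*" by (meson tranclD)
        with Inr obtain i where "y = Inl i" by (auto simp: R_def)
        moreover have "(y, y) \<in> R\<^sup>+" using y by (meson rtrancl_into_trancl1)
        ultimately show ?thesis using no_loop[OF ac] by blast
      qed
    qed
  qed
qed

lemma span_rel_iff: "(a, b) \<in> span_rel S \<longleftrightarrow> (\<exists>r\<in>apex S. src S r = a \<and> tgt S r = b)"
  by (auto simp: span_rel_def)

lemma span_rel_fibre: "span_rel (S \<Zcomp> T) = span_rel S O span_rel T"
proof (intro equalityI subrelI)
  fix a b assume "(a, b) \<in> span_rel (S \<Zcomp> T)"
  then show "(a, b) \<in> span_rel S O span_rel T" by (auto simp: span_rel_iff fibre_span_def relcomp_unfold) metis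
next
  fix a b assume "(a, b) \<in> span_rel S O span_rel T"
  then obtain r t where "r \<in> apex S" "t \<in> apex T" "src S r = a" "tgt S r = src T t" "tgt T t = b"
    by (auto simp: span_rel_iff relcomp_unfold)
  then have "Pr r t \<in> apex (S \<Zcomp> T)" "src (S \<Zcomp> T) (Pr r t) = a" "tgt (S \<Zcomp> T) (Pr r t) = b"
    by (auto simp: fibre_span_def)
  then show "(a, b) \<in> span_rel (S \<Zcomp> T)" unfolding span_rel_iff by blast
qed

lemma span_rel_join: "span_rel (S \<squnion>\<^sub>s T) = span_rel S \<union> span_rel T"
  by (auto simp: span_rel_def join_span_def usum_def image_Un image_image)

lemma span_rel_sum: "span_rel (S +\<^sub>s T) = rsum (span_rel S) (span_rel T)"
  by (auto simp: span_rel_def sum_span_def rsum_def usum_def image_Un image_image)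

section \<open>Composition of wirings\<close>

abbreviation in_matrix :: "'a wiring \<Rightarrow> 'a univ \<Rightarrow> 'a univ \<Rightarrow> nat" where
  "in_matrix f \<equiv> span_matrix (win f)"

abbreviation trace_matrix :: "'a wiring \<Rightarrow> 'a univ \<Rightarrow> 'a univ \<Rightarrow> nat" where
  "trace_matrix f \<equiv> span_matrix (wtrace f)"

abbreviation out_matrix :: "'a wiring \<Rightarrow> 'a univ \<Rightarrow> 'a univ \<Rightarrow> nat" where
  "out_matrix f \<equiv> span_matrix (wout f)"

definition same_wires :: "'a wiring \<Rightarrow> 'a wiring \<Rightarrow> bool" where
  "same_wires f g \<longleftrightarrow> in_matrix f = in_matrix g \<and> trace_matrix f = trace_matrix g \<and>
     out_matrix f = out_matrix g"

lemma is_wiring_spans: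
  assumes "is_wiring X Y f"
  shows "is_fspan (in_ports Y) (win f) (in_ports X)" "is_fspan (out_ports X) (wtrace f) (in_ports X)"
    "is_fspan (out_ports X) (wout f) (out_ports Y)"
    "finite (apex (win f))" "finite (apex (wtrace f))" "finite (apex (wout f))"
    "msupp (in_ports Y) (in_ports X) (in_matrix f)" "msupp (out_ports X) (in_ports X) (trace_matrix f)"
    "msupp (out_ports X) (out_ports Y) (out_matrix f)"
  using assms by (auto simp: is_wiring_def msupp_span_matrix) (auto simp: is_fspan_def)

lemma finite_ports:
  "is_interface X \<Longrightarrow> finite (in_ports X)" "is_interface X \<Longrightarrow> finite (out_ports X)"
  by (auto simp: is_interface_def)

lemma wiring_iso_iff:
  "is_wiring X Y f \<Longrightarrow> is_wiring X' Y' g \<Longrightarrow> wiring_iso f g \<longleftrightarrow> same_wires f g"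
  by (simp add: wiring_iso_def same_wires_def span_iso_iff_matrix is_wiring_spans)

lemma mem_wiring_class:
  "is_wiring X Y f \<Longrightarrow> g \<in> wiring_class X Y f \<longleftrightarrow> is_wiring X Y g \<and> same_wires f g"
  by (auto simp: wiring_class_def wiring_iso_iff)

lemma wiring_class_eqI:
  assumes "is_wiring X Y f" "is_wiring X Y g" "same_wires f g"
  shows "wiring_class X Y f = wiring_class X Y g"
  using assms by (auto simp: mem_wiring_class same_wires_def)

lemma self_in_wiring_class: "is_wiring X Y f \<Longrightarrow> f \<in> wiring_class X Y f"
  by (simp add: mem_wiring_class same_wires_def)

text \<open>Arrows are classes of wirings, but by this rule their equations are statements about matrices.\<close>

lemma dwd_arrow_eqI:
  assumes "is_wiring X Y f" "is_wiring X Y g" "in_matrix f = in_matrix g"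
    "trace_matrix f = trace_matrix g" "out_matrix f = out_matrix g"
  shows "dwd_arrow X f Y = dwd_arrow X g Y"
  unfolding dwd_arrow_def using wiring_class_eqI[OF assms(1,2)] assms(3-5) by (simp add: same_wires_def)

lemma is_wiring_comp:
  "is_wiring X Y f \<Longrightarrow> is_wiring Y Z g \<Longrightarrow> is_wiring X Z (comp_wiring g f)"
  by (auto simp: is_wiring_def comp_wiring_def)

lemma comp_wiring_matrices:
  assumes "is_wiring X Y f" "is_wiring Y Z g" "is_interface X" "is_interface Y"
  shows "in_matrix (comp_wiring g f) = mmul (in_ports Y) (in_matrix g) (in_matrix f)"
    "trace_matrix (comp_wiring g f) = madd (trace_matrix f)
       (mmul (out_ports Y) (out_matrix f) (mmul (in_ports Y) (trace_matrix g) (in_matrix f)))"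
    "out_matrix (comp_wiring g f) = mmul (out_ports Y) (out_matrix f) (out_matrix g)"
proof -
  note f = is_wiring_spans[OF assms(1)] and g = is_wiring_spans[OF assms(2)]
  have VI: "is_fspan (out_ports Y) (wtrace g \<Zcomp> win f) (in_ports X)" using f g by blast
  have OVI: "is_fspan (out_ports X) (wout f \<Zcomp> wtrace g \<Zcomp> win f) (in_ports X)" using f VI by blast
  show "in_matrix (comp_wiring g f) = mmul (in_ports Y) (in_matrix g) (in_matrix f)"
    "out_matrix (comp_wiring g f) = mmul (out_ports Y) (out_matrix f) (out_matrix g)"
    using f g assms(3,4) by (simp_all add: comp_wiring_def span_matrix_fibre finite_ports)
  have "finite (apex (wout f \<Zcomp> wtrace g \<Zcomp> win f))" using OVI by (simp add: is_fspan_def)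
  then show "trace_matrix (comp_wiring g f) = madd (trace_matrix f)
       (mmul (out_ports Y) (out_matrix f) (mmul (in_ports Y) (trace_matrix g) (in_matrix f)))"
    using f assms(3,4) by (simp add: comp_wiring_def span_matrix_join finite_ports
        span_matrix_fibre[OF f(3) VI] span_matrix_fibre[OF g(2) f(1)])
qed

lemma comp_wiring_cong:
  assumes "is_wiring X Y f" "is_wiring Y Z g" "is_interface X" "is_interface Y"
    "is_wiring X Y f'" "is_wiring Y Z g'" "same_wires f f'" "same_wires g g'"
  shows "same_wires (comp_wiring g f) (comp_wiring g' f')"
  using assms(7,8) unfolding same_wires_def comp_wiring_matrices[OF assms(1-4)]
    comp_wiring_matrices[OF assms(5,6,3,4)] by simp

section \<open>Dependencies of composites\<close>

lemma wf_wiring_graph: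
  assumes "is_interface X" "is_wiring X Y f"
  shows "wf_digraph (wiring_graph X f)"
proof -
  have d: "a \<in> in_ports X \<and> b \<in> out_ports X" if "(a, b) \<in> dep X" for a b
    using that assms(1) by (auto simp: is_interface_def)
  have w: "src (wtrace f) r \<in> out_ports X \<and> tgt (wtrace f) r \<in> in_ports X" if "r \<in> apex (wtrace f)" for r
    using that assms(2) by (auto simp: is_wiring_def is_fspan_def)
  show ?thesis
    by (rule wf_digraph.intro) (auto simp: wiring_graph_def w dest: d)
qed

lemma arcs_ends_wiring_graph:
  "arcs_ends (wiring_graph X f) =
     (\<lambda>(a, b). (Inl a, Inr b)) ` dep X \<union> (\<lambda>(a, b). (Inr a, Inl b)) ` span_rel (wtrace f)"
  by (force simp: arcs_ends_def arc_to_ends_def wiring_graph_def span_rel_def)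

lemma acyclic_wiring_graph:
  assumes "is_interface X" "is_wiring X Y f"
  shows "acyclic_graph (wiring_graph X f) \<longleftrightarrow> acyclic (dep X O span_rel (wtrace f))"
  unfolding acyclic_graph_iff[OF wf_wiring_graph[OF assms]] arcs_ends_wiring_graph two_sided_loop(2) ..

lemma induced_dep_eq:
  assumes "is_interface X" "is_wiring X Y f"
  shows "induced_dep X f =
    span_rel (win f) O (dep X O span_rel (wtrace f))\<^sup>* O dep X O span_rel (wout f)"
proof -
  let ?G = "wiring_graph X f"
  have "(\<exists>p. pre_digraph.awalk ?G (Inl (tgt (win f) w)) p (Inr (src (wout f) w'))) \<longleftrightarrow>
    (tgt (win f) w, src (wout f) w') \<in> (dep X O span_rel (wtrace f))\<^sup>* O dep X"
    if "w \<in> apex (win f)" for w w'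
    using that assms(2) two_sided_loop(1)[of _ _ "dep X" "span_rel (wtrace f)"]
    unfolding awalk_iff_reachable[OF wf_wiring_graph[OF assms]] arcs_ends_wiring_graph
    by (auto simp: wiring_graph_def is_wiring_def is_fspan_def Pi_iff)
  then have "induced_dep X f = {(src (win f) w, tgt (wout f) w') | w w'.
     w \<in> apex (win f) \<and> w' \<in> apex (wout f) \<and>
    (tgt (win f) w, src (wout f) w') \<in> (dep X O span_rel (wtrace f))\<^sup>* O dep X}"
    unfolding induced_dep_def by blast
  also have "\<dots> = span_rel (win f) O ((dep X O span_rel (wtrace f))\<^sup>* O dep X) O span_rel (wout f)"
    by (auto simp: span_rel_def)
  finally show ?thesis by (simp add: O_assoc)
qed

lemma is_dep_wiring_iff:
  "is_dep_wiring X Y f \<longleftrightarrow> is_interface X \<and> is_interface Y \<and> is_wiring X Y f \<and>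
     span_rel (win f) O (dep X O span_rel (wtrace f))\<^sup>* O dep X O span_rel (wout f) \<subseteq> dep Y \<and>
     acyclic (dep X O span_rel (wtrace f))"
  unfolding is_dep_wiring_def using induced_dep_eq acyclic_wiring_graph by blast

lemma is_dep_wiringD:
  assumes "is_dep_wiring X Y f" shows "is_interface X" "is_interface Y" "is_wiring X Y f"
  using assms by (auto simp: is_dep_wiring_def)

lemma is_dep_wiring_cong:
  assumes "is_dep_wiring X Y f" "is_wiring X Y g" "same_wires f g"
  shows "is_dep_wiring X Y g"
proof -
  have "span_rel (win f) = span_rel (win g)" "span_rel (wtrace f) = span_rel (wtrace g)"
    "span_rel (wout f) = span_rel (wout g)"
    using assms is_dep_wiringD(3)[OF assms(1)]
    by (simp_all add: span_rel_matrix is_wiring_spans same_wires_def)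
  with assms show ?thesis by (simp add: is_dep_wiring_iff)
qed

text \<open>The inner graph is the wiring graph of \<open>f\<close>, followed two edges at a time; it is fed back
  through the trace wires of \<open>g\<close>. The dependency that \<open>f\<close> induces is contained in that of \<open>Y\<close>.\<close>

lemma is_dep_wiring_comp:
  assumes f: "is_dep_wiring X Y f" and g: "is_dep_wiring Y Z g"
  shows "is_dep_wiring X Z (comp_wiring g f)"
proof -
  define I L O\<^sub>0 W where "I = span_rel (win f)" and "L = dep X O span_rel (wtrace f)"
    and "O\<^sub>0 = dep X O span_rel (wout f)" and "W = span_rel (wtrace g)"
  have rels: "span_rel (win (comp_wiring g f)) = span_rel (win g) O I"
    "dep X O span_rel (wtrace (comp_wiring g f)) = L \<union> O\<^sub>0 O W O I"
    "dep X O span_rel (wout (comp_wiring g f)) = O\<^sub>0 O span_rel (wout g)"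
    unfolding I_def L_def O\<^sub>0_def W_def comp_wiring_def
    by (simp_all add: span_rel_join span_rel_fibre O_assoc relcomp_distrib)
  have "I O L\<^sup>* O O\<^sub>0 \<subseteq> dep Y" "acyclic L" "acyclic (dep Y O W)"
    using f g by (auto simp: is_dep_wiring_iff I_def L_def O\<^sub>0_def W_def)
  note within = feedback_within[OF this]
  have "span_rel (win g) O (dep Y O W)\<^sup>* O dep Y O span_rel (wout g) \<subseteq> dep Z"
    using g by (simp add: is_dep_wiring_iff W_def)
  then have "span_rel (win g) O I O (L \<union> O\<^sub>0 O W O I)\<^sup>* O O\<^sub>0 O span_rel (wout g) \<subseteq> dep Z"
    using within(2) by (rule order_trans[rotated])
  then show ?thesis
    using f g within(1) is_wiring_comp[of X Y f Z g] unfolding is_dep_wiring_iff rels by (simp add: O_assoc)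
qed

section \<open>Sums of wirings\<close>

lemma sum_interface_simps [simp]:
  "in_ports (sum_interface X Y) = usum (in_ports X) (in_ports Y)"
  "out_ports (sum_interface X Y) = usum (out_ports X) (out_ports Y)"
  "dep (sum_interface X Y) = rsum (dep X) (dep Y)"
  by (simp_all add: sum_interface_def rsum_def)

lemma empty_interface_simps [simp]:
  "in_ports empty_interface = {}" "out_ports empty_interface = {}" "dep empty_interface = {}"
  by (simp_all add: empty_interface_def)

lemma is_interface_sum [simp]: "is_interface X \<Longrightarrow> is_interface Y \<Longrightarrow> is_interface (sum_interface X Y)"
  by (auto simp: is_interface_def rsum_def)

lemma is_interface_empty [simp]: "is_interface empty_interface"
  by (simp add: is_interface_def)

lemma sum_wiring_matrices:
  "in_matrix (sum_wiring f g) = mdiag (in_matrix f) (in_matrix g)"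
  "trace_matrix (sum_wiring f g) = mdiag (trace_matrix f) (trace_matrix g)"
  "out_matrix (sum_wiring f g) = mdiag (out_matrix f) (out_matrix g)"
  by (simp_all add: sum_wiring_def span_matrix_sum)

lemma is_wiring_sum:
  "is_wiring X Y f \<Longrightarrow> is_wiring X' Y' g \<Longrightarrow>
    is_wiring (sum_interface X X') (sum_interface Y Y') (sum_wiring f g)"
  by (auto simp: is_wiring_def sum_wiring_def)

lemma is_dep_wiring_sum:
  assumes "is_dep_wiring X Y f" "is_dep_wiring X' Y' g"
  shows "is_dep_wiring (sum_interface X X') (sum_interface Y Y') (sum_wiring f g)"
proof -
  let ?S = "sum_interface X X'" and ?f = "sum_wiring f g"
  have rels: "span_rel (win ?f) = rsum (span_rel (win f)) (span_rel (win g))"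
    "dep ?S O span_rel (wtrace ?f) = rsum (dep X O span_rel (wtrace f)) (dep X' O span_rel (wtrace g))"
    "dep ?S O span_rel (wout ?f) = rsum (dep X O span_rel (wout f)) (dep X' O span_rel (wout g))"
    by (simp_all add: sum_wiring_def span_rel_sum rsum_relcomp)
  show ?thesis
    using assms unfolding is_dep_wiring_iff rels
    by (simp add: rsum_rtrancl_relcomp rsum_relcomp rsum_acyclic rsum_mono is_wiring_sum)
qed

section \<open>Relabellings of ports\<close>

text \<open>One map relabels both the in ports and the out ports. As it is injective on their union, it has
  an inverse that is again a single map.\<close>

definition port_iso :: "'a interface \<Rightarrow> 'a interface \<Rightarrow> ('a univ \<Rightarrow> 'a univ) \<Rightarrow> bool" where
  "port_iso X Y p \<longleftrightarrow> is_interface X \<and> is_interface Y \<and> inj_on p (in_ports X \<union> out_ports X) \<and>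
     p ` in_ports X = in_ports Y \<and> p ` out_ports X = out_ports Y \<and> dep Y = map_prod p p ` dep X"

lemma port_isoD:
  assumes "port_iso X Y p"
  shows "is_interface X" "is_interface Y" "bij_betw p (in_ports X) (in_ports Y)"
    "bij_betw p (out_ports X) (out_ports Y)" "p \<in> in_ports X \<rightarrow> in_ports Y" "p \<in> out_ports X \<rightarrow> out_ports Y"
  using assms by (auto simp: port_iso_def bij_betw_def intro: inj_on_subset)

lemma relabel_matrices:
  "in_matrix (relabel_wiring p X) = mcograph p (in_ports X)"
  "trace_matrix (relabel_wiring p X) = mzero"
  "out_matrix (relabel_wiring p X) = mgraph p (out_ports X)"
  by (simp_all add: relabel_wiring_def span_matrix_fun span_matrix_cofun)

lemma is_dep_wiring_relabel:
  assumes "port_iso X Y p" shows "is_dep_wiring X Y (relabel_wiring p X)"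
proof -
  have "is_wiring X Y (relabel_wiring p X)"
    using assms by (auto simp: is_wiring_def relabel_wiring_def is_fspan_def empty_span_def port_iso_def finite_ports)
  moreover have "span_rel (win (relabel_wiring p X)) O dep X O span_rel (wout (relabel_wiring p X)) \<subseteq> dep Y"
    using assms by (auto simp: span_rel_def relabel_wiring_def port_iso_def)
  ultimately show ?thesis using port_isoD[OF assms]
    by (simp add: is_dep_wiring_iff relabel_wiring_def empty_span_def span_rel_def acyclic_def)
qed

lemma id_wiring_relabel: "id_wiring X = relabel_wiring (\<lambda>x. x) X"
  by (simp add: id_wiring_def relabel_wiring_def id_span_def)

definition relabelling :: "('a univ \<Rightarrow> 'a univ) \<Rightarrow> 'a interface \<Rightarrow> 'a interface \<Rightarrow> 'a dwd_arrow" where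
  "relabelling p X Y = dwd_arrow X (relabel_wiring p X) Y"

lemma port_iso_id [simp]: "is_interface X \<Longrightarrow> port_iso X X (\<lambda>x. x)"
  by (auto simp: port_iso_def inj_on_def map_prod_def)

lemma port_iso_comp:
  assumes "port_iso X Y p" "port_iso Y Z q" shows "port_iso X Z (\<lambda>x. q (p x))"
proof -
  have "inj_on (q \<circ> p) (in_ports X \<union> out_ports X)"
    using assms by (intro comp_inj_on) (auto simp: port_iso_def image_Un)
  moreover have "(\<lambda>x. q (p x)) ` in_ports X = in_ports Z" "(\<lambda>x. q (p x)) ` out_ports X = out_ports Z"
    using assms by (metis image_image port_iso_def)+
  ultimately show ?thesis using assms
    by (simp add: port_iso_def o_def image_image map_prod_def split_beta)
qed

lemma port_iso_inverse:
  assumes p: "port_iso X Y p"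
  defines "q \<equiv> inv_into (in_ports X \<union> out_ports X) p"
  shows "port_iso Y X q" "\<And>x. x \<in> in_ports X \<union> out_ports X \<Longrightarrow> q (p x) = x"
    "\<And>y. y \<in> in_ports Y \<union> out_ports Y \<Longrightarrow> p (q y) = y"
proof -
  have inj: "inj_on p (in_ports X \<union> out_ports X)" and im: "p ` (in_ports X \<union> out_ports X) = in_ports Y \<union> out_ports Y"
    using p by (auto simp: port_iso_def)
  show qp: "q (p x) = x" if "x \<in> in_ports X \<union> out_ports X" for x
    unfolding q_def using inv_into_f_f[OF inj that] .
  show "p (q y) = y" if "y \<in> in_ports Y \<union> out_ports Y" for y
    unfolding q_def using that im by (metis f_inv_into_f)
  have "inj_on q (in_ports Y \<union> out_ports Y)" unfolding q_def im[symmetric] by (rule inj_on_inv_into) simp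
  moreover have "q ` in_ports Y = in_ports X" "q ` out_ports Y = out_ports X"
  proof -
    have "in_ports Y = p ` in_ports X" "out_ports Y = p ` out_ports X" using p by (simp_all add: port_iso_def)
    then show "q ` in_ports Y = in_ports X" "q ` out_ports Y = out_ports X"
      using qp by (simp_all add: image_image cong: image_cong)
  qed
  moreover have "map_prod q q ` dep Y = dep X"
  proof -
    have "map_prod q q (map_prod p p e) = e" if "e \<in> dep X" for e
      using that p qp by (cases e) (auto simp: port_iso_def is_interface_def)
    then show ?thesis using p by (auto simp: port_iso_def image_image)
  qed
  ultimately show "port_iso Y X q" using p by (simp add: port_iso_def)
qed

section \<open>The monoidal category of dependent wirings\<close>

lemma dDWD_simps:
  "Ob dDWD = {X. is_interface X}" "Arr dDWD = {dwd_arrow X f Y | X f Y. is_dep_wiring X Y f}"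
  "Dom dDWD (dwd_arrow X f Y) = X" "Cod dDWD (dwd_arrow X f Y) = Y"
  "Idn dDWD X = relabelling (\<lambda>x. x) X X" "tunit dDWD = empty_interface"
  "X \<otimes>\<^bsub>dDWD\<^esub> Y = sum_interface X Y"
  by (simp_all add: dDWD_def dwd_arrow_def relabelling_def id_wiring_relabel)

lemma hom_dDWD: "\<Phi> \<in> hom dDWD X Y \<longleftrightarrow> (\<exists>f. \<Phi> = dwd_arrow X f Y \<and> is_dep_wiring X Y f)"
  by (auto simp: hom_def dDWD_simps)

lemma dDWD_comp:
  assumes f: "is_dep_wiring X Y f" and g: "is_dep_wiring Y Z g"
  shows "dwd_arrow Y g Z \<cdot>\<^bsub>dDWD\<^esub> dwd_arrow X f Y = dwd_arrow X (comp_wiring g f) Z"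
proof -
  note fd = is_dep_wiringD[OF f] and gd = is_dep_wiringD[OF g]
  have "wiring_class X Z (comp_wiring g' f') = wiring_class X Z (comp_wiring g f)"
    if "g' \<in> wiring_class Y Z g" "f' \<in> wiring_class X Y f" for g' f'
    using that fd gd
    by (intro wiring_class_eqI is_wiring_comp comp_wiring_cong)
      (auto simp: mem_wiring_class same_wires_def)
  moreover have "g \<in> wiring_class Y Z g" "f \<in> wiring_class X Y f"
    using fd gd by (simp_all add: self_in_wiring_class)
  ultimately have "(\<Union>g'\<in>wiring_class Y Z g. \<Union>f'\<in>wiring_class X Y f. wiring_class X Z (comp_wiring g' f'))
      = wiring_class X Z (comp_wiring g f)" by blast
  then show ?thesis by (simp add: dDWD_def dwd_arrow_def)
qed

lemma dDWD_tenA: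
  assumes f: "is_dep_wiring X Y f" and g: "is_dep_wiring X' Y' g"
  shows "dwd_arrow X f Y \<odot>\<^bsub>dDWD\<^esub> dwd_arrow X' g Y' =
    dwd_arrow (sum_interface X X') (sum_wiring f g) (sum_interface Y Y')"
proof -
  note fd = is_dep_wiringD[OF f] and gd = is_dep_wiringD[OF g]
  let ?C = "wiring_class (sum_interface X X') (sum_interface Y Y')"
  have "?C (sum_wiring f' g') = ?C (sum_wiring f g)"
    if "f' \<in> wiring_class X Y f" "g' \<in> wiring_class X' Y' g" for g' f'
    using that fd gd
    by (intro wiring_class_eqI is_wiring_sum) (auto simp: mem_wiring_class same_wires_def sum_wiring_matrices)
  moreover have "f \<in> wiring_class X Y f" "g \<in> wiring_class X' Y' g"
    using fd gd by (simp_all add: self_in_wiring_class)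
  ultimately have "(\<Union>f'\<in>wiring_class X Y f. \<Union>g'\<in>wiring_class X' Y' g. ?C (sum_wiring f' g'))
      = ?C (sum_wiring f g)" by blast
  then show ?thesis by (simp add: dDWD_def dwd_arrow_def)
qed

lemma relabelling_in: "port_iso X Y p \<Longrightarrow> relabelling p X Y \<in> hom dDWD X Y"
  unfolding hom_dDWD relabelling_def using is_dep_wiring_relabel by blast

lemma relabelling_cong:
  "(\<And>x. x \<in> in_ports X \<union> out_ports X \<Longrightarrow> p x = q x) \<Longrightarrow> port_iso X Y p \<Longrightarrow> port_iso X Y q \<Longrightarrow>
    relabelling p X Y = relabelling q X Y"
  unfolding relabelling_def using is_dep_wiring_relabel[THEN is_dep_wiringD(3)]
  by (intro dwd_arrow_eqI) (auto simp: relabel_matrices mgraph_def mcograph_def fun_eq_iff)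

lemma relabelling_comp:
  assumes "port_iso X Y p" "port_iso Y Z q"
  shows "relabelling q Y Z \<cdot>\<^bsub>dDWD\<^esub> relabelling p X Y = relabelling (\<lambda>x. q (p x)) X Z"
proof -
  note p = is_dep_wiring_relabel[OF assms(1)] and q = is_dep_wiring_relabel[OF assms(2)]
    and qp = is_dep_wiring_relabel[OF port_iso_comp[OF assms]]
  note m = comp_wiring_matrices[OF is_dep_wiringD(3)[OF p] is_dep_wiringD(3)[OF q] is_dep_wiringD(1)[OF p]
      is_dep_wiringD(1)[OF q], unfolded relabel_matrices]
  note pd = port_isoD[OF assms(1)]
  show ?thesis unfolding relabelling_def dDWD_comp[OF p q]
  proof (rule dwd_arrow_eqI)
    show "is_wiring X Z (comp_wiring (relabel_wiring q Y) (relabel_wiring p X))"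
      using p q by (meson is_dep_wiringD is_wiring_comp)
    show "is_wiring X Z (relabel_wiring (\<lambda>x. q (p x)) X)" using qp by (rule is_dep_wiringD)
    show "in_matrix (comp_wiring (relabel_wiring q Y) (relabel_wiring p X)) = in_matrix (relabel_wiring (\<lambda>x. q (p x)) X)"
      unfolding m relabel_matrices using pd
      by (intro ext) (simp add: mmul_mcograph_right finite_ports, auto simp: mcograph_def mgraph_def)
    show "out_matrix (comp_wiring (relabel_wiring q Y) (relabel_wiring p X)) = out_matrix (relabel_wiring (\<lambda>x. q (p x)) X)"
      unfolding m relabel_matrices using pd
      by (intro ext) (simp add: mmul_mgraph_left finite_ports, auto simp: mgraph_def)
  qed (simp add: m relabel_matrices)
qed

lemma port_iso_sum:
  assumes "port_iso X Y p" "port_iso X' Y' q"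
  shows "port_iso (sum_interface X X') (sum_interface Y Y') (copair (\<lambda>x. In1 (p x)) (\<lambda>y. In2 (q y)))"
  using assms unfolding port_iso_def
  by (auto simp: inj_on_def usum_def image_Un image_image rsum_def map_prod_def split_beta)

lemma relabelling_tenA:
  assumes "port_iso X Y p" "port_iso X' Y' q"
  shows "relabelling p X Y \<odot>\<^bsub>dDWD\<^esub> relabelling q X' Y' =
    relabelling (copair (\<lambda>x. In1 (p x)) (\<lambda>y. In2 (q y))) (sum_interface X X') (sum_interface Y Y')"
  unfolding relabelling_def dDWD_tenA[OF is_dep_wiring_relabel[OF assms(1)] is_dep_wiring_relabel[OF assms(2)]]
  by (intro dwd_arrow_eqI is_wiring_sum is_dep_wiring_relabel[THEN is_dep_wiringD(3)] port_iso_sum assms)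
    (simp_all add: sum_wiring_matrices relabel_matrices mdiag_mgraph mdiag_mcograph)

lemma relabelling_iso:
  assumes "port_iso X Y p" shows "is_iso dDWD (relabelling p X Y)"
proof -
  note q = port_iso_inverse[OF assms]
  let ?q = "inv_into (in_ports X \<union> out_ports X) p"
  have "relabelling ?q Y X \<cdot>\<^bsub>dDWD\<^esub> relabelling p X Y = Idn dDWD X"
    unfolding relabelling_comp[OF assms q(1)] dDWD_simps
    by (intro relabelling_cong port_iso_comp[OF assms q(1)] q(2) port_iso_id port_isoD(1)[OF assms])
  moreover have "relabelling p X Y \<cdot>\<^bsub>dDWD\<^esub> relabelling ?q Y X = Idn dDWD Y"
    unfolding relabelling_comp[OF q(1) assms] dDWD_simps
    by (intro relabelling_cong port_iso_comp[OF q(1) assms] q(3) port_iso_id port_isoD(2)[OF assms])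
  moreover have "relabelling p X Y \<in> hom dDWD X Y" "relabelling ?q Y X \<in> hom dDWD Y X"
    using assms q(1) by (simp_all add: relabelling_in)
  ultimately show ?thesis by (metis is_isoI)
qed

text \<open>A bijection that carries one matrix to another can be moved past it in three ways, which occur
  for input, output and trace wires respectively.\<close>

lemma matrix_conjugation:
  assumes fin: "finite A" "finite B" "finite A'" "finite B'"
    and supp: "msupp A B M" "msupp A' B' M'" and p: "bij_betw p A A'" and q: "bij_betw q B B'"
    and eq: "\<And>a b. a \<in> A \<Longrightarrow> b \<in> B \<Longrightarrow> M' (p a) (q b) = M a b"
  shows "mmul A (mcograph p A) M = mmul B' M' (mcograph q B)"
    and "mmul B M (mgraph q B) = mmul A' (mgraph p A) M'"
    and "M = mmul A' (mgraph p A) (mmul B' M' (mcograph q B))"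
proof -
  have pq: "p \<in> A \<rightarrow> A'" "q \<in> B \<rightarrow> B'" using p q by (auto simp: bij_betw_apply)
  have fib: "{x \<in> C. k x = k a} = {a}" if "bij_betw k C C'" "a \<in> C" for k :: "'x \<Rightarrow> 'y" and C C' a
    using that by (auto simp: bij_betw_def dest: inj_onD)
  have out: "M a b = 0" if "a \<notin> A \<or> b \<notin> B" for a b using supp(1) that by (auto simp: msupp_def)
  have out': "M' a b = 0" if "a \<notin> A' \<or> b \<notin> B'" for a b using supp(2) that by (auto simp: msupp_def)
  show "mmul A (mcograph p A) M = mmul B' M' (mcograph q B)"
  proof (intro ext)
    fix a' b
    show "mmul A (mcograph p A) M a' b = mmul B' M' (mcograph q B) a' b"
    proof (cases "a' \<in> A'")
      case True
      then obtain a where "a \<in> A" "a' = p a" using p by (auto simp: bij_betw_def)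
      then show ?thesis using fin pq fib[OF p] eq out
        by (simp add: mmul_mcograph_left mmul_mcograph_right)
    next
      case False
      then have none: "{x \<in> A. p x = a'} = {}" using pq by auto
      then show ?thesis using False fin pq out'
        by (simp add: mmul_mcograph_left mmul_mcograph_right none)
    qed
  qed
  show "mmul B M (mgraph q B) = mmul A' (mgraph p A) M'"
  proof (intro ext)
    fix a b'
    show "mmul B M (mgraph q B) a b' = mmul A' (mgraph p A) M' a b'"
    proof (cases "b' \<in> B'")
      case True
      then obtain b where "b \<in> B" "b' = q b" using q by (auto simp: bij_betw_def)
      then show ?thesis using fin pq fib[OF q] eq out
        by (simp add: mmul_mgraph_left mmul_mgraph_right)
    next
      case False
      then have none: "{x \<in> B. q x = b'} = {}" using pq by auto
      then show ?thesis using False fin pq out'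
        by (simp add: mmul_mgraph_left mmul_mgraph_right none)
    qed
  qed
  show "M = mmul A' (mgraph p A) (mmul B' M' (mcograph q B))"
    using fin pq eq out by (intro ext) (auto simp: mmul_mgraph_left mmul_mcograph_right)
qed

text \<open>Naturality of the associator and of both unitors are instances: the wirings on the two sides of
  such a square have the same wires between corresponding ports.\<close>

lemma relabelling_natural:
  assumes q: "port_iso X X' q" and p: "port_iso Y Y' p"
    and f: "is_dep_wiring X Y f" and f': "is_dep_wiring X' Y' f'"
    and "\<And>b c. b \<in> in_ports Y \<Longrightarrow> c \<in> in_ports X \<Longrightarrow> in_matrix f' (p b) (q c) = in_matrix f b c"
    and "\<And>a c. a \<in> out_ports X \<Longrightarrow> c \<in> in_ports X \<Longrightarrow> trace_matrix f' (q a) (q c) = trace_matrix f a c"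
    and "\<And>a b. a \<in> out_ports X \<Longrightarrow> b \<in> out_ports Y \<Longrightarrow> out_matrix f' (q a) (p b) = out_matrix f a b"
  shows "relabelling p Y Y' \<cdot>\<^bsub>dDWD\<^esub> dwd_arrow X f Y = dwd_arrow X' f' Y' \<cdot>\<^bsub>dDWD\<^esub> relabelling q X X'"
proof -
  note pr = is_dep_wiring_relabel[OF p] and qr = is_dep_wiring_relabel[OF q]
  note fd = is_dep_wiringD[OF f] and fd' = is_dep_wiringD[OF f'] and prd = is_dep_wiringD[OF pr]
    and qrd = is_dep_wiringD[OF qr]
  note fw = is_wiring_spans(7-9)[OF fd(3)] and fw' = is_wiring_spans(7-9)[OF fd'(3)]
  note pd = port_isoD[OF p] and qd = port_isoD[OF q]
  note m = comp_wiring_matrices[OF fd(3) prd(3) fd(1,2), unfolded relabel_matrices]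
    comp_wiring_matrices[OF qrd(3) fd'(3) fd(1) fd'(1), unfolded relabel_matrices]
  show ?thesis unfolding relabelling_def dDWD_comp[OF f pr] dDWD_comp[OF qr f']
  proof (rule dwd_arrow_eqI)
    show "is_wiring X Y' (comp_wiring (relabel_wiring p Y) f)" "is_wiring X Y' (comp_wiring f' (relabel_wiring q X))"
      using is_wiring_comp[OF fd(3) prd(3)] is_wiring_comp[OF qrd(3) fd'(3)] by auto
    show "in_matrix (comp_wiring (relabel_wiring p Y) f) = in_matrix (comp_wiring f' (relabel_wiring q X))"
      unfolding m by (rule matrix_conjugation(1)[OF _ _ _ _ fw(1) fw'(1) pd(3) qd(3)]) (use assms pd qd in \<open>auto simp: finite_ports\<close>)
    show "trace_matrix (comp_wiring (relabel_wiring p Y) f) = trace_matrix (comp_wiring f' (relabel_wiring q X))"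
      unfolding m mzero_simps
      by (rule matrix_conjugation(3)[OF _ _ _ _ fw(2) fw'(2) qd(4) qd(3)]) (use assms pd qd in \<open>auto simp: finite_ports\<close>)
    show "out_matrix (comp_wiring (relabel_wiring p Y) f) = out_matrix (comp_wiring f' (relabel_wiring q X))"
      unfolding m by (rule matrix_conjugation(2)[OF _ _ _ _ fw(3) fw'(3) qd(4) pd(4)]) (use assms pd qd in \<open>auto simp: finite_ports\<close>)
  qed
qed

abbreviation port_assoc :: "'a univ \<Rightarrow> 'a univ" where
  "port_assoc \<equiv> copair (copair In1 (\<lambda>y. In2 (In1 y))) (\<lambda>z. In2 (In2 z))"

abbreviation port_lunit :: "'a univ \<Rightarrow> 'a univ" where
  "port_lunit \<equiv> copair (\<lambda>_. undefined) (\<lambda>x. x)"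

abbreviation port_runit :: "'a univ \<Rightarrow> 'a univ" where
  "port_runit \<equiv> copair (\<lambda>x. x) (\<lambda>_. undefined)"

lemma dDWD_struct:
  "assoc dDWD X Y Z = relabelling port_assoc (sum_interface (sum_interface X Y) Z) (sum_interface X (sum_interface Y Z))"
  "lunit dDWD X = relabelling port_lunit (sum_interface empty_interface X) X"
  "runit dDWD X = relabelling port_runit (sum_interface X empty_interface) X"
  by (simp_all add: dDWD_def relabelling_def)

lemma port_iso_assoc:
  assumes "is_interface X" "is_interface Y" "is_interface Z"
  shows "port_iso (sum_interface (sum_interface X Y) Z) (sum_interface X (sum_interface Y Z)) port_assoc"
  using assms unfolding port_iso_def
  by (auto simp: inj_on_def usum_def image_Un image_image rsum_def map_prod_def split_beta)

lemma port_iso_lunit: "is_interface X \<Longrightarrow> port_iso (sum_interface empty_interface X) X port_lunit"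
  unfolding port_iso_def
  by (auto simp: inj_on_def usum_def image_Un image_image rsum_def map_prod_def split_beta)

lemma port_iso_runit: "is_interface X \<Longrightarrow> port_iso (sum_interface X empty_interface) X port_runit"
  unfolding port_iso_def
  by (auto simp: inj_on_def usum_def image_Un image_image rsum_def map_prod_def split_beta)

lemma Idn_dDWD: "Idn dDWD X = dwd_arrow X (id_wiring X) X"
  by (simp add: dDWD_simps relabelling_def id_wiring_relabel)

lemma is_dep_wiring_id: "is_interface X \<Longrightarrow> is_dep_wiring X X (id_wiring X)"
  by (simp add: id_wiring_relabel is_dep_wiring_relabel)

lemma id_wiring_matrices:
  "in_matrix (id_wiring X) = mcograph (\<lambda>x. x) (in_ports X)"
  "trace_matrix (id_wiring X) = mzero"
  "out_matrix (id_wiring X) = mgraph (\<lambda>x. x) (out_ports X)"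
  by (simp_all add: id_wiring_relabel relabel_matrices)

lemma dDWD_category: "is_category dDWD"
proof
  fix f g h :: "'a dwd_arrow" and A B D E :: "'a interface"
  show "Dom dDWD f \<in> Ob dDWD" "Cod dDWD f \<in> Ob dDWD" if "f \<in> Arr dDWD"
    using that by (auto simp: dDWD_simps dest: is_dep_wiringD)
  show "Idn dDWD A \<in> hom dDWD A A" if "A \<in> Ob dDWD" using that by (simp add: dDWD_simps relabelling_in)
  assume "f \<in> hom dDWD A B"
  then obtain f' where f: "f = dwd_arrow A f' B" "is_dep_wiring A B f'" by (auto simp: hom_dDWD)
  note fd = is_dep_wiringD[OF f(2)]
  note fw = is_wiring_spans(7-9)[OF fd(3)]
  note idA = is_dep_wiring_id[OF fd(1)] and idB = is_dep_wiring_id[OF fd(2)]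
  show "Idn dDWD B \<cdot>\<^bsub>dDWD\<^esub> f = f"
    unfolding f Idn_dDWD dDWD_comp[OF f(2) idB]
    by (intro dwd_arrow_eqI is_wiring_comp[OF fd(3)] fd(3) is_dep_wiringD(3)[OF idB])
      (use fd fw in \<open>simp_all add: comp_wiring_matrices[OF fd(3) is_dep_wiringD(3)[OF idB] fd(1,2)]
        id_wiring_matrices mcograph_id finite_ports mmul_id_left mmul_id_right[unfolded mcograph_id]\<close>)
  show "f \<cdot>\<^bsub>dDWD\<^esub> Idn dDWD A = f"
    unfolding f Idn_dDWD dDWD_comp[OF idA f(2)]
    by (intro dwd_arrow_eqI is_wiring_comp[OF is_dep_wiringD(3)[OF idA]] fd(3))
      (use fd fw in \<open>simp_all add: comp_wiring_matrices[OF is_dep_wiringD(3)[OF idA] fd(3,1,1)]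
        id_wiring_matrices mcograph_id finite_ports mmul_id_left mmul_id_right[unfolded mcograph_id]\<close>)
  assume "g \<in> hom dDWD B D"
  then obtain g' where g: "g = dwd_arrow B g' D" "is_dep_wiring B D g'" by (auto simp: hom_dDWD)
  note gd = is_dep_wiringD[OF g(2)]
  note gf = is_dep_wiring_comp[OF f(2) g(2)]
  show "g \<cdot>\<^bsub>dDWD\<^esub> f \<in> hom dDWD A D" unfolding f g dDWD_comp[OF f(2) g(2)] hom_dDWD using gf by blast
  assume "h \<in> hom dDWD D E"
  then obtain h' where h: "h = dwd_arrow D h' E" "is_dep_wiring D E h'" by (auto simp: hom_dDWD)
  note hd = is_dep_wiringD[OF h(2)]
  note hg = is_dep_wiring_comp[OF g(2) h(2)]
  show "(h \<cdot>\<^bsub>dDWD\<^esub> g) \<cdot>\<^bsub>dDWD\<^esub> f = h \<cdot>\<^bsub>dDWD\<^esub> (g \<cdot>\<^bsub>dDWD\<^esub> f)"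
    unfolding f g h dDWD_comp[OF f(2) g(2)] dDWD_comp[OF g(2) h(2)] dDWD_comp[OF gf h(2)] dDWD_comp[OF f(2) hg]
    by (intro dwd_arrow_eqI is_wiring_comp[OF fd(3) is_dep_wiringD(3)[OF hg]]
        is_wiring_comp[OF is_dep_wiringD(3)[OF gf] hd(3)])
      (simp_all add: comp_wiring_matrices[OF fd(3) is_dep_wiringD(3)[OF hg] fd(1,2)]
        comp_wiring_matrices[OF is_dep_wiringD(3)[OF gf] hd(3) fd(1) hd(1)]
        comp_wiring_matrices[OF fd(3) gd(3) fd(1,2)] comp_wiring_matrices[OF gd(3) hd(3) gd(1,2)]
        mmul_assoc mmul_madd madd_assoc)
qed

lemma dDWD_moncat: "is_moncat dDWD"
proof -
  interpret is_category dDWD by (rule dDWD_category)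
  show ?thesis
  proof
    fix A B D E :: "'a interface"
    show "tunit dDWD \<in> Ob dDWD" by (simp add: dDWD_simps)
    assume "A \<in> Ob dDWD" then have A: "is_interface A" by (simp add: dDWD_simps)
    show "lunit dDWD A \<in> hom dDWD (tunit dDWD \<otimes>\<^bsub>dDWD\<^esub> A) A" "is_iso dDWD (lunit dDWD A)"
      "runit dDWD A \<in> hom dDWD (A \<otimes>\<^bsub>dDWD\<^esub> tunit dDWD) A" "is_iso dDWD (runit dDWD A)"
      unfolding dDWD_struct dDWD_simps
      by (simp_all add: relabelling_iso relabelling_in port_iso_lunit port_iso_runit A)
    assume "B \<in> Ob dDWD" then have B: "is_interface B" by (simp add: dDWD_simps)
    show "A \<otimes>\<^bsub>dDWD\<^esub> B \<in> Ob dDWD" using A B by (simp add: dDWD_simps)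
    show "Idn dDWD A \<odot>\<^bsub>dDWD\<^esub> Idn dDWD B = Idn dDWD (A \<otimes>\<^bsub>dDWD\<^esub> B)"
      unfolding dDWD_simps relabelling_tenA[OF port_iso_id[OF A] port_iso_id[OF B]]
      by (intro relabelling_cong port_iso_sum port_iso_id is_interface_sum A B) auto
    \<comment> \<open>Both sides of the triangle and of the pentagon are relabellings, along maps that agree on ports.\<close>
    show "(Idn dDWD A \<odot>\<^bsub>dDWD\<^esub> lunit dDWD B) \<cdot>\<^bsub>dDWD\<^esub> assoc dDWD A (tunit dDWD) B
         = runit dDWD A \<odot>\<^bsub>dDWD\<^esub> Idn dDWD B"
      unfolding dDWD_simps dDWD_struct relabelling_tenA[OF port_iso_id[OF A] port_iso_lunit[OF B]]
        relabelling_tenA[OF port_iso_runit[OF A] port_iso_id[OF B]]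
        relabelling_comp[OF port_iso_assoc[OF A is_interface_empty B] port_iso_sum[OF port_iso_id[OF A] port_iso_lunit[OF B]]]
      by (intro relabelling_cong port_iso_sum port_iso_id port_iso_runit A B
          port_iso_comp[OF port_iso_assoc port_iso_sum] port_iso_lunit is_interface_empty) auto
    assume "D \<in> Ob dDWD" then have D: "is_interface D" by (simp add: dDWD_simps)
    show "assoc dDWD A B D \<in> hom dDWD ((A \<otimes>\<^bsub>dDWD\<^esub> B) \<otimes>\<^bsub>dDWD\<^esub> D) (A \<otimes>\<^bsub>dDWD\<^esub> (B \<otimes>\<^bsub>dDWD\<^esub> D))"
      "is_iso dDWD (assoc dDWD A B D)"
      unfolding dDWD_struct dDWD_simps
      by (simp_all add: relabelling_iso relabelling_in port_iso_assoc A B D)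
    assume "E \<in> Ob dDWD" then have E: "is_interface E" by (simp add: dDWD_simps)
    show "(Idn dDWD A \<odot>\<^bsub>dDWD\<^esub> assoc dDWD B D E) \<cdot>\<^bsub>dDWD\<^esub> assoc dDWD A (B \<otimes>\<^bsub>dDWD\<^esub> D) E
            \<cdot>\<^bsub>dDWD\<^esub> (assoc dDWD A B D \<odot>\<^bsub>dDWD\<^esub> Idn dDWD E)
         = assoc dDWD A B (D \<otimes>\<^bsub>dDWD\<^esub> E) \<cdot>\<^bsub>dDWD\<^esub> assoc dDWD (A \<otimes>\<^bsub>dDWD\<^esub> B) D E"
    proof -
      note i1 = port_iso_sum[OF port_iso_assoc[OF A B D] port_iso_id[OF E]]
        and i2 = port_iso_assoc[OF A is_interface_sum[OF B D] E]
        and i3 = port_iso_sum[OF port_iso_id[OF A] port_iso_assoc[OF B D E]]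
        and i4 = port_iso_assoc[OF is_interface_sum[OF A B] D E]
        and i5 = port_iso_assoc[OF A B is_interface_sum[OF D E]]
      show ?thesis
        unfolding dDWD_simps dDWD_struct relabelling_tenA[OF port_iso_assoc[OF A B D] port_iso_id[OF E]]
          relabelling_tenA[OF port_iso_id[OF A] port_iso_assoc[OF B D E]] relabelling_comp[OF i1 i2]
          relabelling_comp[OF port_iso_comp[OF i1 i2] i3] relabelling_comp[OF i4 i5]
        by (intro relabelling_cong port_iso_comp[OF port_iso_comp[OF i1 i2] i3] port_iso_comp[OF i4 i5]) auto
    qed
  next
    fix f g f' g' :: "'a dwd_arrow" and A B D A' B' D' :: "'a interface"
    assume "f \<in> hom dDWD A B" "f' \<in> hom dDWD A' B'"
    then obtain k k' where k: "f = dwd_arrow A k B" "is_dep_wiring A B k" "f' = dwd_arrow A' k' B'" "is_dep_wiring A' B' k'"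
      by (auto simp: hom_dDWD)
    show "f \<odot>\<^bsub>dDWD\<^esub> f' \<in> hom dDWD (A \<otimes>\<^bsub>dDWD\<^esub> A') (B \<otimes>\<^bsub>dDWD\<^esub> B')"
      unfolding k dDWD_tenA[OF k(2,4)] hom_dDWD dDWD_simps using is_dep_wiring_sum[OF k(2,4)] by blast
    assume "g \<in> hom dDWD B D" "g' \<in> hom dDWD B' D'"
    then obtain l l' where l: "g = dwd_arrow B l D" "is_dep_wiring B D l" "g' = dwd_arrow B' l' D'" "is_dep_wiring B' D' l'"
      by (auto simp: hom_dDWD)
    note kd = is_dep_wiringD[OF k(2)] is_dep_wiringD[OF k(4)] and ld = is_dep_wiringD[OF l(2)] is_dep_wiringD[OF l(4)]
    note ks = is_dep_wiring_sum[OF k(2,4)] and ls = is_dep_wiring_sum[OF l(2,4)]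
    note ksd = is_dep_wiringD[OF ks] and lsd = is_dep_wiringD[OF ls]
    show "(g \<cdot>\<^bsub>dDWD\<^esub> f) \<odot>\<^bsub>dDWD\<^esub> (g' \<cdot>\<^bsub>dDWD\<^esub> f') = (g \<odot>\<^bsub>dDWD\<^esub> g') \<cdot>\<^bsub>dDWD\<^esub> (f \<odot>\<^bsub>dDWD\<^esub> f')"
      unfolding k l dDWD_comp[OF k(2) l(2)] dDWD_comp[OF k(4) l(4)] dDWD_tenA[OF k(2,4)] dDWD_tenA[OF l(2,4)]
        dDWD_tenA[OF is_dep_wiring_comp[OF k(2) l(2)] is_dep_wiring_comp[OF k(4) l(4)]] dDWD_comp[OF ks ls]
      by (intro dwd_arrow_eqI is_wiring_sum is_wiring_comp[OF kd(3) ld(3)] is_wiring_comp[OF kd(6) ld(6)]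
          is_wiring_comp[OF ksd(3) lsd(3)])
        (use kd in \<open>simp_all add: comp_wiring_matrices[OF kd(3) ld(3) kd(1,2)] comp_wiring_matrices[OF kd(6) ld(6) kd(4,5)]
          comp_wiring_matrices[OF ksd(3) lsd(3) ksd(1,2)] sum_wiring_matrices finite_ports mdiag_mmul mdiag_madd\<close>)
  next
    fix f g h :: "'a dwd_arrow" and A B D A' B' D' :: "'a interface"
    assume "f \<in> hom dDWD A A'"
    then obtain k where k: "f = dwd_arrow A k A'" "is_dep_wiring A A' k" by (auto simp: hom_dDWD)
    note kd = is_dep_wiringD[OF k(2)]
    note id0 = is_dep_wiring_id[OF is_interface_empty]
    show "lunit dDWD A' \<cdot>\<^bsub>dDWD\<^esub> (Idn dDWD (tunit dDWD) \<odot>\<^bsub>dDWD\<^esub> f) = f \<cdot>\<^bsub>dDWD\<^esub> lunit dDWD A"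
      unfolding k dDWD_struct Idn_dDWD dDWD_simps(6) dDWD_tenA[OF id0 k(2)]
      by (rule relabelling_natural[OF port_iso_lunit[OF kd(1)] port_iso_lunit[OF kd(2)] is_dep_wiring_sum[OF id0 k(2)] k(2)])
        (auto simp: sum_wiring_matrices mdiag_def)
    show "runit dDWD A' \<cdot>\<^bsub>dDWD\<^esub> (f \<odot>\<^bsub>dDWD\<^esub> Idn dDWD (tunit dDWD)) = f \<cdot>\<^bsub>dDWD\<^esub> runit dDWD A"
      unfolding k dDWD_struct Idn_dDWD dDWD_simps(6) dDWD_tenA[OF k(2) id0]
      by (rule relabelling_natural[OF port_iso_runit[OF kd(1)] port_iso_runit[OF kd(2)] is_dep_wiring_sum[OF k(2) id0] k(2)])
        (auto simp: sum_wiring_matrices mdiag_def)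
    assume "g \<in> hom dDWD B B'" "h \<in> hom dDWD D D'"
    then obtain l m where l: "g = dwd_arrow B l B'" "is_dep_wiring B B' l" and m: "h = dwd_arrow D m D'" "is_dep_wiring D D' m"
      by (auto simp: hom_dDWD)
    note ld = is_dep_wiringD[OF l(2)] and md = is_dep_wiringD[OF m(2)]
    show "assoc dDWD A' B' D' \<cdot>\<^bsub>dDWD\<^esub> ((f \<odot>\<^bsub>dDWD\<^esub> g) \<odot>\<^bsub>dDWD\<^esub> h)
         = (f \<odot>\<^bsub>dDWD\<^esub> (g \<odot>\<^bsub>dDWD\<^esub> h)) \<cdot>\<^bsub>dDWD\<^esub> assoc dDWD A B D"
      unfolding k l m dDWD_struct dDWD_tenA[OF k(2) l(2)] dDWD_tenA[OF l(2) m(2)]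
        dDWD_tenA[OF is_dep_wiring_sum[OF k(2) l(2)] m(2)] dDWD_tenA[OF k(2) is_dep_wiring_sum[OF l(2) m(2)]]
      by (rule relabelling_natural[OF port_iso_assoc[OF kd(1) ld(1) md(1)] port_iso_assoc[OF kd(2) ld(2) md(2)]
            is_dep_wiring_sum[OF is_dep_wiring_sum[OF k(2) l(2)] m(2)]
            is_dep_wiring_sum[OF k(2) is_dep_wiring_sum[OF l(2) m(2)]]])
        (auto simp: sum_wiring_matrices mdiag_def)
  qed
qed


section \<open>Functors out of free categories\<close>

lemma hom_free_category:
  "x \<in> hom (free_category G) u v \<longleftrightarrow> (\<exists>p. x = (u, p, v) \<and> pre_digraph.awalk G u p v)"
  by (auto simp: hom_def free_category_def)

lemma free_category_is_category:
  assumes "wf_digraph G" shows "is_category (free_category G)"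
proof -
  interpret wf_digraph G by (fact assms)
  show ?thesis
  proof
    fix f assume "f \<in> Arr (free_category G)"
    then obtain u p v where "f = (u, p, v)" "awalk u p v" by (auto simp: free_category_def)
    then show "Dom (free_category G) f \<in> Ob (free_category G)" "Cod (free_category G) f \<in> Ob (free_category G)"
      by (auto simp: free_category_def)
  next
    fix u assume "u \<in> Ob (free_category G)"
    then show "Idn (free_category G) u \<in> hom (free_category G) u u"
      unfolding hom_free_category by (simp add: free_category_def awalk_Nil_iff)
  next
    fix f g u v w assume "f \<in> hom (free_category G) u v" "g \<in> hom (free_category G) v w"
    then show "g \<cdot>\<^bsub>free_category G\<^esub> f \<in> hom (free_category G) u w"
      unfolding hom_free_category by (auto simp: free_category_def simp del: awalk_append_iff intro: awalk_appendI)
  next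
    fix f u v assume "f \<in> hom (free_category G) u v"
    then show "Idn (free_category G) v \<cdot>\<^bsub>free_category G\<^esub> f = f" "f \<cdot>\<^bsub>free_category G\<^esub> Idn (free_category G) u = f"
      unfolding hom_free_category by (auto simp: free_category_def)
  next
    fix f g h u v w x
    assume "f \<in> hom (free_category G) u v" "g \<in> hom (free_category G) v w" "h \<in> hom (free_category G) w x"
    then show "(h \<cdot>\<^bsub>free_category G\<^esub> g) \<cdot>\<^bsub>free_category G\<^esub> f = h \<cdot>\<^bsub>free_category G\<^esub> (g \<cdot>\<^bsub>free_category G\<^esub> f)"
      unfolding hom_free_category by (auto simp: free_category_def)
  qed
qed

lemma generator_in:
  assumes "wf_digraph G" "e \<in> arcs G"
  shows "generator G e \<in> hom (free_category G) (tail G e) (head G e)"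
  using wf_digraph.arc_implies_awalk[OF assms] by (auto simp: hom_free_category generator_def)

lemma free_functor_is_functor:
  assumes G: "wf_digraph G" and f: "\<And>e. e \<in> arcs G \<Longrightarrow> f e \<in> A (tail G e) \<rightarrow> A (head G e)"
  shows "is_functor (free_category G) SET (free_functor G A f)"
proof -
  interpret wf_digraph G by (fact G)
  interpret S: is_category SET by (rule SET_category)
  interpret P: is_category "free_category G" by (rule free_category_is_category[OF G])
  have w: "walk_arrow G A f u p \<in> hom SET (A u) (A v)" if "awalk u p v" for u p v
    using that
  proof (induction p arbitrary: u)
    case Nil
    then show ?case by (auto simp: awalk_Nil_iff SET_Idn_in)
  next
    case (Cons e p)
    then have "e \<in> arcs G" "u = tail G e" "awalk (head G e) p v" by (auto simp: awalk_Cons_iff)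
    then show ?case using Cons.IH f by (auto intro!: SET_comp_in[OF set_arrow_in])
  qed
  have app: "walk_arrow G A f u (p @ q) = walk_arrow G A f v q \<cdot>\<^bsub>SET\<^esub> walk_arrow G A f u p"
    if "awalk u p v" "awalk v q x" for u p v q x
    using that(1)
  proof (induction p arbitrary: u)
    case Nil
    then show ?case using S.Idn_right[OF w[OF that(2)]] by (auto simp: awalk_Nil_iff)
  next
    case (Cons e p)
    then have e: "e \<in> arcs G" "u = tail G e" "awalk (head G e) p v" by (auto simp: awalk_Cons_iff)
    then have "set_arrow (A u) (f e) (A (head G e)) \<in> hom SET (A u) (A (head G e))"
      using f by (auto intro!: set_arrow_in)
    from S.Comp_assoc[OF this w[OF e(3)] w[OF that(2)]] show ?case using Cons.IH[OF e(3)] e(2) by simp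
  qed
  show ?thesis
  proof
    fix u v y h k
    show "fob (free_functor G A f) u \<in> Ob SET" by (simp add: SET_simps)
    show "far (free_functor G A f) (Idn (free_category G) u) = Idn SET (fob (free_functor G A f) u)"
      by (simp add: free_functor_def free_category_def)
    assume "h \<in> hom (free_category G) u v"
    then obtain p where h: "h = (u, p, v)" "awalk u p v" by (auto simp: hom_free_category)
    with w show "far (free_functor G A f) h \<in> hom SET (fob (free_functor G A f) u) (fob (free_functor G A f) v)"
      by (simp add: free_functor_def)
    assume "k \<in> hom (free_category G) v y"
    then obtain q where k: "k = (v, q, y)" "awalk v q y" by (auto simp: hom_free_category)
    show "far (free_functor G A f) (k \<cdot>\<^bsub>free_category G\<^esub> h) =
        far (free_functor G A f) k \<cdot>\<^bsub>SET\<^esub> far (free_functor G A f) h"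
      using app[OF h(2) k(2)] by (simp add: h k free_functor_def free_category_def)
  qed
qed

text \<open>Every arrow of a free category is a composite of generators, and naturality squares paste.\<close>

lemma natural_on_generators:
  assumes G: "wf_digraph G" and F: "is_functor (free_category G) SET F" and F': "is_functor (free_category G) SET F'"
    and \<eta>: "\<And>v. v \<in> verts G \<Longrightarrow> \<eta> v \<in> hom SET (fob F v) (fob F' v)"
    and gen: "\<And>e. e \<in> arcs G \<Longrightarrow> \<eta> (head G e) \<cdot>\<^bsub>SET\<^esub> far F (generator G e) = far F' (generator G e) \<cdot>\<^bsub>SET\<^esub> \<eta> (tail G e)"
    and p: "pre_digraph.awalk G u p v"
  shows "\<eta> v \<cdot>\<^bsub>SET\<^esub> far F (u, p, v) = far F' (u, p, v) \<cdot>\<^bsub>SET\<^esub> \<eta> u"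
proof -
  interpret wf_digraph G by (fact G)
  interpret S: is_category SET by (rule SET_category)
  interpret F: is_functor "free_category G" SET F by (fact F)
  interpret F': is_functor "free_category G" SET F' by (fact F')
  from p show ?thesis
  proof (induction p arbitrary: u)
    case Nil
    then have u: "u = v" "u \<in> verts G" by (auto simp: awalk_Nil_iff)
    then have "(u, [], v) = Idn (free_category G) u" "u \<in> Ob (free_category G)" by (simp_all add: free_category_def)
    then show ?case using u S.Idn_left[OF \<eta>[OF u(2)]] S.Idn_right[OF \<eta>[OF u(2)]]
      by (simp add: F.far_Idn F'.far_Idn)
  next
    case (Cons e p)
    then have e: "e \<in> arcs G" "u = tail G e" and p: "awalk (head G e) p v" by (auto simp: awalk_Cons_iff)
    let ?m = "head G e"
    note g = generator_in[OF G e(1)]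
    have ph: "(?m, p, v) \<in> hom (free_category G) ?m v" using p by (simp add: hom_free_category)
    have split: "(u, e # p, v) = (?m, p, v) \<cdot>\<^bsub>free_category G\<^esub> generator G e"
      by (simp add: free_category_def generator_def e(2))
    have vs: "u \<in> verts G" "?m \<in> verts G" "v \<in> verts G" using e p by auto
    note gF = F.far_in[OF g] and pF = F.far_in[OF ph] and gF' = F'.far_in[OF g] and pF' = F'.far_in[OF ph]
    note \<eta>s = \<eta>[OF vs(1)] \<eta>[OF vs(2)] \<eta>[OF vs(3)]
    have "\<eta> v \<cdot>\<^bsub>SET\<^esub> far F (u, e # p, v) = (\<eta> v \<cdot>\<^bsub>SET\<^esub> far F (?m, p, v)) \<cdot>\<^bsub>SET\<^esub> far F (generator G e)"
      unfolding split F.far_Comp[OF g ph] S.Comp_assoc[OF gF pF \<eta>s(3)] ..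
    also have "\<dots> = far F' (?m, p, v) \<cdot>\<^bsub>SET\<^esub> (\<eta> ?m \<cdot>\<^bsub>SET\<^esub> far F (generator G e))"
      unfolding Cons.IH[OF p] S.Comp_assoc[OF gF \<eta>s(2) pF'] ..
    also have "\<dots> = far F' (?m, p, v) \<cdot>\<^bsub>SET\<^esub> (far F' (generator G e) \<cdot>\<^bsub>SET\<^esub> \<eta> u)"
      unfolding gen[OF e(1)] e(2) ..
    also have "\<dots> = (far F' (?m, p, v) \<cdot>\<^bsub>SET\<^esub> far F' (generator G e)) \<cdot>\<^bsub>SET\<^esub> \<eta> u"
      unfolding e(2) using S.Comp_assoc[OF \<eta>s(1)[unfolded e(2)] gF' pF'] by simp
    also have "\<dots> = far F' (u, e # p, v) \<cdot>\<^bsub>SET\<^esub> \<eta> u"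
      unfolding split F'.far_Comp[OF g ph] ..
    finally show ?case .
  qed
qed

section \<open>Diagrams as matrices\<close>

lemma wf_hf_graph: "wf_digraph hf_graph"
  by unfold_locales (auto simp: hf_graph_def)

lemma hf_graph_simps [simp]:
  "verts hf_graph = UNIV" "arcs hf_graph = UNIV" "tail hf_graph = hf_tail" "head hf_graph = hf_head"
  by (simp_all add: hf_graph_def)

abbreviation link_matrix :: "'a diagram \<Rightarrow> hf_link \<Rightarrow> 'a univ \<Rightarrow> 'a univ \<Rightarrow> nat" where
  "link_matrix D l \<equiv> span_matrix (link_span D l)"

definition is_diagram :: "'a diagram \<Rightarrow> bool" where
  "is_diagram D \<longleftrightarrow> is_functor Hf SET (schema D) \<and> (\<forall>v. finite (part D v))"

lemma far_generator:
  assumes "is_functor Hf SET (schema D)"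
  shows "far (schema D) (generator hf_graph a) \<in> hom SET (part D (hf_tail a)) (part D (hf_head a))"
  using is_functor.far_in[OF assms] generator_in[OF wf_hf_graph, of a] by (simp add: Hf_def)

lemma part_map_in:
  "is_functor Hf SET (schema D) \<Longrightarrow> x \<in> part D (hf_tail a) \<Longrightarrow> part_map D a x \<in> part D (hf_head a)"
  unfolding part_map_def by (rule arrow_fun_in[OF far_generator])

lemma link_fspan:
  assumes "is_diagram D" shows "is_fspan (part D (link_src l)) (link_span D l) (part D (link_tgt l))"
  using assms part_map_in[of D _ "LinkSrc l"] part_map_in[of D _ "LinkTgt l"]
  by (auto simp: is_fspan_def is_diagram_def link_span_def)

abbreviation flow_arrows :: "hf_arrow set" where
  "flow_arrows \<equiv> {InflowStock, InflowFlow, OutflowStock, OutflowFlow, FlowVar}"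

text \<open>An isomorphism of diagrams in which links are not matched but only counted. The bijections on
  ports need not be identities, so diagrams whose interfaces differ by a relabelling can be
  compared too.\<close>

definition matches :: "'a diagram \<Rightarrow> 'a diagram \<Rightarrow> (hf_ob \<Rightarrow> 'a univ \<Rightarrow> 'a univ) \<Rightarrow> bool" where
  "matches D E h \<longleftrightarrow>
     (\<forall>v. (\<forall>l. v \<noteq> Link l) \<longrightarrow> bij_betw (h v) (part D v) (part E v)) \<and>
     (\<forall>a \<in> flow_arrows. \<forall>x \<in> part D (hf_tail a).
        part_map E a (h (hf_tail a) x) = h (hf_head a) (part_map D a x)) \<and>
     (\<forall>l. \<forall>x \<in> part D (link_src l). \<forall>y \<in> part D (link_tgt l).
        link_matrix E l (h (link_src l) x) (h (link_tgt l) y) = link_matrix D l x y) \<and>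
     (\<forall>s q v i. (s, q, v, i) \<in> aux_dom E \<longrightarrow>
        pullback (part D Var) (h Var) (aux E (s, q, v, i)) =
        aux D (pullback (part D Stock) (h Stock) s, pullback (part D SumVar) (h SumVar) q,
               pullback (part D Var) (h Var) v, pullback (part D InPort) (h InPort) i))"

lemma matchesD:
  assumes "matches D E h"
  shows "(\<And>l. v \<noteq> Link l) \<Longrightarrow> bij_betw (h v) (part D v) (part E v)"
    and "a \<in> flow_arrows \<Longrightarrow> x \<in> part D (hf_tail a) \<Longrightarrow>
        part_map E a (h (hf_tail a) x) = h (hf_head a) (part_map D a x)"
    and "x \<in> part D (link_src l) \<Longrightarrow> y \<in> part D (link_tgt l) \<Longrightarrow>
        link_matrix E l (h (link_src l) x) (h (link_tgt l) y) = link_matrix D l x y"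
    and "(s, q, u, i) \<in> aux_dom E \<Longrightarrow>
        pullback (part D Var) (h Var) (aux E (s, q, u, i)) =
        aux D (pullback (part D Stock) (h Stock) s, pullback (part D SumVar) (h SumVar) q,
               pullback (part D Var) (h Var) u, pullback (part D InPort) (h InPort) i)"
  using assms unfolding matches_def by auto

lemma link_ends: "link_src l \<noteq> Link k" "link_tgt l \<noteq> Link k"
  by (cases l; simp)+

lemma pullback_id: "x \<in> rvec A \<Longrightarrow> (\<And>a. a \<in> A \<Longrightarrow> f a = a) \<Longrightarrow> pullback A f x = x"
  by (auto simp: pullback_def PiE_iff extensional_def)

lemma pullback_in [simp]: "pullback A f x \<in> rvec A"
  by (simp add: pullback_def)

lemma pullback_pullback: "(\<And>a. a \<in> A \<Longrightarrow> f a \<in> B) \<Longrightarrow> pullback A f (pullback B g x) = pullback A (\<lambda>a. g (f a)) x"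
  by (auto simp: pullback_def)

lemma natural_isoI:
  assumes D: "is_functor Hf SET (schema D)" and E: "is_functor Hf SET (schema E)"
    and bij: "\<And>v. bij_betw (k v) (part D v) (part E v)"
    and nat: "\<And>a x. x \<in> part D (hf_tail a) \<Longrightarrow> part_map E a (k (hf_tail a) x) = k (hf_head a) (part_map D a x)"
  shows "natural_iso Hf SET (schema D) (schema E) (\<lambda>v. set_arrow (part D v) (k v) (part E v))"
proof -
  let ?\<eta> = "\<lambda>v. set_arrow (part D v) (k v) (part E v)"
  have \<eta>: "?\<eta> v \<in> hom SET (part D v) (part E v)" for v
    by (auto intro!: set_arrow_in bij_betw_apply[OF bij])
  have iso: "is_iso SET (?\<eta> v)" for v
    using bij by (simp add: SET_iso_iff[OF \<eta>] cong: bij_betw_cong)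
  have gen: "?\<eta> (hf_head a) \<cdot>\<^bsub>SET\<^esub> far (schema D) (generator hf_graph a)
      = far (schema E) (generator hf_graph a) \<cdot>\<^bsub>SET\<^esub> ?\<eta> (hf_tail a)" for a
  proof (rule hom_SET_eqI)
    note gD = far_generator[OF D, of a] and gE = far_generator[OF E, of a]
    show "?\<eta> (hf_head a) \<cdot>\<^bsub>SET\<^esub> far (schema D) (generator hf_graph a) \<in> hom SET (part D (hf_tail a)) (part E (hf_head a))"
      by (rule SET_comp_in[OF gD \<eta>])
    show "far (schema E) (generator hf_graph a) \<cdot>\<^bsub>SET\<^esub> ?\<eta> (hf_tail a) \<in> hom SET (part D (hf_tail a)) (part E (hf_head a))"
      by (rule SET_comp_in[OF \<eta> gE])
    fix x assume x: "x \<in> part D (hf_tail a)"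
    show "arrow_fun (?\<eta> (hf_head a) \<cdot>\<^bsub>SET\<^esub> far (schema D) (generator hf_graph a)) x
        = arrow_fun (far (schema E) (generator hf_graph a) \<cdot>\<^bsub>SET\<^esub> ?\<eta> (hf_tail a)) x"
      unfolding arrow_fun_comp[OF gD \<eta> x] arrow_fun_comp[OF \<eta> gE x]
      using nat[OF x] part_map_in[OF D x] x by (simp add: part_map_def)
  qed
  have "?\<eta> v \<cdot>\<^bsub>SET\<^esub> far (schema D) (u, p, v) = far (schema E) (u, p, v) \<cdot>\<^bsub>SET\<^esub> ?\<eta> u"
    if "pre_digraph.awalk hf_graph u p v" for u p v
    by (rule natural_on_generators[OF wf_hf_graph D[unfolded Hf_def] E[unfolded Hf_def] \<eta> _ that])
      (simp add: gen)
  then have "\<forall>f\<in>Arr Hf. ?\<eta> (Cod Hf f) \<cdot>\<^bsub>SET\<^esub> far (schema D) f = far (schema E) f \<cdot>\<^bsub>SET\<^esub> ?\<eta> (Dom Hf f)"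
    by (auto simp: Hf_def free_category_def)
  then show ?thesis unfolding natural_iso_def using \<eta> iso by blast
qed

text \<open>Given the bijections on the ends of links, equal numbers of links allow a bijection of the links
  themselves to be chosen, by \<open>span_iso_iff_matrix\<close>.\<close>

lemma diagram_iso_iff:
  assumes D: "is_diagram D" and E: "is_diagram E"
  shows "diagram_iso D E \<longleftrightarrow> (\<exists>h. matches D E h \<and>
    (\<forall>x\<in>part D InPort. h InPort x = x) \<and> (\<forall>x\<in>part D OutPort. h OutPort x = x))"
proof
  have FD: "is_functor Hf SET (schema D)" and FE: "is_functor Hf SET (schema E)"
    using D E by (auto simp: is_diagram_def)
  assume "diagram_iso D E"
  then obtain \<eta> where nat: "natural_iso Hf SET (schema D) (schema E) \<eta>"
    and ports: "\<eta> InPort = Idn SET (part D InPort)" "\<eta> OutPort = Idn SET (part D OutPort)"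
    and aux0: "\<forall>(s, q, v, i)\<in>aux_dom E.
        pullback (part D Var) (arrow_fun (\<eta> Var)) (aux E (s, q, v, i)) =
        aux D (pullback (part D Stock) (arrow_fun (\<eta> Stock)) s,
               pullback (part D SumVar) (arrow_fun (\<eta> SumVar)) q,
               pullback (part D Var) (arrow_fun (\<eta> Var)) v, i)"
    unfolding diagram_iso_def by blast
  have aux: "pullback (part D Var) (arrow_fun (\<eta> Var)) (aux E (s, q, v, i)) =
        aux D (pullback (part D Stock) (arrow_fun (\<eta> Stock)) s,
               pullback (part D SumVar) (arrow_fun (\<eta> SumVar)) q,
               pullback (part D Var) (arrow_fun (\<eta> Var)) v, i)" if "(s, q, v, i) \<in> aux_dom E" for s q v i
    using bspec[OF aux0 that] by simp
  define h where "h v = arrow_fun (\<eta> v)" for v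
  have ob: "v \<in> Ob Hf" for v by (simp add: Hf_def free_category_def)
  have \<eta>: "\<eta> v \<in> hom SET (part D v) (part E v)" "is_iso SET (\<eta> v)" for v
    using nat ob[of v] by (auto simp: natural_iso_def)
  have bij: "bij_betw (h v) (part D v) (part E v)" for v
    unfolding h_def using \<eta>(2) by (simp add: SET_iso_iff[OF \<eta>(1)])
  have gen: "part_map E a (h (hf_tail a) x) = h (hf_head a) (part_map D a x)" if "x \<in> part D (hf_tail a)" for a x
  proof -
    have "generator hf_graph a \<in> Arr Hf" "Cod Hf (generator hf_graph a) = hf_head a" "Dom Hf (generator hf_graph a) = hf_tail a"
      using generator_in[OF wf_hf_graph, of a] by (auto simp: Hf_def hom_def)
    then have "\<eta> (hf_head a) \<cdot>\<^bsub>SET\<^esub> far (schema D) (generator hf_graph a)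
        = far (schema E) (generator hf_graph a) \<cdot>\<^bsub>SET\<^esub> \<eta> (hf_tail a)"
      using nat by (metis natural_iso_def)
    then show ?thesis
      unfolding h_def part_map_def
      by (metis arrow_fun_comp[OF far_generator[OF FD] \<eta>(1) that] arrow_fun_comp[OF \<eta>(1) far_generator[OF FE] that])
  qed
  have "link_matrix E l (h (link_src l) x) (h (link_tgt l) y) = link_matrix D l x y"
    if "x \<in> part D (link_src l)" "y \<in> part D (link_tgt l)" for l x y
  proof -
    have "part_map E (LinkSrc l) (h (Link l) r) = h (link_src l) x \<and> part_map E (LinkTgt l) (h (Link l) r) = h (link_tgt l) y
       \<longleftrightarrow> part_map D (LinkSrc l) r = x \<and> part_map D (LinkTgt l) r = y" if r: "r \<in> part D (Link l)" for r
    proof -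
      have "part_map D (LinkSrc l) r \<in> part D (link_src l)" "part_map D (LinkTgt l) r \<in> part D (link_tgt l)"
        using part_map_in[OF FD, of r "LinkSrc l"] part_map_in[OF FD, of r "LinkTgt l"] r by simp_all
      then show ?thesis
        using gen[of r "LinkSrc l"] gen[of r "LinkTgt l"] r \<open>x \<in> _\<close> \<open>y \<in> _\<close>
          bij_betw_imp_inj_on[OF bij[of "link_src l"]] bij_betw_imp_inj_on[OF bij[of "link_tgt l"]]
        by (simp add: inj_on_eq_iff)
    qed
    then have "bij_betw (h (Link l)) {r \<in> part D (Link l). part_map D (LinkSrc l) r = x \<and> part_map D (LinkTgt l) r = y}
      {r \<in> part E (Link l). part_map E (LinkSrc l) r = h (link_src l) x \<and> part_map E (LinkTgt l) r = h (link_tgt l) y}"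
      by (intro bij_betw_Collect[OF bij]) auto
    then show ?thesis by (simp add: span_matrix_def link_span_def bij_betw_same_card)
  qed
  moreover have hin: "\<forall>x\<in>part D InPort. h InPort x = x" "\<forall>x\<in>part D OutPort. h OutPort x = x"
    by (simp_all add: h_def ports arrow_fun_Idn)
  moreover have "part E InPort = part D InPort"
    using \<eta>(1)[of InPort] ports(1) by (auto simp: hom_SET SET_simps set_arrow_def)
  then have "pullback (part D InPort) (h InPort) i = i" if "(s, q, v, i) \<in> aux_dom E" for s q v i
    using that hin by (intro pullback_id) (auto simp: aux_dom_def)
  ultimately show "\<exists>h. matches D E h \<and> (\<forall>x\<in>part D InPort. h InPort x = x) \<and> (\<forall>x\<in>part D OutPort. h OutPort x = x)"
    by (intro exI[of _ h]) (simp add: matches_def bij gen aux[folded h_def])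
next
  have FD: "is_functor Hf SET (schema D)" and FE: "is_functor Hf SET (schema E)"
    using D E by (auto simp: is_diagram_def)
  assume "\<exists>h. matches D E h \<and> (\<forall>x\<in>part D InPort. h InPort x = x) \<and> (\<forall>x\<in>part D OutPort. h OutPort x = x)"
  then obtain h where m: "matches D E h" and ports: "\<And>x. x \<in> part D InPort \<Longrightarrow> h InPort x = x"
    "\<And>x. x \<in> part D OutPort \<Longrightarrow> h OutPort x = x" by blast
  note bij = matchesD(1)[OF m]
  have "\<exists>k. bij_betw k (part D (Link l)) (part E (Link l)) \<and> (\<forall>r\<in>part D (Link l).
     part_map E (LinkSrc l) (k r) = h (link_src l) (part_map D (LinkSrc l) r) \<and>
     part_map E (LinkTgt l) (k r) = h (link_tgt l) (part_map D (LinkTgt l) r))" for l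
  proof -
    \<comment> \<open>the links of \<open>D\<close>, with their ends carried over to \<open>E\<close>\<close>
    define S where "S = \<lparr> apex = part D (Link l), src = \<lambda>r. h (link_src l) (part_map D (LinkSrc l) r),
      tgt = \<lambda>r. h (link_tgt l) (part_map D (LinkTgt l) r) \<rparr>"
    note bs = bij[of "link_src l", OF link_ends(1)] and bt = bij[of "link_tgt l", OF link_ends(2)]
    have D_in: "part_map D (LinkSrc l) r \<in> part D (link_src l)" "part_map D (LinkTgt l) r \<in> part D (link_tgt l)"
      if "r \<in> part D (Link l)" for r
      using part_map_in[OF FD, of r "LinkSrc l"] part_map_in[OF FD, of r "LinkTgt l"] that by simp_all
    have "is_fspan (part E (link_src l)) S (part E (link_tgt l))"
      using D D_in bs bt by (auto simp: S_def is_fspan_def is_diagram_def bij_betw_apply)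
    note supp = msupp_span_matrix[OF this] msupp_span_matrix[OF link_fspan[OF E], of l]
    have "span_matrix S a b = link_matrix E l a b" for a b
    proof (cases "a \<in> part E (link_src l) \<and> b \<in> part E (link_tgt l)")
      case True
      then have "a \<in> h (link_src l) ` part D (link_src l)" "b \<in> h (link_tgt l) ` part D (link_tgt l)"
        using bij_betw_imp_surj_on[OF bs] bij_betw_imp_surj_on[OF bt] by simp_all
      then obtain x y where xy: "x \<in> part D (link_src l)" "y \<in> part D (link_tgt l)" "a = h (link_src l) x" "b = h (link_tgt l) y"
        by (elim imageE) (rule that)
      have "{r \<in> apex S. src S r = a \<and> tgt S r = b} = {r \<in> apex (link_span D l). src (link_span D l) r = x \<and> tgt (link_span D l) r = y}"
        unfolding xy S_def link_span_def using D_in xy bs bt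
        by (auto simp: bij_betw_def inj_on_eq_iff)
      then show ?thesis using matchesD(3)[OF m xy(1,2)] xy by (simp add: span_matrix_def)
    next
      case False
      then show ?thesis using supp unfolding msupp_def by metis
    qed
    then have "span_iso S (link_span E l)"
      using D E by (intro span_iso_iff_matrix[THEN iffD2]) (auto simp: S_def is_diagram_def link_span_def fun_eq_iff)
    then show ?thesis by (auto simp: span_iso_def S_def link_span_def)
  qed
  then obtain k where k: "\<And>l. bij_betw (k l) (part D (Link l)) (part E (Link l))"
    "\<And>l r. r \<in> part D (Link l) \<Longrightarrow> part_map E (LinkSrc l) (k l r) = h (link_src l) (part_map D (LinkSrc l) r) \<and>
      part_map E (LinkTgt l) (k l r) = h (link_tgt l) (part_map D (LinkTgt l) r)"
    by metis
  define H where "H v = (case v of Link l \<Rightarrow> k l | _ \<Rightarrow> h v)" for v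
  have H: "H v = h v" if "\<And>l. v \<noteq> Link l" for v using that by (cases v) (auto simp: H_def)
  have Hbij: "bij_betw (H v) (part D v) (part E v)" for v
    using bij k(1) by (cases v) (auto simp: H_def)
  have Hnat: "part_map E a (H (hf_tail a) x) = H (hf_head a) (part_map D a x)" if "x \<in> part D (hf_tail a)" for a x
  proof (cases a)
    case (LinkSrc l)
    then show ?thesis using that k(2) H[OF link_ends(1)] by (simp add: H_def)
  next
    case (LinkTgt l)
    then show ?thesis using that k(2) H[OF link_ends(2)] by (simp add: H_def)
  qed (use that matchesD(2)[OF m, of a x] in \<open>auto simp: H_def\<close>)
  have same: "part E InPort = part D InPort" "part E OutPort = part D OutPort"
    using bij[of InPort] bij[of OutPort] ports by (auto simp: bij_betw_def)
  have pb: "pullback A (arrow_fun (set_arrow A f B)) x = pullback A f x" for A B :: "'a univ set" and f and x :: "'a vec"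
    by (auto simp: pullback_def)
  have aux: "pullback (part D Var) (h Var) (aux E (s, q, v, i)) =
        aux D (pullback (part D Stock) (h Stock) s, pullback (part D SumVar) (h SumVar) q,
               pullback (part D Var) (h Var) v, i)" if "(s, q, v, i) \<in> aux_dom E" for s q v i
  proof -
    have "pullback (part D InPort) (h InPort) i = i"
      using that ports same by (intro pullback_id) (auto simp: aux_dom_def)
    then show ?thesis using matchesD(4)[OF m that] by simp
  qed
  show "diagram_iso D E"
    unfolding diagram_iso_def
  proof (intro exI conjI)
    show "natural_iso Hf SET (schema D) (schema E) (\<lambda>v. set_arrow (part D v) (H v) (part E v))"
      by (rule natural_isoI[OF FD FE Hbij Hnat])
    show "set_arrow (part D InPort) (H InPort) (part E InPort) = Idn SET (part D InPort)"
      "set_arrow (part D OutPort) (H OutPort) (part E OutPort) = Idn SET (part D OutPort)"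
      using ports by (auto simp: SET_simps same H_def intro!: set_arrow_cong)
  qed (auto simp: pb H_def aux)
qed

lemma matches_idI:
  assumes "\<And>v. (\<And>l. v \<noteq> Link l) \<Longrightarrow> part D v = part E v"
    and "\<And>a x. a \<in> flow_arrows \<Longrightarrow> x \<in> part D (hf_tail a) \<Longrightarrow>
        part_map E a x = part_map D a x"
    and "\<And>l. link_matrix D l = link_matrix E l"
    and "aux E \<in> aux_dom E \<rightarrow> rvec (part E Var)"
    and "\<And>s q v i. (s, q, v, i) \<in> aux_dom E \<Longrightarrow> aux D (s, q, v, i) = aux E (s, q, v, i)"
  shows "matches D E (\<lambda>_ x. x)"
proof -
  have parts: "part D Var = part E Var" "part D Stock = part E Stock" "part D SumVar = part E SumVar"
    "part D InPort = part E InPort" using assms(1) by simp_all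
  have "pullback (part E Var) (\<lambda>x. x) (aux E (s, q, v, i)) =
        aux D (pullback (part E Stock) (\<lambda>x. x) s, pullback (part E SumVar) (\<lambda>x. x) q,
               pullback (part E Var) (\<lambda>x. x) v, pullback (part E InPort) (\<lambda>x. x) i)"
    if d: "(s, q, v, i) \<in> aux_dom E" for s q v i
  proof -
    have "aux E (s, q, v, i) \<in> rvec (part E Var)" using assms(4) d by blast
    moreover have "s \<in> rvec (part E Stock)" "q \<in> rvec (part E SumVar)" "v \<in> rvec (part E Var)" "i \<in> rvec (part E InPort)"
      using d by (simp_all add: aux_dom_def)
    ultimately show ?thesis using assms(5)[OF d] by (simp add: pullback_id)
  qed
  then show ?thesis unfolding matches_def parts using assms(1-3) by (auto simp: bij_betw_def)
qed

lemma matches_comp: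
  assumes h: "matches D E h" and k: "matches E F k" and D: "is_diagram D"
  shows "matches D F (\<lambda>v x. k v (h v x))"
  unfolding matches_def
proof (intro conjI allI ballI impI)
  have h_in: "h v x \<in> part E v" if "x \<in> part D v" "\<And>l. v \<noteq> Link l" for v x
    using bij_betw_apply[OF matchesD(1)[OF h]] that by blast
  fix v assume v: "\<forall>l. v \<noteq> Link l"
  show "bij_betw (\<lambda>x. k v (h v x)) (part D v) (part F v)"
    using bij_betw_trans[OF matchesD(1)[OF h] matchesD(1)[OF k], of v] v by (simp add: o_def)
next
  fix a x assume a: "a \<in> flow_arrows" and x: "x \<in> part D (hf_tail a)"
  have "\<And>l. hf_tail a \<noteq> Link l" using a by auto
  then have "h (hf_tail a) x \<in> part E (hf_tail a)" using bij_betw_apply[OF matchesD(1)[OF h] x] by blast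
  then show "part_map F a (k (hf_tail a) (h (hf_tail a) x)) = k (hf_head a) (h (hf_head a) (part_map D a x))"
    using matchesD(2)[OF h a x] matchesD(2)[OF k a] by simp
next
  fix l x y assume x: "x \<in> part D (link_src l)" and y: "y \<in> part D (link_tgt l)"
  have "h (link_src l) x \<in> part E (link_src l)" "h (link_tgt l) y \<in> part E (link_tgt l)"
    using bij_betw_apply[OF matchesD(1)[OF h link_ends(1)] x] bij_betw_apply[OF matchesD(1)[OF h link_ends(2)] y] .
  then show "link_matrix F l (k (link_src l) (h (link_src l) x)) (k (link_tgt l) (h (link_tgt l) y)) = link_matrix D l x y"
    using matchesD(3)[OF h x y] matchesD(3)[OF k] by simp
next
  fix s q u i assume d: "(s, q, u, i) \<in> aux_dom F"
  have h_in: "h v x \<in> part E v" if "x \<in> part D v" "\<And>l. v \<noteq> Link l" for v x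
    using bij_betw_apply[OF matchesD(1)[OF h]] that by blast
  have pb: "pullback (part D v) (\<lambda>x. k v (h v x)) z = pullback (part D v) (h v) (pullback (part E v) (k v) z)"
    if "\<And>l. v \<noteq> Link l" for v and z :: "'a vec"
    using h_in that by (subst pullback_pullback) auto
  have "(pullback (part E Stock) (k Stock) s, pullback (part E SumVar) (k SumVar) q,
      pullback (part E Var) (k Var) u, pullback (part E InPort) (k InPort) i) \<in> aux_dom E"
    by (simp add: aux_dom_def)
  from matchesD(4)[OF h this] show "pullback (part D Var) (\<lambda>x. k Var (h Var x)) (aux F (s, q, u, i)) =
        aux D (pullback (part D Stock) (\<lambda>x. k Stock (h Stock x)) s, pullback (part D SumVar) (\<lambda>x. k SumVar (h SumVar x)) q,
               pullback (part D Var) (\<lambda>x. k Var (h Var x)) u, pullback (part D InPort) (\<lambda>x. k InPort (h InPort x)) i)"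
    by (simp add: pb matchesD(4)[OF k d])
qed

lemma matches_inverse:
  assumes m: "matches D E h" and D: "is_diagram D" and E: "aux E \<in> aux_dom E \<rightarrow> rvec (part E Var)"
  shows "matches E D (\<lambda>v. inv_into (part D v) (h v))"
proof -
  let ?k = "\<lambda>v. inv_into (part D v) (h v)"
  have bij: "bij_betw (?k v) (part E v) (part D v)" if "\<And>l. v \<noteq> Link l" for v
    by (rule bij_betw_inv_into[OF matchesD(1)[OF m that]])
  have hk: "h v (?k v y) = y" if "y \<in> part E v" "\<And>l. v \<noteq> Link l" for v y
    using bij_betw_inv_into_right[OF matchesD(1)[OF m that(2)] that(1)] .
  have kh: "?k v (h v x) = x" if "x \<in> part D v" "\<And>l. v \<noteq> Link l" for v x
    using bij_betw_inv_into_left[OF matchesD(1)[OF m that(2)] that(1)] .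
  have k_in: "?k v y \<in> part D v" if "y \<in> part E v" "\<And>l. v \<noteq> Link l" for v y
    using bij_betw_apply[OF bij[OF that(2)] that(1)] .
  have h_in: "h v x \<in> part E v" if "x \<in> part D v" "\<And>l. v \<noteq> Link l" for v x
    using bij_betw_apply[OF matchesD(1)[OF m that(2)] that(1)] .
  show ?thesis
    unfolding matches_def
  proof (intro conjI allI ballI impI)
    show "bij_betw (?k v) (part E v) (part D v)" if "\<forall>l. v \<noteq> Link l" for v using bij that by blast
    fix a y assume a: "a \<in> flow_arrows" and y: "y \<in> part E (hf_tail a)"
    have nl: "\<And>l. hf_tail a \<noteq> Link l" "\<And>l. hf_head a \<noteq> Link l" using a by auto
    have "part_map D a (?k (hf_tail a) y) \<in> part D (hf_head a)"
      using D k_in[OF y nl(1)] by (simp add: is_diagram_def part_map_in)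
    from kh[OF this nl(2)] matchesD(2)[OF m a k_in[OF y nl(1)]]
    show "part_map D a (?k (hf_tail a) y) = ?k (hf_head a) (part_map E a y)" by (simp add: hk[OF y nl(1)])
  next
    fix l x y assume x: "x \<in> part E (link_src l)" and y: "y \<in> part E (link_tgt l)"
    from matchesD(3)[OF m k_in[OF x link_ends(1)] k_in[OF y link_ends(2)]]
    show "link_matrix D l (?k (link_src l) x) (?k (link_tgt l) y) = link_matrix E l x y"
      by (simp add: hk[OF x link_ends(1)] hk[OF y link_ends(2)])
  next
    fix s q u i assume d: "(s, q, u, i) \<in> aux_dom D"
    have d': "(pullback (part E Stock) (?k Stock) s, pullback (part E SumVar) (?k SumVar) q,
      pullback (part E Var) (?k Var) u, pullback (part E InPort) (?k InPort) i) \<in> aux_dom E" (is "?x \<in> _")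
      by (simp add: aux_dom_def)
    have pb: "pullback (part D v) (h v) (pullback (part E v) (?k v) z) = z"
      if "z \<in> rvec (part D v)" "\<And>l. v \<noteq> Link l" for v and z :: "'a vec"
      using that h_in kh by (subst pullback_pullback) (auto intro: pullback_id)
    have pb': "pullback (part E v) (?k v) (pullback (part D v) (h v) z) = z"
      if "z \<in> rvec (part E v)" "\<And>l. v \<noteq> Link l" for v and z :: "'a vec"
      using that k_in hk by (subst pullback_pullback) (auto intro: pullback_id)
    have "pullback (part D Var) (h Var) (aux E ?x) = aux D (s, q, u, i)"
      using matchesD(4)[OF m d'] d by (simp add: pb aux_dom_def)
    moreover have "aux E ?x \<in> rvec (part E Var)" using E d' by blast
    ultimately show "pullback (part E Var) (?k Var) (aux D (s, q, u, i)) = aux E ?x"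
      using pb'[of "aux E ?x" Var] by simp
  qed
qed


section \<open>Open diagrams\<close>

abbreviation link_rel :: "'a diagram \<Rightarrow> hf_link \<Rightarrow> ('a univ \<times> 'a univ) set" where
  "link_rel D l \<equiv> span_rel (link_span D l)"

lemma wf_var_graph:
  assumes "is_diagram D" shows "wf_digraph (var_graph D)"
  using link_fspan[OF assms, of VarLink]
  by (intro wf_digraph.intro) (auto simp: var_graph_def is_fspan_def link_span_def)

lemma arcs_ends_var_graph: "arcs_ends (var_graph D) = link_rel D VarLink"
  by (auto simp: arcs_ends_def arc_to_ends_def var_graph_def span_rel_def link_span_def)

lemma diagram_dep_eq:
  assumes "is_diagram D"
  shows "diagram_dep D = link_rel D InLink O (link_rel D VarLink)\<^sup>* O link_rel D OutLink"
proof -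
  have "(\<exists>p. pre_digraph.awalk (var_graph D) (tgt (link_span D InLink) l) p (src (link_span D OutLink) l')) \<longleftrightarrow>
    (tgt (link_span D InLink) l, src (link_span D OutLink) l') \<in> (link_rel D VarLink)\<^sup>*"
    if "l \<in> apex (link_span D InLink)" for l l'
    using that link_fspan[OF assms, of InLink]
    unfolding awalk_iff_reachable[OF wf_var_graph[OF assms]] arcs_ends_var_graph
    by (auto simp: var_graph_def is_fspan_def)
  then have "diagram_dep D = {(src (link_span D InLink) l, tgt (link_span D OutLink) l') | l l'.
     l \<in> apex (link_span D InLink) \<and> l' \<in> apex (link_span D OutLink) \<and>
     (tgt (link_span D InLink) l, src (link_span D OutLink) l') \<in> (link_rel D VarLink)\<^sup>*}"
    unfolding diagram_dep_def by blast
  also have "\<dots> = link_rel D InLink O (link_rel D VarLink)\<^sup>* O link_rel D OutLink"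
    by (auto simp: span_rel_def)
  finally show ?thesis .
qed

lemma rvec_iff: "x \<in> rvec A \<longleftrightarrow> (\<forall>a. a \<notin> A \<longrightarrow> x a = undefined)"
  by (auto simp: PiE_iff extensional_def)

lemma rvec_Plus: "case_sum x y \<in> rvec (A <+> B) \<longleftrightarrow> x \<in> rvec A \<and> y \<in> rvec B"
  unfolding rvec_iff split_sum_all by auto

text \<open>The sources of the links into \<open>b\<close> form a subset of a fourfold coproduct. Agreement on it is
  agreement on its four parts.\<close>

lemma aux_respects_iff:
  "aux_respects D \<longleftrightarrow> (\<forall>b \<in> part D Var. \<forall>s q v i s' q' v' i'.
     (s, q, v, i) \<in> aux_dom D \<longrightarrow> (s', q', v', i') \<in> aux_dom D \<longrightarrow>
     (\<forall>a. (a, b) \<in> link_rel D StockLink \<longrightarrow> s a = s' a) \<longrightarrow>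
     (\<forall>a. (a, b) \<in> link_rel D SumLink \<longrightarrow> q a = q' a) \<longrightarrow>
     (\<forall>a. (a, b) \<in> link_rel D VarLink \<longrightarrow> v a = v' a) \<longrightarrow>
     (\<forall>a. (a, b) \<in> link_rel D InLink \<longrightarrow> i a = i' a) \<longrightarrow>
     aux D (s, q, v, i) b = aux D (s', q', v', i') b)"
proof -
  let ?A = "part D Stock <+> part D SumVar <+> part D Var <+> part D InPort"
  let ?S = "\<lambda>b. src (aux_span D) ` {r \<in> apex (aux_span D). tgt (aux_span D) r = b}"
  have S: "(\<forall>a\<in>?S b. P a) \<longleftrightarrow> (\<forall>a. (a, b) \<in> link_rel D StockLink \<longrightarrow> P (Inl a)) \<and>
     (\<forall>a. (a, b) \<in> link_rel D SumLink \<longrightarrow> P (Inr (Inl a))) \<and>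
     (\<forall>a. (a, b) \<in> link_rel D VarLink \<longrightarrow> P (Inr (Inr (Inl a)))) \<and>
     (\<forall>a. (a, b) \<in> link_rel D InLink \<longrightarrow> P (Inr (Inr (Inr a))))" for P b
  proof -
    have img: "(\<forall>a\<in>?S b. P a) \<longleftrightarrow> (\<forall>r\<in>apex (aux_span D). tgt (aux_span D) r = b \<longrightarrow> P (src (aux_span D) r))"
      by blast
    have plus: "(\<forall>x\<in>A <+> B. Q x) \<longleftrightarrow> (\<forall>a\<in>A. Q (Inl a)) \<and> (\<forall>b\<in>B. Q (Inr b))"
      for A :: "'x set" and B :: "'y set" and Q by auto
    have rel: "(\<forall>a. (a, b) \<in> link_rel D l \<longrightarrow> Q a) \<longleftrightarrow>
      (\<forall>r\<in>part D (Link l). part_map D (LinkTgt l) r = b \<longrightarrow> Q (part_map D (LinkSrc l) r))" for l Q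
      by (auto simp: span_rel_iff link_span_def)
    show ?thesis unfolding img rel by (simp add: aux_span_def plus)
  qed
  have restr: "restrict x T = restrict y T \<longleftrightarrow> (\<forall>a\<in>T. x a = y a)" for x y :: "_ \<Rightarrow> real" and T
    by (auto simp: fun_eq_iff restrict_apply)
  have quad: "(case_sum s (case_sum q (case_sum v i)) \<in> rvec ?A) \<longleftrightarrow> (s, q, v, i) \<in> aux_dom D" for s q v i
    by (simp add: aux_dom_def rvec_Plus)
  have split: "x = case_sum (\<lambda>s. x (Inl s)) (case_sum (\<lambda>q. x (Inr (Inl q)))
      (case_sum (\<lambda>v. x (Inr (Inr (Inl v)))) (\<lambda>i. x (Inr (Inr (Inr i))))))"
    for x :: "'a univ + 'a univ + 'a univ + 'a univ \<Rightarrow> real"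
    by (auto simp: fun_eq_iff split: sum.splits)
  have all: "(\<forall>x\<in>rvec ?A. Q x) \<longleftrightarrow>
    (\<forall>s q v i. (s, q, v, i) \<in> aux_dom D \<longrightarrow> Q (case_sum s (case_sum q (case_sum v i))))" for Q
    by (metis quad split)
  show ?thesis unfolding aux_respects_def respects_span_def restr S all by (simp add: imp_conjL)
qed

lemma open_diagram_iff:
  "open_diagram X D \<longleftrightarrow> is_diagram D \<and>
     inj_on (part_map D InflowFlow) (part D Inflow) \<and> inj_on (part_map D OutflowFlow) (part D Outflow) \<and>
     acyclic (link_rel D VarLink) \<and> part D InPort = in_ports X \<and> part D OutPort = out_ports X \<and>
     link_rel D InLink O (link_rel D VarLink)\<^sup>* O link_rel D OutLink \<subseteq> dep X \<and>
     aux D \<in> aux_dom D \<rightarrow> rvec (part D Var) \<and> aux_respects D"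
proof (cases "is_diagram D")
  case True
  then show ?thesis
    using acyclic_graph_iff[OF wf_var_graph[OF True]] diagram_dep_eq[OF True]
    by (auto simp: open_diagram_def is_diagram_def arcs_ends_var_graph)
qed (auto simp: open_diagram_def is_diagram_def)

lemma open_diagramD:
  assumes "open_diagram X D"
  shows "is_diagram D" "part D InPort = in_ports X" "part D OutPort = out_ports X"
    "aux D \<in> aux_dom D \<rightarrow> rvec (part D Var)" "finite (part D v)"
  using assms by (auto simp: open_diagram_iff is_diagram_def)

lemma port_link_fspan:
  assumes "open_diagram X D"
  shows "is_fspan (in_ports X) (link_span D InLink) (part D Var)"
    "is_fspan (part D Var) (link_span D OutLink) (out_ports X)"
  using link_fspan[OF open_diagramD(1)[OF assms], of InLink] link_fspan[OF open_diagramD(1)[OF assms], of OutLink]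
    open_diagramD(2,3)[OF assms] by simp_all

lemma diagram_iso_refl: "open_diagram X D \<Longrightarrow> diagram_iso D D"
  using matches_idI[of D D] open_diagramD[of X D] by (auto simp: diagram_iso_iff)

lemma diagram_iso_sym:
  assumes D: "open_diagram X D" and E: "open_diagram X E" and iso: "diagram_iso D E"
  shows "diagram_iso E D"
proof -
  note Dd = open_diagramD[OF D] and Ed = open_diagramD[OF E]
  from iso obtain h where m: "matches D E h" and ports: "\<And>x. x \<in> in_ports X \<Longrightarrow> h InPort x = x"
    "\<And>x. x \<in> out_ports X \<Longrightarrow> h OutPort x = x"
    by (auto simp: diagram_iso_iff[OF Dd(1) Ed(1)] Dd(2,3))
  have "inj_on (h InPort) (in_ports X)" "inj_on (h OutPort) (out_ports X)"
    using ports by (auto simp: inj_on_def)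
  then have "inv_into (in_ports X) (h InPort) x = x" if "x \<in> in_ports X" for x
    using that ports by (metis inv_into_f_f)
  moreover have "inv_into (out_ports X) (h OutPort) x = x" if "x \<in> out_ports X" for x
    using \<open>inj_on (h OutPort) _\<close> that ports by (metis inv_into_f_f)
  ultimately show ?thesis
    using matches_inverse[OF m Dd(1) Ed(4)] by (auto simp: diagram_iso_iff[OF Ed(1) Dd(1)] Dd(2,3) Ed(2,3))
qed

lemma diagram_iso_trans:
  assumes D: "open_diagram X D" and E: "open_diagram X E" and F: "open_diagram X F"
    and iso: "diagram_iso D E" "diagram_iso E F"
  shows "diagram_iso D F"
proof -
  note Dd = open_diagramD[OF D] and Ed = open_diagramD[OF E] and Fd = open_diagramD[OF F]
  from iso(1) obtain h where h: "matches D E h" "\<And>x. x \<in> in_ports X \<Longrightarrow> h InPort x = x"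
    "\<And>x. x \<in> out_ports X \<Longrightarrow> h OutPort x = x"
    by (auto simp: diagram_iso_iff[OF Dd(1) Ed(1)] Dd(2,3))
  from iso(2) obtain k where k: "matches E F k" "\<And>x. x \<in> in_ports X \<Longrightarrow> k InPort x = x"
    "\<And>x. x \<in> out_ports X \<Longrightarrow> k OutPort x = x"
    by (auto simp: diagram_iso_iff[OF Ed(1) Fd(1)] Ed(2,3))
  show ?thesis
    using matches_comp[OF h(1) k(1) Dd(1)] h k by (auto simp: diagram_iso_iff[OF Dd(1) Fd(1)] Dd(2,3))
qed

lemma self_in_diagram_class: "open_diagram X D \<Longrightarrow> D \<in> diagram_class X D"
  by (simp add: diagram_class_def diagram_iso_refl)

lemma diagram_class_eqI:
  assumes "open_diagram X D" "open_diagram X E" "diagram_iso D E"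
  shows "diagram_class X D = diagram_class X E"
  unfolding diagram_class_def
  using assms diagram_iso_trans[of X D E] diagram_iso_trans[of X E D] diagram_iso_sym[of X D E] by blast

lemma diagram_isoI:
  assumes "open_diagram X D" "open_diagram X E" "matches D E h"
    "\<And>x. x \<in> in_ports X \<Longrightarrow> h InPort x = x" "\<And>x. x \<in> out_ports X \<Longrightarrow> h OutPort x = x"
  shows "diagram_iso D E"
  using assms open_diagramD(1-3)[OF assms(1)] open_diagramD(1)[OF assms(2)] by (auto simp: diagram_iso_iff)

lemma diagram_isoE:
  assumes "open_diagram X D" "open_diagram X E" "diagram_iso D E"
  obtains h where "matches D E h" "\<And>x. x \<in> in_ports X \<Longrightarrow> h InPort x = x" "\<And>x. x \<in> out_ports X \<Longrightarrow> h OutPort x = x"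
  using assms open_diagramD(1-3)[OF assms(1)] open_diagramD(1)[OF assms(2)] by (auto simp: diagram_iso_iff)

section \<open>Diagrams given by sets and maps\<close>

lemma is_diagram_free:
  assumes m: "\<And>a. m a \<in> A (hf_tail a) \<rightarrow> A (hf_head a)" and A: "\<And>v. finite (A v)"
  shows "is_diagram \<lparr> schema = free_functor hf_graph A m, aux = \<phi> \<rparr>"
  using free_functor_is_functor[OF wf_hf_graph, of m A] m A
  by (simp add: is_diagram_def Hf_def) (simp add: free_functor_def)

lemma part_map_free:
  assumes m: "m a \<in> A (hf_tail a) \<rightarrow> A (hf_head a)" and x: "x \<in> A (hf_tail a)"
  shows "part_map \<lparr> schema = free_functor hf_graph A m, aux = \<phi> \<rparr> a x = m a x"
proof -
  have "set_arrow (A (hf_tail a)) (m a) (A (hf_head a)) \<in> hom SET (A (hf_tail a)) (A (hf_head a))"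
    using m by (rule set_arrow_in)
  from is_category.Idn_left[OF SET_category this] show ?thesis
    using x by (simp add: part_map_def free_functor_def generator_def)
qed

lemma span_cong:
  assumes "apex S = apex T" "\<And>r. r \<in> apex T \<Longrightarrow> src S r = src T r" "\<And>r. r \<in> apex T \<Longrightarrow> tgt S r = tgt T r"
  shows "span_matrix S = span_matrix T" "span_rel S = span_rel T"
proof -
  have "{r \<in> apex S. src S r = a \<and> tgt S r = b} = {r \<in> apex T. src T r = a \<and> tgt T r = b}" for a b
    using assms by auto
  then show "span_matrix S = span_matrix T" by (simp add: fun_eq_iff span_matrix_def)
  show "span_rel S = span_rel T" using assms by (auto simp: span_rel_def)
qed

section \<open>The action of wirings on diagrams\<close>

lemma act_links_fspan:
  assumes f: "is_wiring X Y f" and D: "open_diagram X D"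
  shows "is_fspan (act_part Y f D (link_src l)) (act_links f D l) (act_part Y f D (link_tgt l))"
proof -
  note fw = is_wiring_spans[OF f] and Dd = open_diagramD[OF D]
  note I = port_link_fspan(1)[OF D] and O' = port_link_fspan(2)[OF D]
  have V: "is_fspan (part D Var) (link_span D VarLink) (part D Var)" using link_fspan[OF Dd(1), of VarLink] by simp
  show ?thesis
  proof (cases l)
    case InLink
    then show ?thesis using is_fspan_fibre[OF fw(1) I] by (simp add: act_links_def act_part_def)
  next
    case OutLink
    then show ?thesis using is_fspan_fibre[OF O' fw(3)] by (simp add: act_links_def act_part_def)
  next
    case VarLink
    then show ?thesis using is_fspan_join[OF V is_fspan_fibre[OF O' is_fspan_fibre[OF fw(2) I]]]
      by (simp add: act_links_def act_part_def)
  qed (use link_fspan[OF Dd(1), of l] in \<open>simp_all add: act_links_def act_part_def\<close>)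
qed

lemma part_act:
  "part (act Y f D) v = act_part Y f D v"
  by (simp add: act_def free_functor_def)

lemma part_act_simps [simp]:
  "part (act Y f D) Stock = part D Stock" "part (act Y f D) Flow = part D Flow"
  "part (act Y f D) Inflow = part D Inflow" "part (act Y f D) Outflow = part D Outflow"
  "part (act Y f D) Var = part D Var" "part (act Y f D) SumVar = part D SumVar"
  "part (act Y f D) InPort = in_ports Y" "part (act Y f D) OutPort = out_ports Y"
  by (simp_all add: part_act act_part_def)

lemma act_map_in:
  assumes f: "is_wiring X Y f" and D: "open_diagram X D"
  shows "act_map f D a \<in> act_part Y f D (hf_tail a) \<rightarrow> act_part Y f D (hf_head a)"
proof (cases a)
  case (LinkSrc l)
  then show ?thesis using act_links_fspan[OF f D, of l] by (simp add: is_fspan_def act_map_def act_part_def)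
next
  case (LinkTgt l)
  then show ?thesis using act_links_fspan[OF f D, of l] by (simp add: is_fspan_def act_map_def act_part_def)
qed (use part_map_in[of D _ a] open_diagramD(1)[OF D] in \<open>auto simp: act_map_def act_part_def is_diagram_def\<close>)

lemma is_diagram_act:
  assumes f: "is_wiring X Y f" and D: "open_diagram X D" and Y: "is_interface Y"
  shows "is_diagram (act Y f D)"
  unfolding act_def
proof (rule is_diagram_free[OF act_map_in[OF f D]])
  fix v show "finite (act_part Y f D v)"
    using open_diagramD(5)[OF D, of v] Y act_links_fspan[OF f D] finite_ports[OF Y]
    by (cases v) (auto simp: act_part_def is_fspan_def)
qed

lemma part_map_act:
  assumes f: "is_wiring X Y f" and D: "open_diagram X D"
  shows "x \<in> part (act Y f D) (hf_tail a) \<Longrightarrow> part_map (act Y f D) a x = act_map f D a x"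
  unfolding act_def by (rule part_map_free[OF act_map_in[OF f D]]) (simp add: free_functor_def)

lemma part_map_act_nonlink:
  assumes f: "is_wiring X Y f" and D: "open_diagram X D"
    and a: "a \<in> flow_arrows" and x: "x \<in> part D (hf_tail a)"
  shows "part_map (act Y f D) a x = part_map D a x"
proof -
  have "x \<in> part (act Y f D) (hf_tail a)" using a x by auto
  then show ?thesis using part_map_act[OF f D] a by (auto simp: act_map_def)
qed

lemma act_link_span:
  assumes f: "is_wiring X Y f" and D: "open_diagram X D"
  shows "link_matrix (act Y f D) l = span_matrix (act_links f D l)"
    "link_rel (act Y f D) l = span_rel (act_links f D l)"
  using part_map_act[OF f D]
  by (intro span_cong; simp add: link_span_def part_act act_part_def act_map_def)+

lemma act_matrix:
  assumes f: "is_dep_wiring X Y f" and D: "open_diagram X D"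
  shows "link_matrix (act Y f D) InLink = mmul (in_ports X) (in_matrix f) (link_matrix D InLink)"
    "link_matrix (act Y f D) OutLink = mmul (out_ports X) (link_matrix D OutLink) (out_matrix f)"
    "link_matrix (act Y f D) VarLink = madd (link_matrix D VarLink)
       (mmul (out_ports X) (link_matrix D OutLink) (mmul (in_ports X) (trace_matrix f) (link_matrix D InLink)))"
    "link_matrix (act Y f D) StockLink = link_matrix D StockLink"
    "link_matrix (act Y f D) SumLink = link_matrix D SumLink"
    "link_matrix (act Y f D) StockSumLink = link_matrix D StockSumLink"
proof -
  note fd = is_dep_wiringD[OF f]
  note fw = is_wiring_spans[OF fd(3)] and Dd = open_diagramD[OF D] and fin = finite_ports[OF fd(1)]
  note I = port_link_fspan(1)[OF D] and O' = port_link_fspan(2)[OF D]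
  have TI: "is_fspan (out_ports X) (wtrace f \<Zcomp> link_span D InLink) (part D Var)" using is_fspan_fibre[OF fw(2) I] .
  have fins: "finite (apex (link_span D VarLink))" "finite (apex (link_span D OutLink \<Zcomp> wtrace f \<Zcomp> link_span D InLink))"
    using link_fspan[OF Dd(1), of VarLink] is_fspan_fibre[OF O' TI] by (simp_all add: is_fspan_def)
  show "link_matrix (act Y f D) InLink = mmul (in_ports X) (in_matrix f) (link_matrix D InLink)"
    "link_matrix (act Y f D) OutLink = mmul (out_ports X) (link_matrix D OutLink) (out_matrix f)"
    "link_matrix (act Y f D) VarLink = madd (link_matrix D VarLink)
       (mmul (out_ports X) (link_matrix D OutLink) (mmul (in_ports X) (trace_matrix f) (link_matrix D InLink)))"
    unfolding act_link_span[OF fd(3) D] act_links_def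
    by (simp_all add: span_matrix_fibre[OF fw(1) I fin(1)] span_matrix_fibre[OF O' fw(3) fin(2)]
      span_matrix_join[OF fins] span_matrix_fibre[OF O' TI fin(2)] span_matrix_fibre[OF fw(2) I fin(1)])
qed (simp_all add: act_link_span[OF is_dep_wiringD(3)[OF f] D] act_links_def)

lemma act_rel:
  assumes f: "is_wiring X Y f" and D: "open_diagram X D"
  shows "link_rel (act Y f D) InLink = span_rel (win f) O link_rel D InLink"
    "link_rel (act Y f D) OutLink = link_rel D OutLink O span_rel (wout f)"
    "link_rel (act Y f D) VarLink = link_rel D VarLink \<union>
       link_rel D OutLink O span_rel (wtrace f) O link_rel D InLink"
    "link_rel (act Y f D) StockLink = link_rel D StockLink"
    "link_rel (act Y f D) SumLink = link_rel D SumLink"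
  unfolding act_link_span[OF f D] act_links_def by (simp_all add: span_rel_fibre span_rel_join)

text \<open>The values at the in ports of the diagram that result from values \<open>v\<close> of its variables and
  values \<open>y\<close> at the in ports of the outer interface.\<close>

definition driven_inputs :: "'a wiring \<Rightarrow> 'a diagram \<Rightarrow> 'a vec \<Rightarrow> 'a vec \<Rightarrow> 'a vec" where
  "driven_inputs f D v y = (\<lambda>i \<in> part D InPort.
        span_map (win f) (part D InPort) y i +
        span_map (wtrace f) (part D InPort) (span_map (link_span D OutLink) (part D OutPort) v) i)"

lemma aux_act: "aux (act Y f D) (s, q, v, y) = aux D (s, q, v, driven_inputs f D v y)"
  by (simp add: act_def act_aux_def driven_inputs_def)

lemma aux_dom_act:
  assumes "open_diagram X D"
  shows "(s, q, v, y) \<in> aux_dom (act Y f D) \<Longrightarrow> (s, q, v, driven_inputs f D v y) \<in> aux_dom D"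
  using assms by (auto simp: aux_dom_def driven_inputs_def)

lemma driven_inputs_eq:
  assumes f: "is_dep_wiring X Y f" and D: "open_diagram X D"
  shows "driven_inputs f D v y = (\<lambda>i \<in> in_ports X. (\<Sum>a\<in>in_ports Y. real (in_matrix f a i) * y a) +
    (\<Sum>b\<in>out_ports X. real (trace_matrix f b i) * (\<Sum>u\<in>part D Var. real (link_matrix D OutLink u b) * v u)))"
proof -
  note fd = is_dep_wiringD[OF f]
  note fw = is_wiring_spans[OF fd(3)] and Dd = open_diagramD[OF D]
  note O' = port_link_fspan(2)[OF D]
  show ?thesis
    unfolding driven_inputs_def Dd(2,3)
    using fd(1,2) Dd(5)[of Var]
    by (intro restrict_ext) (simp add: span_map_matrix[OF fw(1)] span_map_matrix[OF fw(2)] span_map_matrix[OF O'] finite_ports)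
qed

text \<open>The var links of \<open>D\<close> are the inner graph \<open>L\<close>, fed back through the trace wires of \<open>f\<close>,
  and the dependency that \<open>D\<close> induces is contained in that of \<open>X\<close>. The auxiliary function still respects the
  links: if \<open>i\<close> is linked to a variable \<open>b\<close>, then whatever drives the input \<open>i\<close> is linked to \<open>b\<close>
  after the action.\<close>

theorem open_diagram_act:
  assumes f: "is_dep_wiring X Y f" and D: "open_diagram X D"
  shows "open_diagram Y (act Y f D)"
proof -
  note fd = is_dep_wiringD[OF f] and Dd = open_diagramD[OF D]
  note fw = is_wiring_spans[OF fd(3)]
  define I L O\<^sub>0 W where "I = link_rel D InLink" and "L = link_rel D VarLink"
    and "O\<^sub>0 = link_rel D OutLink" and "W = span_rel (wtrace f)"
  have "I O L\<^sup>* O O\<^sub>0 \<subseteq> dep X" "acyclic L" "acyclic (dep X O W)"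
    using D f by (auto simp: open_diagram_iff is_dep_wiring_iff I_def L_def O\<^sub>0_def W_def)
  note within = feedback_within[OF this]
  have "span_rel (win f) O (dep X O W)\<^sup>* O dep X O span_rel (wout f) \<subseteq> dep Y"
    using f by (simp add: is_dep_wiring_iff W_def)
  then have dep: "span_rel (win f) O I O (L \<union> O\<^sub>0 O W O I)\<^sup>* O O\<^sub>0 O span_rel (wout f) \<subseteq> dep Y"
    using within(2) by (rule order_trans[rotated])
  have resp: "aux_respects (act Y f D)"
    unfolding aux_respects_iff act_rel[OF fd(3) D]
  proof (intro ballI allI impI)
    fix b s q v y s' q' v' y'
    assume b: "b \<in> part (act Y f D) Var" and d: "(s, q, v, y) \<in> aux_dom (act Y f D)"
      and d': "(s', q', v', y') \<in> aux_dom (act Y f D)"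
      and s: "\<forall>a. (a, b) \<in> link_rel D StockLink \<longrightarrow> s a = s' a"
      and q: "\<forall>a. (a, b) \<in> link_rel D SumLink \<longrightarrow> q a = q' a"
      and v: "\<forall>a. (a, b) \<in> link_rel D VarLink \<union> link_rel D OutLink O span_rel (wtrace f) O link_rel D InLink \<longrightarrow> v a = v' a"
      and y: "\<forall>a. (a, b) \<in> span_rel (win f) O link_rel D InLink \<longrightarrow> y a = y' a"
    have "driven_inputs f D v y i = driven_inputs f D v' y' i" if i: "(i, b) \<in> link_rel D InLink" for i
    proof -
      have win: "real (in_matrix f a i) * y a = real (in_matrix f a i) * y' a" for a
      proof (cases "in_matrix f a i = 0")
        case False
        then have "(a, i) \<in> span_rel (win f)" using fw(4) by (simp add: span_rel_matrix)
        then show ?thesis using y i by (simp add: relcompI)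
      qed simp
      have wtr: "real (trace_matrix f o' i) * (real (link_matrix D OutLink u o') * v u)
          = real (trace_matrix f o' i) * (real (link_matrix D OutLink u o') * v' u)" for o' u
      proof (cases "trace_matrix f o' i = 0 \<or> link_matrix D OutLink u o' = 0")
        case False
        then have "(o', i) \<in> span_rel (wtrace f)" "(u, o') \<in> link_rel D OutLink"
          using fw(5) link_fspan[OF Dd(1), of OutLink] by (simp_all add: span_rel_matrix is_fspan_def)
        then have "(u, b) \<in> link_rel D OutLink O span_rel (wtrace f) O link_rel D InLink" using i by blast
        then show ?thesis using v by simp
      qed auto
      show ?thesis
        unfolding driven_inputs_eq[OF f D] sum_distrib_left by (simp add: win wtr cong: restrict_cong)
    qed
    moreover have "aux_respects D" using D by (simp add: open_diagram_iff)
    ultimately show "aux (act Y f D) (s, q, v, y) b = aux (act Y f D) (s', q', v', y') b"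
      unfolding aux_act using b s q v aux_dom_act[OF D d] aux_dom_act[OF D d']
      by (elim aux_respects_iff[THEN iffD1, rule_format]) simp_all
  qed
  have "aux (act Y f D) \<in> aux_dom (act Y f D) \<rightarrow> rvec (part D Var)"
  proof
    fix x assume x: "x \<in> aux_dom (act Y f D)"
    obtain s q v y where "x = (s, q, v, y)" by (cases x)
    with x aux_dom_act[OF D] Dd(4) show "aux (act Y f D) x \<in> rvec (part D Var)" by (auto simp: aux_act)
  qed
  moreover have "inj_on (part_map (act Y f D) InflowFlow) (part D Inflow)"
    "inj_on (part_map (act Y f D) OutflowFlow) (part D Outflow)"
  proof -
    have "inj_on (part_map (act Y f D) a) (part D (hf_tail a)) \<longleftrightarrow> inj_on (part_map D a) (part D (hf_tail a))"
      if "a \<in> {InflowFlow, OutflowFlow}" for a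
      using that by (intro inj_on_cong part_map_act_nonlink[OF fd(3) D]) auto
    from this[of InflowFlow] this[of OutflowFlow] D
    show "inj_on (part_map (act Y f D) InflowFlow) (part D Inflow)"
      "inj_on (part_map (act Y f D) OutflowFlow) (part D Outflow)" by (simp_all add: open_diagram_iff)
  qed
  ultimately show ?thesis
    using dep within(1) resp is_diagram_act[OF fd(3) D fd(2)]
    unfolding open_diagram_iff act_rel[OF fd(3) D] I_def L_def O\<^sub>0_def W_def
    by (simp add: O_assoc)
qed


section \<open>Functoriality of the action\<close>

text \<open>The bijections that match the two diagrams also match the results, once they are replaced by
  the identity on the new ports: sums over inner ports and variables are reindexed along them. If
  \<open>h\<close> is the identity on ports, this is compatibility of the action with isomorphism; if \<open>f\<close> is a
  relabelling and \<open>g\<close> an identity, it yields \<open>act_relabel\<close> below.\<close>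

lemma act_transport:
  assumes f: "is_dep_wiring X Y f" and g: "is_dep_wiring X' Y g" and D: "open_diagram X D"
    and E: "open_diagram X' E" and m: "matches D E h"
    and win: "\<And>y b. y \<in> in_ports Y \<Longrightarrow> b \<in> in_ports X \<Longrightarrow> in_matrix g y (h InPort b) = in_matrix f y b"
    and trace: "\<And>a b. a \<in> out_ports X \<Longrightarrow> b \<in> in_ports X \<Longrightarrow>
      trace_matrix g (h OutPort a) (h InPort b) = trace_matrix f a b"
    and out: "\<And>a y. a \<in> out_ports X \<Longrightarrow> y \<in> out_ports Y \<Longrightarrow> out_matrix g (h OutPort a) y = out_matrix f a y"
  shows "diagram_iso (act Y f D) (act Y g E)"
proof -
  note fd = is_dep_wiringD[OF f] and gd = is_dep_wiringD[OF g] and Dd = open_diagramD[OF D] and Ed = open_diagramD[OF E]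
  define k where "k = h(InPort := \<lambda>x. x, OutPort := \<lambda>x. x)"
  have k: "k v = h v" if "v \<noteq> InPort" "v \<noteq> OutPort" for v using that by (simp add: k_def)
  have kp: "k InPort = (\<lambda>x. x)" "k OutPort = (\<lambda>x. x)" by (simp_all add: k_def)
  have bij: "bij_betw (h InPort) (in_ports X) (in_ports X')" "bij_betw (h OutPort) (out_ports X) (out_ports X')"
    "bij_betw (h Var) (part D Var) (part E Var)"
    using matchesD(1)[OF m, of InPort] matchesD(1)[OF m, of OutPort] matchesD(1)[OF m, of Var] by (simp_all add: Dd Ed)
  note reindex = bij[THEN sum.reindex_bij_betw, symmetric]
  have I: "link_matrix E InLink (h InPort b) (h Var y) = link_matrix D InLink b y" if "b \<in> in_ports X" "y \<in> part D Var" for b y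
    using matchesD(3)[OF m, of b InLink y] that by (simp add: Dd)
  have O': "link_matrix E OutLink (h Var x) b = link_matrix D OutLink x c"
    if "c \<in> out_ports X" "x \<in> part D Var" "b = h OutPort c" for b c x
    using matchesD(3)[OF m, of x OutLink c] that by (simp add: Dd)
  have V: "link_matrix E VarLink (h Var x) (h Var y) = link_matrix D VarLink x y" if "x \<in> part D Var" "y \<in> part D Var" for x y
    using matchesD(3)[OF m, of x VarLink y] that by simp
  have drive: "pullback (in_ports X) (h InPort) (driven_inputs g E v y) = driven_inputs f D (pullback (part D Var) (h Var) v) y" for v y
    unfolding driven_inputs_eq[OF f D] driven_inputs_eq[OF g E] pullback_def
    using bij_betw_apply[OF bij(1)] by (intro restrict_ext) (simp add: reindex win trace O')
  have "matches (act Y f D) (act Y g E) k"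
    unfolding matches_def
  proof (intro conjI allI ballI impI)
    fix v assume v: "\<forall>l. v \<noteq> Link l"
    show "bij_betw (k v) (part (act Y f D) v) (part (act Y g E) v)"
      using v matchesD(1)[OF m, of v] by (cases v) (simp_all add: k kp bij_betw_def)
  next
    fix a x assume a: "a \<in> flow_arrows" and x: "x \<in> part (act Y f D) (hf_tail a)"
    have xD: "x \<in> part D (hf_tail a)" using a x by auto
    have ka: "k (hf_tail a) = h (hf_tail a)" "k (hf_head a) = h (hf_head a)" using a by (auto simp: k)
    have "\<And>l. hf_tail a \<noteq> Link l" using a by auto
    then have hx: "h (hf_tail a) x \<in> part E (hf_tail a)"
      using bij_betw_apply[OF matchesD(1)[OF m] xD] by blast
    show "part_map (act Y g E) a (k (hf_tail a) x) = k (hf_head a) (part_map (act Y f D) a x)"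
      unfolding ka part_map_act_nonlink[OF gd(3) E a hx] part_map_act_nonlink[OF fd(3) D a xD]
      by (rule matchesD(2)[OF m a xD])
  next
    fix l x y assume x: "x \<in> part (act Y f D) (link_src l)" and y: "y \<in> part (act Y f D) (link_tgt l)"
    show "link_matrix (act Y g E) l (k (link_src l) x) (k (link_tgt l) y) = link_matrix (act Y f D) l x y"
      using x y matchesD(3)[OF m, of x l y]
      by (cases l) (simp_all add: act_matrix[OF f D] act_matrix[OF g E] k kp mmul_def madd_def reindex win trace out I O' V)
  next
    fix s q v y assume d: "(s, q, v, y) \<in> aux_dom (act Y g E)"
    have "pullback (in_ports Y) (\<lambda>x. x) y = y" using d by (intro pullback_id) (auto simp: aux_dom_def)
    then show "pullback (part (act Y f D) Var) (k Var) (aux (act Y g E) (s, q, v, y)) =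
        aux (act Y f D) (pullback (part (act Y f D) Stock) (k Stock) s, pullback (part (act Y f D) SumVar) (k SumVar) q,
          pullback (part (act Y f D) Var) (k Var) v, pullback (part (act Y f D) InPort) (k InPort) y)"
      using matchesD(4)[OF m aux_dom_act[OF E d]] by (simp add: aux_act k kp Dd(2) drive)
  qed
  then show ?thesis
    by (rule diagram_isoI[OF open_diagram_act[OF f D] open_diagram_act[OF g E]]) (simp_all add: kp)
qed

lemma act_cong:
  assumes "is_dep_wiring X Y f" "is_dep_wiring X Y g" "same_wires f g"
    and "open_diagram X D" "open_diagram X E" "diagram_iso D E"
  shows "diagram_iso (act Y f D) (act Y g E)"
proof -
  from diagram_isoE[OF assms(4-6)] obtain h where h: "matches D E h"
    "\<And>x. x \<in> in_ports X \<Longrightarrow> h InPort x = x" "\<And>x. x \<in> out_ports X \<Longrightarrow> h OutPort x = x" by blast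
  show ?thesis
    by (rule act_transport[OF assms(1,2,4,5) h(1)]) (use h(2,3) assms(3) in \<open>simp_all add: same_wires_def\<close>)
qed

text \<open>On links, this is associativity and distributivity of the matrix product; on inputs, it is the
  same computation with matrices applied to vectors.\<close>

lemma act_comp:
  assumes f: "is_dep_wiring X Y f" and g: "is_dep_wiring Y Z g" and D: "open_diagram X D"
  shows "diagram_iso (act Z (comp_wiring g f) D) (act Z g (act Y f D))"
proof -
  note fd = is_dep_wiringD[OF f] and gd = is_dep_wiringD[OF g]
  note gf = is_dep_wiring_comp[OF f g] and fD = open_diagram_act[OF f D]
  note gfD = open_diagram_act[OF g fD] and cD = open_diagram_act[OF gf D]
  note cm = comp_wiring_matrices[OF fd(3) gd(3) fd(1,2)]
  have drive: "driven_inputs (comp_wiring g f) D v z = driven_inputs f D v (driven_inputs g (act Y f D) v z)" for v z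
    unfolding driven_inputs_eq[OF gf D] driven_inputs_eq[OF f D] driven_inputs_eq[OF g fD]
    by (intro restrict_ext) (simp add: cm act_matrix[OF f D] madd_def sum_mmul distrib_left distrib_right sum.distrib)
  have "matches (act Z (comp_wiring g f) D) (act Z g (act Y f D)) (\<lambda>_ x. x)"
  proof (rule matches_idI)
    fix v assume "\<And>l. v \<noteq> Link l"
    then show "part (act Z (comp_wiring g f) D) v = part (act Z g (act Y f D)) v" by (cases v) auto
  next
    fix a x assume a: "a \<in> flow_arrows"
      and x: "x \<in> part (act Z (comp_wiring g f) D) (hf_tail a)"
    then have "x \<in> part D (hf_tail a)" "x \<in> part (act Y f D) (hf_tail a)" by auto
    then show "part_map (act Z g (act Y f D)) a x = part_map (act Z (comp_wiring g f) D) a x"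
      by (simp only: part_map_act_nonlink[OF is_dep_wiringD(3)[OF gf] D a] part_map_act_nonlink[OF fd(3) D a]
          part_map_act_nonlink[OF gd(3) fD a])
  next
    fix l show "link_matrix (act Z (comp_wiring g f) D) l = link_matrix (act Z g (act Y f D)) l"
      by (cases l) (simp_all add: act_matrix[OF gf D] act_matrix[OF f D] act_matrix[OF g fD] cm
          mmul_assoc mmul_madd madd_assoc)
  next
    show "aux (act Z g (act Y f D)) \<in> aux_dom (act Z g (act Y f D)) \<rightarrow> rvec (part (act Z g (act Y f D)) Var)"
      by (rule open_diagramD(4)[OF gfD])
  qed (simp add: aux_act drive)
  then show ?thesis by (rule diagram_isoI[OF cD gfD]) simp_all
qed

lemma act_id:
  assumes X: "is_interface X" and D: "open_diagram X D"
  shows "diagram_iso (act X (id_wiring X) D) D"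
proof -
  let ?f = "id_wiring X"
  note f = is_dep_wiring_id[OF X] and Dd = open_diagramD[OF D]
  note supp = msupp_span_matrix[OF link_fspan[OF Dd(1)]]
  have drive: "driven_inputs ?f D v y = y" if y: "y \<in> rvec (in_ports X)" for v y
  proof -
    have "(\<Sum>a\<in>in_ports X. real (mcograph (\<lambda>x. x) (in_ports X) a i) * y a) = y i" if i: "i \<in> in_ports X" for i
    proof -
      have "(\<Sum>a\<in>in_ports X. real (mcograph (\<lambda>x. x) (in_ports X) a i) * y a) = (\<Sum>a\<in>in_ports X. if a = i then y a else 0)"
        using i by (intro sum.cong) (auto simp: mcograph_def mgraph_def)
      then show ?thesis using i finite_ports(1)[OF X] by (simp add: sum.delta)
    qed
    then show ?thesis
      using y unfolding driven_inputs_eq[OF f D]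
      by (auto simp: fun_eq_iff restrict_apply id_wiring_matrices mzero_def rvec_iff)
  qed
  have "matches (act X ?f D) D (\<lambda>_ x. x)"
  proof (rule matches_idI)
    fix v assume "\<And>l. v \<noteq> Link l"
    then show "part (act X ?f D) v = part D v" by (cases v) (auto simp: Dd)
  next
    fix a x assume "a \<in> flow_arrows" "x \<in> part (act X ?f D) (hf_tail a)"
    then show "part_map D a x = part_map (act X ?f D) a x"
      using part_map_act_nonlink[OF is_dep_wiringD(3)[OF f] D, of a x] by auto
  next
    fix l show "link_matrix (act X ?f D) l = link_matrix D l"
      using supp[of InLink] supp[of OutLink] finite_ports[OF X]
      by (cases l) (simp_all add: act_matrix[OF f D] id_wiring_matrices mcograph_id Dd mmul_id_left
          mmul_id_right[unfolded mcograph_id])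
  qed (use Dd(4) in \<open>simp_all add: aux_act aux_dom_def drive Dd\<close>)
  then show ?thesis by (rule diagram_isoI[OF open_diagram_act[OF f D] D]) simp_all
qed

text \<open>Relabelling the ports of \<open>D\<close> has the effect that the identity wiring has on a diagram that
  matches \<open>D\<close> over the relabelling. In the coherence laws, \<open>h\<close> is the canonical bijection between
  coproducts of sets, which on ports is \<open>p\<close>.\<close>

lemma act_relabel:
  assumes p: "port_iso X X' p" and D: "open_diagram X D" and E: "open_diagram X' E" and m: "matches D E h"
    and ports: "\<And>x. x \<in> in_ports X \<Longrightarrow> h InPort x = p x" "\<And>x. x \<in> out_ports X \<Longrightarrow> h OutPort x = p x"
  shows "diagram_iso (act X' (relabel_wiring p X) D) E"
proof -
  note f = is_dep_wiring_relabel[OF p] and pd = port_isoD[OF p]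
  note g = is_dep_wiring_id[OF pd(2)]
  have "diagram_iso (act X' (relabel_wiring p X) D) (act X' (id_wiring X') E)"
    by (rule act_transport[OF f g D E m])
      (use pd ports in \<open>auto simp: relabel_matrices id_wiring_matrices mcograph_def mgraph_def mzero_def\<close>)
  then show ?thesis
    using diagram_iso_trans[OF open_diagram_act[OF f D] open_diagram_act[OF g E] E] act_id[OF pd(2) E] by blast
qed

section \<open>Sums of diagrams\<close>

definition sum_aux :: "'a diagram \<Rightarrow> 'a diagram \<Rightarrow> 'a vec \<times> 'a vec \<times> 'a vec \<times> 'a vec \<Rightarrow> 'a vec" where
  "sum_aux D E = (\<lambda>(s, q, v, i). \<lambda>z \<in> usum (part D Var) (part E Var).
     copair (aux D (\<lambda>x. s (In1 x), \<lambda>x. q (In1 x), \<lambda>x. v (In1 x), \<lambda>x. i (In1 x)))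
            (aux E (\<lambda>x. s (In2 x), \<lambda>x. q (In2 x), \<lambda>x. v (In2 x), \<lambda>x. i (In2 x))) z)"

definition sum_diagram :: "'a diagram \<Rightarrow> 'a diagram \<Rightarrow> 'a diagram" where
  "sum_diagram D E = \<lparr> schema = free_functor hf_graph (\<lambda>v. usum (part D v) (part E v))
       (\<lambda>a. copair (\<lambda>x. In1 (part_map D a x)) (\<lambda>y. In2 (part_map E a y))),
     aux = sum_aux D E \<rparr>"

text \<open>On the empty set of variables, \<open>\<lambda>_. undefined\<close> is the only extensional function.\<close>

definition empty_diagram :: "'a diagram" where
  "empty_diagram = \<lparr> schema = free_functor hf_graph (\<lambda>_. {}) (\<lambda>_ x. x), aux = (\<lambda>_ _. undefined) \<rparr>"

lemma part_sum [simp]: "part (sum_diagram D E) v = usum (part D v) (part E v)"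
  by (simp add: sum_diagram_def free_functor_def)

lemma sum_map_in:
  assumes "is_diagram D" "is_diagram E"
  shows "copair (\<lambda>x. In1 (part_map D a x)) (\<lambda>y. In2 (part_map E a y))
    \<in> usum (part D (hf_tail a)) (part E (hf_tail a)) \<rightarrow> usum (part D (hf_head a)) (part E (hf_head a))"
  using assms part_map_in by (auto simp: is_diagram_def)

lemma is_diagram_sum:
  assumes "is_diagram D" "is_diagram E" shows "is_diagram (sum_diagram D E)"
  unfolding sum_diagram_def using sum_map_in[OF assms] assms
  by (intro is_diagram_free) (auto simp: is_diagram_def)

lemma part_map_sum:
  assumes "is_diagram D" "is_diagram E"
  shows "x \<in> part D (hf_tail a) \<Longrightarrow> part_map (sum_diagram D E) a (In1 x) = In1 (part_map D a x)"
    "y \<in> part E (hf_tail a) \<Longrightarrow> part_map (sum_diagram D E) a (In2 y) = In2 (part_map E a y)"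
proof -
  let ?m = "\<lambda>a. copair (\<lambda>x. In1 (part_map D a x)) (\<lambda>y. In2 (part_map E a y))"
  have "part_map (sum_diagram D E) a z = ?m a z" if "z \<in> usum (part D (hf_tail a)) (part E (hf_tail a))" for z
    unfolding sum_diagram_def
    by (rule part_map_free[where m = ?m and A = "\<lambda>v. usum (part D v) (part E v)", OF sum_map_in[OF assms] that])
  then show "x \<in> part D (hf_tail a) \<Longrightarrow> part_map (sum_diagram D E) a (In1 x) = In1 (part_map D a x)"
    "y \<in> part E (hf_tail a) \<Longrightarrow> part_map (sum_diagram D E) a (In2 y) = In2 (part_map E a y)" by simp_all
qed

lemma link_sum:
  assumes "is_diagram D" "is_diagram E"
  shows "link_matrix (sum_diagram D E) l = mdiag (link_matrix D l) (link_matrix E l)"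
    "link_rel (sum_diagram D E) l = rsum (link_rel D l) (link_rel E l)"
proof -
  have ap: "apex (link_span (sum_diagram D E) l) = apex (link_span D l +\<^sub>s link_span E l)"
    by (simp add: link_span_def sum_span_def)
  have ends: "src (link_span (sum_diagram D E) l) r = src (link_span D l +\<^sub>s link_span E l) r \<and>
    tgt (link_span (sum_diagram D E) l) r = tgt (link_span D l +\<^sub>s link_span E l) r"
    if "r \<in> apex (link_span D l +\<^sub>s link_span E l)" for r
    using that by (auto simp: link_span_def sum_span_def part_map_sum[OF assms])
  have "link_matrix (sum_diagram D E) l = span_matrix (link_span D l +\<^sub>s link_span E l)"
    "link_rel (sum_diagram D E) l = span_rel (link_span D l +\<^sub>s link_span E l)"
    by (rule span_cong[OF ap]; simp add: ends)+
  then show "link_matrix (sum_diagram D E) l = mdiag (link_matrix D l) (link_matrix E l)"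
    "link_rel (sum_diagram D E) l = rsum (link_rel D l) (link_rel E l)"
    by (simp_all add: span_matrix_sum span_rel_sum)
qed

lemma aux_sum:
  "x \<in> part D Var \<Longrightarrow> aux (sum_diagram D E) (s, q, v, i) (In1 x) =
     aux D (\<lambda>x. s (In1 x), \<lambda>x. q (In1 x), \<lambda>x. v (In1 x), \<lambda>x. i (In1 x)) x"
  "y \<in> part E Var \<Longrightarrow> aux (sum_diagram D E) (s, q, v, i) (In2 y) =
     aux E (\<lambda>x. s (In2 x), \<lambda>x. q (In2 x), \<lambda>x. v (In2 x), \<lambda>x. i (In2 x)) y"
  "aux (sum_diagram D E) (s, q, v, i) \<in> rvec (usum (part D Var) (part E Var))"
  by (simp_all add: sum_diagram_def sum_aux_def)

lemma aux_dom_sum: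
  assumes "(s, q, v, i) \<in> aux_dom (sum_diagram D E)"
  shows "(\<lambda>x. s (In1 x), \<lambda>x. q (In1 x), \<lambda>x. v (In1 x), \<lambda>x. i (In1 x)) \<in> aux_dom D"
    "(\<lambda>x. s (In2 x), \<lambda>x. q (In2 x), \<lambda>x. v (In2 x), \<lambda>x. i (In2 x)) \<in> aux_dom E"
  using assms by (auto simp: aux_dom_def rvec_iff)

lemma rvec_usum_eqI:
  assumes "x \<in> rvec (usum A B)" "y \<in> rvec (usum A B)"
    "\<And>a. a \<in> A \<Longrightarrow> x (In1 a) = y (In1 a)" "\<And>b. b \<in> B \<Longrightarrow> x (In2 b) = y (In2 b)"
  shows "x = y"
  using assms by (intro PiE_ext[OF assms(1,2)]) auto

theorem open_diagram_sum:
  assumes D: "open_diagram X D" and E: "open_diagram Y E"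
  shows "open_diagram (sum_interface X Y) (sum_diagram D E)"
proof -
  note Dd = open_diagramD[OF D] and Ed = open_diagramD[OF E]
  note pm = part_map_sum[OF Dd(1) Ed(1)]
  have inj: "inj_on (part_map (sum_diagram D E) a) (part (sum_diagram D E) (hf_tail a))"
    if "inj_on (part_map D a) (part D (hf_tail a))" "inj_on (part_map E a) (part E (hf_tail a))" for a
    using that by (intro inj_onI) (auto simp: pm inj_on_eq_iff)
  have "aux_respects (sum_diagram D E)"
    unfolding aux_respects_iff link_sum[OF Dd(1) Ed(1)]
  proof (intro ballI allI impI)
    fix b s q v i s' q' v' i'
    assume b: "b \<in> part (sum_diagram D E) Var" and d: "(s, q, v, i) \<in> aux_dom (sum_diagram D E)"
      and d': "(s', q', v', i') \<in> aux_dom (sum_diagram D E)"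
      and agree: "\<forall>a. (a, b) \<in> rsum (link_rel D StockLink) (link_rel E StockLink) \<longrightarrow> s a = s' a"
        "\<forall>a. (a, b) \<in> rsum (link_rel D SumLink) (link_rel E SumLink) \<longrightarrow> q a = q' a"
        "\<forall>a. (a, b) \<in> rsum (link_rel D VarLink) (link_rel E VarLink) \<longrightarrow> v a = v' a"
        "\<forall>a. (a, b) \<in> rsum (link_rel D InLink) (link_rel E InLink) \<longrightarrow> i a = i' a"
    have r: "aux_respects D" "aux_respects E" using D E by (simp_all add: open_diagram_iff)
    from b have "b \<in> usum (part D Var) (part E Var)" by simp
    then show "aux (sum_diagram D E) (s, q, v, i) b = aux (sum_diagram D E) (s', q', v', i') b"
    proof (cases rule: usumE)
      case (In1 x)
      then show ?thesis
        using agree aux_dom_sum(1)[OF d] aux_dom_sum(1)[OF d']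
        by (simp add: aux_sum) (rule r(1)[THEN aux_respects_iff[THEN iffD1, rule_format]], simp_all)
    next
      case (In2 x)
      then show ?thesis
        using agree aux_dom_sum(2)[OF d] aux_dom_sum(2)[OF d']
        by (simp add: aux_sum) (rule r(2)[THEN aux_respects_iff[THEN iffD1, rule_format]], simp_all)
    qed
  qed
  moreover have "aux (sum_diagram D E) \<in> aux_dom (sum_diagram D E) \<rightarrow> rvec (usum (part D Var) (part E Var))"
    by (simp add: sum_diagram_def sum_aux_def split_beta)
  ultimately show ?thesis
    using D E is_diagram_sum[OF Dd(1) Ed(1)] inj[of InflowFlow] inj[of OutflowFlow]
    unfolding open_diagram_iff link_sum[OF Dd(1) Ed(1)]
    by (simp add: rsum_acyclic rsum_rtrancl_relcomp rsum_relcomp rsum_mono)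
qed

lemma part_empty [simp]: "part empty_diagram v = {}"
  by (simp add: empty_diagram_def free_functor_def)

lemma open_diagram_empty: "open_diagram empty_interface (empty_diagram :: 'a diagram)"
proof -
  let ?D = "empty_diagram :: 'a diagram"
  have "is_diagram ?D" unfolding empty_diagram_def by (rule is_diagram_free) auto
  moreover have "link_rel ?D l = {}" for l by (simp add: span_rel_def link_span_def)
  moreover have "aux ?D t = (\<lambda>_. undefined)" for t by (simp add: empty_diagram_def)
  ultimately show ?thesis
    unfolding open_diagram_iff aux_respects_iff by (simp add: acyclic_def)
qed

lemma bij_betw_usum:
  assumes h: "bij_betw h A A'" and k: "bij_betw k B B'"
  shows "bij_betw (copair (\<lambda>x. In1 (h x)) (\<lambda>y. In2 (k y))) (usum A B) (usum A' B')"
proof -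
  let ?m = "copair (\<lambda>x. In1 (h x)) (\<lambda>y. In2 (k y))"
  have "inj_on ?m (usum A B)"
    using bij_betw_imp_inj_on[OF h] bij_betw_imp_inj_on[OF k]
    by (intro inj_onI) (auto simp: inj_on_eq_iff)
  moreover have "?m ` usum A B = In1 ` (h ` A) \<union> In2 ` (k ` B)"
    unfolding usum_def image_Un image_image by simp
  then have "?m ` usum A B = usum A' B'"
    by (simp add: usum_def bij_betw_imp_surj_on[OF h] bij_betw_imp_surj_on[OF k])
  ultimately show ?thesis by (simp add: bij_betw_def)
qed

lemma sum_diagram_cong:
  assumes D: "open_diagram X D" and D': "open_diagram X D'" and E: "open_diagram Y E" and E': "open_diagram Y E'"
    and iso: "diagram_iso D D'" "diagram_iso E E'"
  shows "diagram_iso (sum_diagram D E) (sum_diagram D' E')"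
proof -
  note Dd = open_diagramD[OF D] and Ed = open_diagramD[OF E] and D'd = open_diagramD[OF D'] and E'd = open_diagramD[OF E']
  from diagram_isoE[OF D D' iso(1)] obtain h where h: "matches D D' h"
    "\<And>x. x \<in> in_ports X \<Longrightarrow> h InPort x = x" "\<And>x. x \<in> out_ports X \<Longrightarrow> h OutPort x = x" by blast
  from diagram_isoE[OF E E' iso(2)] obtain k where k: "matches E E' k"
    "\<And>x. x \<in> in_ports Y \<Longrightarrow> k InPort x = x" "\<And>x. x \<in> out_ports Y \<Longrightarrow> k OutPort x = x" by blast
  define m where "m v = copair (\<lambda>x. In1 (h v x)) (\<lambda>y. In2 (k v y))" for v
  have m: "m v (In1 x) = In1 (h v x)" "m v (In2 y) = In2 (k v y)" for v x y by (simp_all add: m_def)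
  have h_in: "h v x \<in> part D' v" if "x \<in> part D v" "\<And>l. v \<noteq> Link l" for v x
    using bij_betw_apply[OF matchesD(1)[OF h(1) that(2)] that(1)] .
  have k_in: "k v x \<in> part E' v" if "x \<in> part E v" "\<And>l. v \<noteq> Link l" for v x
    using bij_betw_apply[OF matchesD(1)[OF k(1) that(2)] that(1)] .
  have pb: "(\<lambda>x. pullback (usum (part D v) (part E v)) (m v) z (In1 x)) = pullback (part D v) (h v) (\<lambda>x. z (In1 x))"
    "(\<lambda>x. pullback (usum (part D v) (part E v)) (m v) z (In2 x)) = pullback (part E v) (k v) (\<lambda>x. z (In2 x))"
    for v and z :: "'a vec"
    by (auto simp: pullback_def m)
  have "matches (sum_diagram D E) (sum_diagram D' E') m"
    unfolding matches_def
  proof (intro conjI allI ballI impI)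
    fix v assume v: "\<forall>l. v \<noteq> Link l"
    then have "bij_betw (h v) (part D v) (part D' v)" "bij_betw (k v) (part E v) (part E' v)"
      using matchesD(1)[OF h(1)] matchesD(1)[OF k(1)] by blast+
    then show "bij_betw (m v) (part (sum_diagram D E) v) (part (sum_diagram D' E') v)"
      unfolding m_def part_sum by (rule bij_betw_usum)
  next
    fix a x assume a: "a \<in> flow_arrows"
      and x: "x \<in> part (sum_diagram D E) (hf_tail a)"
    have nl: "\<And>l. hf_tail a \<noteq> Link l" using a by auto
    from x have "x \<in> usum (part D (hf_tail a)) (part E (hf_tail a))" by simp
    then show "part_map (sum_diagram D' E') a (m (hf_tail a) x) = m (hf_head a) (part_map (sum_diagram D E) a x)"
    proof (cases rule: usumE)
      case (In1 y)
      then show ?thesis using matchesD(2)[OF h(1) a In1(2)] h_in[OF In1(2) nl]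
        by (simp add: m part_map_sum[OF Dd(1) Ed(1)] part_map_sum[OF D'd(1) E'd(1)])
    next
      case (In2 y)
      then show ?thesis using matchesD(2)[OF k(1) a In2(2)] k_in[OF In2(2) nl]
        by (simp add: m part_map_sum[OF Dd(1) Ed(1)] part_map_sum[OF D'd(1) E'd(1)])
    qed
  next
    fix l x y assume "x \<in> part (sum_diagram D E) (link_src l)" "y \<in> part (sum_diagram D E) (link_tgt l)"
    then have "x \<in> usum (part D (link_src l)) (part E (link_src l))" "y \<in> usum (part D (link_tgt l)) (part E (link_tgt l))"
      by simp_all
    then show "link_matrix (sum_diagram D' E') l (m (link_src l) x) (m (link_tgt l) y) = link_matrix (sum_diagram D E) l x y"
      unfolding link_sum[OF Dd(1) Ed(1)] link_sum[OF D'd(1) E'd(1)]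
      by (elim usumE) (simp_all add: m mdiag_def matchesD(3)[OF h(1)] matchesD(3)[OF k(1)])
  next
    fix s q v i assume d: "(s, q, v, i) \<in> aux_dom (sum_diagram D' E')"
    show "pullback (part (sum_diagram D E) Var) (m Var) (aux (sum_diagram D' E') (s, q, v, i)) =
        aux (sum_diagram D E) (pullback (part (sum_diagram D E) Stock) (m Stock) s,
          pullback (part (sum_diagram D E) SumVar) (m SumVar) q,
          pullback (part (sum_diagram D E) Var) (m Var) v, pullback (part (sum_diagram D E) InPort) (m InPort) i)" (is "?l = ?r")
    proof (rule rvec_usum_eqI)
      show "?l \<in> rvec (usum (part D Var) (part E Var))" unfolding part_sum by (rule pullback_in)
      show "?r \<in> rvec (usum (part D Var) (part E Var))" by (rule aux_sum(3))
    next
      fix x assume x: "x \<in> part D Var"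
      then have hx: "h Var x \<in> part D' Var" by (simp add: h_in)
      show "?l (In1 x) = ?r (In1 x)"
        using fun_cong[OF matchesD(4)[OF h(1) aux_dom_sum(1)[OF d]], of x] x
        unfolding part_sum aux_sum(1)[OF x] pb by (simp add: pullback_def m aux_sum(1)[OF hx])
    next
      fix x assume x: "x \<in> part E Var"
      then have kx: "k Var x \<in> part E' Var" by (simp add: k_in)
      show "?l (In2 x) = ?r (In2 x)"
        using fun_cong[OF matchesD(4)[OF k(1) aux_dom_sum(2)[OF d]], of x] x
        unfolding part_sum aux_sum(2)[OF x] pb by (simp add: pullback_def m aux_sum(2)[OF kx])
    qed
  qed
  then show ?thesis
    by (rule diagram_isoI[OF open_diagram_sum[OF D E] open_diagram_sum[OF D' E']]) (auto simp: m h k)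
qed

text \<open>Block sums of matrices can be added and multiplied blockwise, and the sum of the diagrams feeds
  each block of inputs from its own variables and outer ports.\<close>

lemma act_sum:
  assumes f: "is_dep_wiring X X' f" and g: "is_dep_wiring Y Y' g"
    and D: "open_diagram X D" and E: "open_diagram Y E"
  shows "diagram_iso (act (sum_interface X' Y') (sum_wiring f g) (sum_diagram D E))
    (sum_diagram (act X' f D) (act Y' g E))"
proof -
  let ?fg = "sum_wiring f g" and ?S = "sum_diagram D E" and ?T = "sum_diagram (act X' f D) (act Y' g E)"
  let ?A = "act (sum_interface X' Y') (sum_wiring f g) (sum_diagram D E)"
  note fg = is_dep_wiring_sum[OF f g] and S = open_diagram_sum[OF D E]
  note fd = is_dep_wiringD[OF f] and gd = is_dep_wiringD[OF g]
  note fD = open_diagram_act[OF f D] and gE = open_diagram_act[OF g E]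
  note Dd = open_diagramD[OF D] and Ed = open_diagramD[OF E] and fDd = open_diagramD[OF fD] and gEd = open_diagramD[OF gE]
  note T = open_diagram_sum[OF fD gE] and A = open_diagram_act[OF fg S]
  note fin = finite_ports[OF fd(1)] finite_ports[OF fd(2)] finite_ports[OF gd(1)] finite_ports[OF gd(2)] Dd(5) Ed(5)
  have drive: "(\<lambda>x. driven_inputs ?fg ?S v y (In1 x)) = driven_inputs f D (\<lambda>x. v (In1 x)) (\<lambda>x. y (In1 x))"
    "(\<lambda>x. driven_inputs ?fg ?S v y (In2 x)) = driven_inputs g E (\<lambda>x. v (In2 x)) (\<lambda>x. y (In2 x))" for v y
    unfolding driven_inputs_eq[OF fg S] driven_inputs_eq[OF f D] driven_inputs_eq[OF g E]
    by (simp_all add: fun_eq_iff restrict_apply sum_usum fin sum_wiring_matrices link_sum[OF Dd(1) Ed(1)] mdiag_def)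
  have "matches ?A ?T (\<lambda>_ x. x)"
  proof (rule matches_idI)
    fix v assume "\<And>l. v \<noteq> Link l"
    then show "part ?A v = part ?T v" by (cases v) auto
  next
    fix a x assume a: "a \<in> flow_arrows"
      and x: "x \<in> part ?A (hf_tail a)"
    have xS: "x \<in> part ?S (hf_tail a)" using a x by auto
    have tails: "part (act X' f D) (hf_tail a) = part D (hf_tail a)" "part (act Y' g E) (hf_tail a) = part E (hf_tail a)"
      using a by auto
    from xS have "x \<in> usum (part D (hf_tail a)) (part E (hf_tail a))" by simp
    then show "part_map ?T a x = part_map ?A a x"
      unfolding part_map_act_nonlink[OF is_dep_wiringD(3)[OF fg] S a xS]
      by (elim usumE) (simp_all add: part_map_sum[OF Dd(1) Ed(1)] part_map_sum[OF fDd(1) gEd(1)] tails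
        part_map_act_nonlink[OF fd(3) D a] part_map_act_nonlink[OF gd(3) E a])
  next
    fix l show "link_matrix ?A l = link_matrix ?T l"
      by (cases l) (simp_all add: act_matrix[OF fg S] link_sum[OF fDd(1) gEd(1)] link_sum[OF Dd(1) Ed(1)]
          act_matrix[OF f D] act_matrix[OF g E] sum_wiring_matrices mdiag_mmul mdiag_madd fin)
  next
    show "aux ?T \<in> aux_dom ?T \<rightarrow> rvec (part ?T Var)" by (rule open_diagramD(4)[OF T])
    fix s q v i assume d: "(s, q, v, i) \<in> aux_dom ?T"
    show "aux ?A (s, q, v, i) = aux ?T (s, q, v, i)"
      unfolding aux_act
    proof (rule rvec_usum_eqI[OF aux_sum(3)])
      show "aux ?T (s, q, v, i) \<in> rvec (usum (part D Var) (part E Var))"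
        using aux_sum(3)[of "act X' f D" "act Y' g E"] by simp
    qed (simp_all add: aux_sum aux_act drive)
  qed
  then show ?thesis by (rule diagram_isoI[OF A T]) auto
qed

section \<open>Coherence of sums of diagrams\<close>

text \<open>The reassociation of coproducts is applied to every part of the diagram, ports included. This
  is why, by \<open>act_relabel\<close>, the associator of wirings carries one bracketing to the other; the
  unitors below are treated in the same way.\<close>

lemma sum_diagram_assoc:
  assumes D: "open_diagram X D" and E: "open_diagram Y E" and F: "open_diagram Z F"
  shows "matches (sum_diagram (sum_diagram D E) F) (sum_diagram D (sum_diagram E F)) (\<lambda>_. port_assoc)"
proof -
  let ?L = "sum_diagram (sum_diagram D E) F" and ?R = "sum_diagram D (sum_diagram E F)"
  note DE = open_diagram_sum[OF D E] and EF = open_diagram_sum[OF E F]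
  note d = open_diagramD(1)[OF D] open_diagramD(1)[OF E] open_diagramD(1)[OF F] open_diagramD(1)[OF DE] open_diagramD(1)[OF EF]
  note pm = part_map_sum[OF d(1,2)] part_map_sum[OF d(2,3)] part_map_sum[OF d(4,3)] part_map_sum[OF d(1,5)]
  note lm = link_sum(1)[OF d(1,2)] link_sum(1)[OF d(2,3)] link_sum(1)[OF d(4,3)] link_sum(1)[OF d(1,5)]
  show ?thesis
    unfolding matches_def
  proof (intro conjI allI ballI impI)
    show "bij_betw port_assoc (part ?L v) (part ?R v)" for v
      by (rule bij_betw_byWitness[where f' = "copair (\<lambda>x. In1 (In1 x)) (copair (\<lambda>y. In1 (In2 y)) In2)"]) auto
    fix a x assume "x \<in> part ?L (hf_tail a)"
    then show "part_map ?R a (port_assoc x) = port_assoc (part_map ?L a x)" by (auto simp: pm)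
  next
    fix l x y assume "x \<in> part ?L (link_src l)" "y \<in> part ?L (link_tgt l)"
    then show "link_matrix ?R l (port_assoc x) (port_assoc y) = link_matrix ?L l x y"
      unfolding lm by (auto simp: mdiag_def)
  next
    fix s q v i assume dom: "(s, q, v, i) \<in> aux_dom ?R"
    have pb: "(\<lambda>x. pullback (usum (usum A B) C) port_assoc z (In1 (In1 x))) = (\<lambda>x. z (In1 x))"
      "(\<lambda>x. pullback (usum (usum A B) C) port_assoc z (In1 (In2 x))) = (\<lambda>x. z (In2 (In1 x)))"
      "(\<lambda>x. pullback (usum (usum A B) C) port_assoc z (In2 x)) = (\<lambda>x. z (In2 (In2 x)))"
      if "z \<in> rvec (usum A (usum B C))" for A B C and z :: "'a vec"
      using that by (auto simp: pullback_def rvec_iff)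
    have dom': "s \<in> rvec (usum (part D Stock) (usum (part E Stock) (part F Stock)))"
      "q \<in> rvec (usum (part D SumVar) (usum (part E SumVar) (part F SumVar)))"
      "v \<in> rvec (usum (part D Var) (usum (part E Var) (part F Var)))"
      "i \<in> rvec (usum (part D InPort) (usum (part E InPort) (part F InPort)))"
      using dom by (simp_all add: aux_dom_def)
    show "pullback (part ?L Var) port_assoc (aux ?R (s, q, v, i)) =
      aux ?L (pullback (part ?L Stock) port_assoc s, pullback (part ?L SumVar) port_assoc q,
        pullback (part ?L Var) port_assoc v, pullback (part ?L InPort) port_assoc i)"
      unfolding part_sum
    proof (rule rvec_usum_eqI[OF pullback_in])
      show "aux ?L t \<in> rvec (usum (usum (part D Var) (part E Var)) (part F Var))" for t
        using aux_sum(3)[of "sum_diagram D E" F] by (cases t) simp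
    qed (auto simp: aux_sum pb[OF dom'(1)] pb[OF dom'(2)] pb[OF dom'(3)] pb[OF dom'(4)] pullback_def[of _ _ "aux ?R (s, q, v, i)"])
  qed
qed

lemma sum_diagram_lunit:
  assumes D: "open_diagram X D"
  shows "matches (sum_diagram empty_diagram D) D (\<lambda>_. port_lunit)"
proof -
  let ?L = "sum_diagram empty_diagram D"
  note d = open_diagramD(1)[OF open_diagram_empty] open_diagramD(1)[OF D]
  show ?thesis
    unfolding matches_def
  proof (intro conjI allI ballI impI)
    show "bij_betw port_lunit (part ?L v) (part D v)" for v
      by (rule bij_betw_byWitness[where f' = In2]) auto
    fix a x assume "x \<in> part ?L (hf_tail a)"
    then show "part_map D a (port_lunit x) = port_lunit (part_map ?L a x)" by (auto simp: part_map_sum[OF d])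
  next
    fix l x y assume "x \<in> part ?L (link_src l)" "y \<in> part ?L (link_tgt l)"
    then show "link_matrix D l (port_lunit x) (port_lunit y) = link_matrix ?L l x y"
      unfolding link_sum(1)[OF d] by (auto simp: mdiag_def)
  next
    fix s q v i assume dom: "(s, q, v, i) \<in> aux_dom D"
    have pb: "(\<lambda>x. pullback (usum {} A) port_lunit z (In2 x)) = z" if "z \<in> rvec A" for A and z :: "'a vec"
      using that by (auto simp: pullback_def rvec_iff)
    have dom': "s \<in> rvec (part D Stock)" "q \<in> rvec (part D SumVar)" "v \<in> rvec (part D Var)" "i \<in> rvec (part D InPort)"
      using dom by (simp_all add: aux_dom_def)
    show "pullback (part ?L Var) port_lunit (aux D (s, q, v, i)) =
      aux ?L (pullback (part ?L Stock) port_lunit s, pullback (part ?L SumVar) port_lunit q,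
        pullback (part ?L Var) port_lunit v, pullback (part ?L InPort) port_lunit i)"
      unfolding part_sum part_empty
    proof (rule rvec_usum_eqI[OF pullback_in])
      show "aux ?L t \<in> rvec (usum {} (part D Var))" for t
        using aux_sum(3)[of empty_diagram D] by (cases t) simp
    qed (auto simp: aux_sum pb[OF dom'(1)] pb[OF dom'(2)] pb[OF dom'(3)] pb[OF dom'(4)] pullback_def[of _ _ "aux D (s, q, v, i)"])
  qed
qed

lemma sum_diagram_runit:
  assumes D: "open_diagram X D"
  shows "matches (sum_diagram D empty_diagram) D (\<lambda>_. port_runit)"
proof -
  let ?L = "sum_diagram D empty_diagram"
  note d = open_diagramD(1)[OF D] open_diagramD(1)[OF open_diagram_empty]
  show ?thesis
    unfolding matches_def
  proof (intro conjI allI ballI impI)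
    show "bij_betw port_runit (part ?L v) (part D v)" for v
      by (rule bij_betw_byWitness[where f' = In1]) auto
    fix a x assume "x \<in> part ?L (hf_tail a)"
    then show "part_map D a (port_runit x) = port_runit (part_map ?L a x)" by (auto simp: part_map_sum[OF d])
  next
    fix l x y assume "x \<in> part ?L (link_src l)" "y \<in> part ?L (link_tgt l)"
    then show "link_matrix D l (port_runit x) (port_runit y) = link_matrix ?L l x y"
      unfolding link_sum(1)[OF d] by (auto simp: mdiag_def)
  next
    fix s q v i assume dom: "(s, q, v, i) \<in> aux_dom D"
    have pb: "(\<lambda>x. pullback (usum A {}) port_runit z (In1 x)) = z" if "z \<in> rvec A" for A and z :: "'a vec"
      using that by (auto simp: pullback_def rvec_iff)
    have dom': "s \<in> rvec (part D Stock)" "q \<in> rvec (part D SumVar)" "v \<in> rvec (part D Var)" "i \<in> rvec (part D InPort)"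
      using dom by (simp_all add: aux_dom_def)
    show "pullback (part ?L Var) port_runit (aux D (s, q, v, i)) =
      aux ?L (pullback (part ?L Stock) port_runit s, pullback (part ?L SumVar) port_runit q,
        pullback (part ?L Var) port_runit v, pullback (part ?L InPort) port_runit i)"
      unfolding part_sum part_empty
    proof (rule rvec_usum_eqI[OF pullback_in])
      show "aux ?L t \<in> rvec (usum (part D Var) {})" for t
        using aux_sum(3)[of D empty_diagram] by (cases t) simp
    qed (auto simp: aux_sum pb[OF dom'(1)] pb[OF dom'(2)] pb[OF dom'(3)] pb[OF dom'(4)] pullback_def[of _ _ "aux D (s, q, v, i)"])
  qed
qed


section \<open>The lax monoidal functor\<close>

definition un_atom :: "'b univ \<Rightarrow> 'b" where
  "un_atom z = (case z of Atom c \<Rightarrow> c | _ \<Rightarrow> undefined)"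

lemma un_atom_Atom [simp]: "un_atom (Atom c) = c"
  by (simp add: un_atom_def)

definition diagram_space :: "'a interface \<Rightarrow> 'a diagram set univ set" where
  "diagram_space X = {Atom (diagram_class X D) | D. open_diagram X D}"

text \<open>As in the composition of wirings, classes are lifted by unions over representatives; the classes
  in these unions are all equal.\<close>

definition SF :: "('a interface, 'a dwd_arrow, 'a diagram set univ set, 'a diagram set set_arrow) functor_data" where
  "SF = \<lparr> fob = diagram_space,
     far = (\<lambda>(X, \<Phi>, Y). set_arrow (diagram_space X)
       (\<lambda>z. Atom (\<Union>f\<in>\<Phi>. \<Union>D\<in>un_atom z. diagram_class Y (act Y f D))) (diagram_space Y)) \<rparr>"

definition laxator :: "'a interface \<Rightarrow> 'a interface \<Rightarrow> 'a diagram set set_arrow" where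
  "laxator X Y = set_arrow (uprod (diagram_space X) (diagram_space Y))
     (\<lambda>z. Atom (\<Union>D\<in>un_atom (pfst z). \<Union>E\<in>un_atom (psnd z).
        diagram_class (sum_interface X Y) (sum_diagram D E))) (diagram_space (sum_interface X Y))"

definition lax_unit :: "'a diagram set set_arrow" where
  "lax_unit = set_arrow {Star} (\<lambda>_. Atom (diagram_class empty_interface empty_diagram)) (diagram_space empty_interface)"

lemma diagram_spaceI: "open_diagram X D \<Longrightarrow> Atom (diagram_class X D) \<in> diagram_space X"
  by (auto simp: diagram_space_def)

lemma diagram_spaceE:
  assumes "z \<in> diagram_space X" obtains D where "z = Atom (diagram_class X D)" "open_diagram X D"
  using assms by (auto simp: diagram_space_def)

lemma act_class_eq:
  assumes f: "is_dep_wiring X Y f" and D: "open_diagram X D"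
    and f': "f' \<in> wiring_class X Y f" and D': "D' \<in> diagram_class X D"
  shows "diagram_class Y (act Y f' D') = diagram_class Y (act Y f D)"
proof -
  have w: "is_wiring X Y f'" "same_wires f f'" using f' is_dep_wiringD(3)[OF f] by (simp_all add: mem_wiring_class)
  then have f'd: "is_dep_wiring X Y f'" using is_dep_wiring_cong[OF f] by blast
  have D'o: "open_diagram X D'" "diagram_iso D D'" using D' by (simp_all add: diagram_class_def)
  show ?thesis
    by (rule diagram_class_eqI[OF open_diagram_act[OF f D] open_diagram_act[OF f'd D'o(1)]
          act_cong[OF f f'd w(2) D D'o], symmetric])
qed

lemma SF_apply:
  assumes f: "is_dep_wiring X Y f" and D: "open_diagram X D"
  shows "arrow_fun (far SF (dwd_arrow X f Y)) (Atom (diagram_class X D)) = Atom (diagram_class Y (act Y f D))"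
proof -
  have "f \<in> wiring_class X Y f" "D \<in> diagram_class X D"
    using self_in_wiring_class[OF is_dep_wiringD(3)[OF f]] self_in_diagram_class[OF D] .
  then have "(\<Union>f'\<in>wiring_class X Y f. \<Union>D'\<in>diagram_class X D. diagram_class Y (act Y f' D'))
      = diagram_class Y (act Y f D)"
    using act_class_eq[OF f D] by blast
  then show ?thesis by (simp add: SF_def dwd_arrow_def diagram_spaceI[OF D])
qed

lemma fob_SF: "fob SF X = diagram_space X"
  by (simp add: SF_def)

lemma far_SF_in:
  assumes f: "is_dep_wiring X Y f"
  shows "far SF (dwd_arrow X f Y) \<in> hom SET (diagram_space X) (diagram_space Y)"
proof -
  have "arrow_fun (far SF (dwd_arrow X f Y)) z \<in> diagram_space Y" if "z \<in> diagram_space X" for z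
    using that by (rule diagram_spaceE) (simp add: SF_apply[OF f] diagram_spaceI open_diagram_act[OF f])
  then show ?thesis by (simp add: SF_def dwd_arrow_def set_arrow_in Pi_iff)
qed

lemma laxator_apply:
  assumes D: "open_diagram X D" and E: "open_diagram Y E"
  shows "arrow_fun (laxator X Y) (Pr (Atom (diagram_class X D)) (Atom (diagram_class Y E)))
    = Atom (diagram_class (sum_interface X Y) (sum_diagram D E))"
proof -
  have "diagram_class (sum_interface X Y) (sum_diagram D' E') = diagram_class (sum_interface X Y) (sum_diagram D E)"
    if "D' \<in> diagram_class X D" "E' \<in> diagram_class Y E" for D' E'
    using that D E unfolding diagram_class_def[of X] diagram_class_def[of Y]
    by (intro diagram_class_eqI[symmetric] open_diagram_sum sum_diagram_cong[of X D D' Y E E']) auto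
  moreover have "D \<in> diagram_class X D" "E \<in> diagram_class Y E"
    using self_in_diagram_class[OF D] self_in_diagram_class[OF E] .
  ultimately have "(\<Union>D'\<in>diagram_class X D. \<Union>E'\<in>diagram_class Y E.
      diagram_class (sum_interface X Y) (sum_diagram D' E')) = diagram_class (sum_interface X Y) (sum_diagram D E)"
    by blast
  then show ?thesis by (simp add: laxator_def diagram_spaceI[OF D] diagram_spaceI[OF E])
qed

lemma laxator_in:
  "laxator X Y \<in> hom SET (uprod (diagram_space X) (diagram_space Y)) (diagram_space (sum_interface X Y))"
proof -
  have "arrow_fun (laxator X Y) z \<in> diagram_space (sum_interface X Y)"
    if "z \<in> uprod (diagram_space X) (diagram_space Y)" for z
    using that by (elim uprodE diagram_spaceE) (simp add: laxator_apply diagram_spaceI open_diagram_sum)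
  then show ?thesis by (simp add: laxator_def set_arrow_in Pi_iff)
qed

lemma lax_unit_in: "lax_unit \<in> hom SET {Star} (diagram_space empty_interface)"
  unfolding lax_unit_def by (rule set_arrow_in) (simp add: diagram_spaceI[OF open_diagram_empty])

lemma lax_unit_apply: "arrow_fun lax_unit Star = Atom (diagram_class empty_interface empty_diagram)"
  by (simp add: lax_unit_def)

lemma SF_functor: "is_functor dDWD SET SF"
proof -
  interpret C: is_category dDWD by (rule dDWD_category)
  interpret S: is_category SET by (rule SET_category)
  show ?thesis
  proof
    fix X Y Z :: "'a interface" and f g :: "'a dwd_arrow"
    show "fob SF X \<in> Ob SET" by (simp add: SET_simps)
    show "far SF (Idn dDWD X) = Idn SET (fob SF X)" if "X \<in> Ob dDWD"
    proof -
      have X: "is_interface X" using that by (simp add: dDWD_simps)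
      show ?thesis
        unfolding fob_SF Idn_dDWD
      proof (rule hom_SET_eqI[OF far_SF_in[OF is_dep_wiring_id[OF X]] SET_Idn_in])
        fix z assume z: "z \<in> diagram_space X"
        then obtain D where D: "z = Atom (diagram_class X D)" "open_diagram X D" by (rule diagram_spaceE)
        have "diagram_class X (act X (id_wiring X) D) = diagram_class X D"
          by (rule diagram_class_eqI[OF open_diagram_act[OF is_dep_wiring_id[OF X] D(2)] D(2) act_id[OF X D(2)]])
        then show "arrow_fun (far SF (dwd_arrow X (id_wiring X) X)) z = arrow_fun (Idn SET (diagram_space X)) z"
          unfolding arrow_fun_Idn[OF z] by (simp add: D(1) SF_apply[OF is_dep_wiring_id[OF X] D(2)])
      qed
    qed
    assume "f \<in> hom dDWD X Y"
    then obtain f' where f: "f = dwd_arrow X f' Y" "is_dep_wiring X Y f'" by (auto simp: hom_dDWD)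
    show "far SF f \<in> hom SET (fob SF X) (fob SF Y)" unfolding f fob_SF by (rule far_SF_in[OF f(2)])
    assume "g \<in> hom dDWD Y Z"
    then obtain g' where g: "g = dwd_arrow Y g' Z" "is_dep_wiring Y Z g'" by (auto simp: hom_dDWD)
    note gf = is_dep_wiring_comp[OF f(2) g(2)]
    show "far SF (g \<cdot>\<^bsub>dDWD\<^esub> f) = far SF g \<cdot>\<^bsub>SET\<^esub> far SF f"
      unfolding f g dDWD_comp[OF f(2) g(2)]
    proof (rule hom_SET_eqI[OF far_SF_in[OF gf] SET_comp_in[OF far_SF_in[OF f(2)] far_SF_in[OF g(2)]]])
      fix z assume z: "z \<in> diagram_space X"
      then obtain D where D: "z = Atom (diagram_class X D)" "open_diagram X D" by (rule diagram_spaceE)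
      note fD = open_diagram_act[OF f(2) D(2)]
      have "diagram_class Z (act Z (comp_wiring g' f') D) = diagram_class Z (act Z g' (act Y f' D))"
        by (rule diagram_class_eqI[OF open_diagram_act[OF gf D(2)] open_diagram_act[OF g(2) fD] act_comp[OF f(2) g(2) D(2)]])
      then show "arrow_fun (far SF (dwd_arrow X (comp_wiring g' f') Z)) z
          = arrow_fun (far SF (dwd_arrow Y g' Z) \<cdot>\<^bsub>SET\<^esub> far SF (dwd_arrow X f' Y)) z"
        unfolding arrow_fun_comp[OF far_SF_in[OF f(2)] far_SF_in[OF g(2)] z]
        by (simp add: D(1) SF_apply[OF f(2) D(2)] SF_apply[OF g(2) fD] SF_apply[OF gf D(2)])
    qed
  qed
qed

lemma far_SF_relabelling:
  assumes p: "port_iso X Y p" and D: "open_diagram X D" and E: "open_diagram Y E"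
    and m: "matches D E (\<lambda>_. p)"
  shows "arrow_fun (far SF (relabelling p X Y)) (Atom (diagram_class X D)) = Atom (diagram_class Y E)"
  unfolding relabelling_def SF_apply[OF is_dep_wiring_relabel[OF p] D]
  using diagram_class_eqI[OF open_diagram_act[OF is_dep_wiring_relabel[OF p] D] E act_relabel[OF p D E m]] by simp

lemma far_SF_relabelling_in:
  "port_iso X Y p \<Longrightarrow> far SF (relabelling p X Y) \<in> hom SET (diagram_space X) (diagram_space Y)"
  unfolding relabelling_def by (rule far_SF_in[OF is_dep_wiring_relabel])

lemma laxator_natural:
  assumes f: "is_dep_wiring X X' f" and g: "is_dep_wiring Y Y' g"
  shows "far SF (dwd_arrow X f X' \<odot>\<^bsub>dDWD\<^esub> dwd_arrow Y g Y') \<cdot>\<^bsub>SET\<^esub> laxator X Y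
    = laxator X' Y' \<cdot>\<^bsub>SET\<^esub> (far SF (dwd_arrow X f X') \<odot>\<^bsub>SET\<^esub> far SF (dwd_arrow Y g Y'))" (is "?l = ?r")
proof -
  note fg = is_dep_wiring_sum[OF f g]
  note i1 = far_SF_in[OF fg, folded dDWD_tenA[OF f g]] and i2 = SET_tenA_in[OF far_SF_in[OF f] far_SF_in[OF g]]
  show ?thesis
  proof (rule hom_SET_eqI[OF SET_comp_in[OF laxator_in i1] SET_comp_in[OF i2 laxator_in]])
    fix z assume z: "z \<in> uprod (diagram_space X) (diagram_space Y)"
    then obtain D E where DE: "z = Pr (Atom (diagram_class X D)) (Atom (diagram_class Y E))"
      and D: "open_diagram X D" and E: "open_diagram Y E" by (auto elim!: diagram_spaceE)
    note fD = open_diagram_act[OF f D] and gE = open_diagram_act[OF g E] and DE' = open_diagram_sum[OF D E]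
    have "diagram_class (sum_interface X' Y') (act (sum_interface X' Y') (sum_wiring f g) (sum_diagram D E))
        = diagram_class (sum_interface X' Y') (sum_diagram (act X' f D) (act Y' g E))"
      by (rule diagram_class_eqI[OF open_diagram_act[OF fg DE'] open_diagram_sum[OF fD gE] act_sum[OF f g D E]])
    then show "arrow_fun ?l z = arrow_fun ?r z"
      unfolding arrow_fun_comp[OF laxator_in i1 z] arrow_fun_comp[OF i2 laxator_in z]
      unfolding DE dDWD_tenA[OF f g] by (simp add: arrow_fun_tenA[OF far_SF_in[OF f] far_SF_in[OF g] diagram_spaceI[OF D] diagram_spaceI[OF E]]
          laxator_apply[OF D E] SF_apply[OF f D] SF_apply[OF g E] laxator_apply[OF fD gE] SF_apply[OF fg DE'])
  qed
qed

lemma laxator_assoc: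
  assumes X: "is_interface X" and Y: "is_interface Y" and Z: "is_interface Z"
  shows "far SF (assoc dDWD X Y Z) \<cdot>\<^bsub>SET\<^esub> laxator (sum_interface X Y) Z \<cdot>\<^bsub>SET\<^esub> (laxator X Y \<odot>\<^bsub>SET\<^esub> Idn SET (diagram_space Z))
    = laxator X (sum_interface Y Z) \<cdot>\<^bsub>SET\<^esub> (Idn SET (diagram_space X) \<odot>\<^bsub>SET\<^esub> laxator Y Z)
        \<cdot>\<^bsub>SET\<^esub> assoc SET (diagram_space X) (diagram_space Y) (diagram_space Z)" (is "?l = ?r")
proof -
  note p = port_iso_assoc[OF X Y Z]
  note l1 = SET_tenA_in[OF laxator_in[of X Y] SET_Idn_in[of "diagram_space Z"]]
  note l2 = SET_comp_in[OF l1 laxator_in] and l3 = far_SF_relabelling_in[OF p]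
  note r1 = SET_struct_in(1)[of "diagram_space X" "diagram_space Y" "diagram_space Z"]
  note r2 = SET_tenA_in[OF SET_Idn_in[of "diagram_space X"] laxator_in[of Y Z]]
  note r3 = SET_comp_in[OF r1 r2]
  show ?thesis
  proof (rule hom_SET_eqI[OF SET_comp_in[OF l2 l3, folded dDWD_struct] SET_comp_in[OF r3 laxator_in]])
    fix z assume z: "z \<in> uprod (uprod (diagram_space X) (diagram_space Y)) (diagram_space Z)"
    then obtain D E F where DEF: "z = Pr (Pr (Atom (diagram_class X D)) (Atom (diagram_class Y E))) (Atom (diagram_class Z F))"
      and D: "open_diagram X D" and E: "open_diagram Y E" and F: "open_diagram Z F"
      by (auto elim!: diagram_spaceE)
    note DE = open_diagram_sum[OF D E] and EF = open_diagram_sum[OF E F]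
    note DE_F = open_diagram_sum[OF DE F] and D_EF = open_diagram_sum[OF D EF]
    note s = diagram_spaceI[OF D] diagram_spaceI[OF E] diagram_spaceI[OF F] diagram_spaceI[OF EF]
    have sXY: "Pr (Atom (diagram_class X D)) (Atom (diagram_class Y E)) \<in> uprod (diagram_space X) (diagram_space Y)"
      "Pr (Atom (diagram_class Y E)) (Atom (diagram_class Z F)) \<in> uprod (diagram_space Y) (diagram_space Z)"
      using s by simp_all
    show "arrow_fun ?l z = arrow_fun ?r z"
      unfolding dDWD_struct arrow_fun_comp[OF l2 l3 z] arrow_fun_comp[OF l1 laxator_in z] arrow_fun_comp[OF r3 laxator_in z]
        arrow_fun_comp[OF r1 r2 z]
      unfolding DEF arrow_fun_tenA[OF laxator_in SET_Idn_in sXY(1) s(3)] laxator_apply[OF D E] arrow_fun_Idn[OF s(3)]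
        laxator_apply[OF DE F] far_SF_relabelling[OF p DE_F D_EF sum_diagram_assoc[OF D E F]]
      using s sXY by (simp add: SET_simps(5) arrow_fun_tenA[OF SET_Idn_in laxator_in] laxator_apply[OF E F]
        arrow_fun_Idn laxator_apply[OF D EF])
  qed
qed

lemma laxator_lunit:
  assumes X: "is_interface X"
  shows "far SF (lunit dDWD X) \<cdot>\<^bsub>SET\<^esub> laxator empty_interface X \<cdot>\<^bsub>SET\<^esub> (lax_unit \<odot>\<^bsub>SET\<^esub> Idn SET (diagram_space X))
    = lunit SET (diagram_space X)" (is "?l = ?r")
proof -
  note p = port_iso_lunit[OF X]
  note l1 = SET_tenA_in[OF lax_unit_in SET_Idn_in[of "diagram_space X"]]
  note l2 = SET_comp_in[OF l1 laxator_in] and l3 = far_SF_relabelling_in[OF p]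
  show ?thesis
  proof (rule hom_SET_eqI[OF SET_comp_in[OF l2 l3, folded dDWD_struct] SET_struct_in(2)])
    fix z :: "'a diagram set univ" assume z: "z \<in> uprod {Star} (diagram_space X)"
    then obtain D where z': "z = Pr Star (Atom (diagram_class X D))" and D: "open_diagram X D"
      by (auto elim!: diagram_spaceE)
    note s = diagram_spaceI[OF D]
    have Star: "Star \<in> {Star :: 'a diagram set univ}" by simp
    show "arrow_fun ?l z = arrow_fun ?r z"
      unfolding dDWD_struct arrow_fun_comp[OF l2 l3 z] arrow_fun_comp[OF l1 laxator_in z]
      unfolding z' arrow_fun_tenA[OF lax_unit_in SET_Idn_in Star s] lax_unit_apply arrow_fun_Idn[OF s]
        laxator_apply[OF open_diagram_empty D]
        far_SF_relabelling[OF p open_diagram_sum[OF open_diagram_empty D] D sum_diagram_lunit[OF D]]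
      using s by (simp add: SET_simps(6))
  qed
qed

lemma laxator_runit:
  assumes X: "is_interface X"
  shows "far SF (runit dDWD X) \<cdot>\<^bsub>SET\<^esub> laxator X empty_interface \<cdot>\<^bsub>SET\<^esub> (Idn SET (diagram_space X) \<odot>\<^bsub>SET\<^esub> lax_unit)
    = runit SET (diagram_space X)" (is "?l = ?r")
proof -
  note p = port_iso_runit[OF X]
  note l1 = SET_tenA_in[OF SET_Idn_in[of "diagram_space X"] lax_unit_in]
  note l2 = SET_comp_in[OF l1 laxator_in] and l3 = far_SF_relabelling_in[OF p]
  show ?thesis
  proof (rule hom_SET_eqI[OF SET_comp_in[OF l2 l3, folded dDWD_struct] SET_struct_in(3)])
    fix z :: "'a diagram set univ" assume z: "z \<in> uprod (diagram_space X) {Star}"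
    then obtain D where z': "z = Pr (Atom (diagram_class X D)) Star" and D: "open_diagram X D"
      by (auto elim!: diagram_spaceE)
    note s = diagram_spaceI[OF D]
    have Star: "Star \<in> {Star :: 'a diagram set univ}" by simp
    show "arrow_fun ?l z = arrow_fun ?r z"
      unfolding dDWD_struct arrow_fun_comp[OF l2 l3 z] arrow_fun_comp[OF l1 laxator_in z]
      unfolding z' arrow_fun_tenA[OF SET_Idn_in lax_unit_in s Star] lax_unit_apply arrow_fun_Idn[OF s]
        laxator_apply[OF D open_diagram_empty]
        far_SF_relabelling[OF p open_diagram_sum[OF D open_diagram_empty] D sum_diagram_runit[OF D]]
      using s by (simp add: SET_simps(7))
  qed
qed

lemma SF_lax_monoidal: "lax_monoidal_functor dDWD SET SF laxator lax_unit"
proof -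
  interpret C: is_moncat dDWD by (rule dDWD_moncat)
  interpret S: is_moncat SET by (rule SET_moncat)
  interpret F: is_functor dDWD SET SF by (rule SF_functor)
  show ?thesis
  proof
    show "lax_unit \<in> hom SET (tunit SET) (fob SF (tunit dDWD))"
      using lax_unit_in by (simp add: SET_simps dDWD_simps fob_SF)
    fix X Y Z X' Y' :: "'a interface" and f g :: "'a dwd_arrow"
    show "laxator X Y \<in> hom SET (fob SF X \<otimes>\<^bsub>SET\<^esub> fob SF Y) (fob SF (X \<otimes>\<^bsub>dDWD\<^esub> Y))"
      using laxator_in by (simp add: SET_simps dDWD_simps fob_SF)
    show "far SF (f \<odot>\<^bsub>dDWD\<^esub> g) \<cdot>\<^bsub>SET\<^esub> laxator X Y = laxator X' Y' \<cdot>\<^bsub>SET\<^esub> (far SF f \<odot>\<^bsub>SET\<^esub> far SF g)"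
      if "f \<in> hom dDWD X X'" "g \<in> hom dDWD Y Y'"
      using that laxator_natural by (auto simp: hom_dDWD)
    assume "X \<in> Ob dDWD" then have X: "is_interface X" by (simp add: dDWD_simps)
    show "far SF (lunit dDWD X) \<cdot>\<^bsub>SET\<^esub> laxator (tunit dDWD) X \<cdot>\<^bsub>SET\<^esub> (lax_unit \<odot>\<^bsub>SET\<^esub> Idn SET (fob SF X)) = lunit SET (fob SF X)"
      using laxator_lunit[OF X] by (simp only: dDWD_simps fob_SF)
    show "far SF (runit dDWD X) \<cdot>\<^bsub>SET\<^esub> laxator X (tunit dDWD) \<cdot>\<^bsub>SET\<^esub> (Idn SET (fob SF X) \<odot>\<^bsub>SET\<^esub> lax_unit) = runit SET (fob SF X)"
      using laxator_runit[OF X] by (simp only: dDWD_simps fob_SF)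
    assume "Y \<in> Ob dDWD" then have Y: "is_interface Y" by (simp add: dDWD_simps)
    assume "Z \<in> Ob dDWD" then have Z: "is_interface Z" by (simp add: dDWD_simps)
    show "far SF (assoc dDWD X Y Z) \<cdot>\<^bsub>SET\<^esub> laxator (X \<otimes>\<^bsub>dDWD\<^esub> Y) Z \<cdot>\<^bsub>SET\<^esub> (laxator X Y \<odot>\<^bsub>SET\<^esub> Idn SET (fob SF Z))
         = laxator X (Y \<otimes>\<^bsub>dDWD\<^esub> Z) \<cdot>\<^bsub>SET\<^esub> (Idn SET (fob SF X) \<odot>\<^bsub>SET\<^esub> laxator Y Z)
             \<cdot>\<^bsub>SET\<^esub> assoc SET (fob SF X) (fob SF Y) (fob SF Z)"
      using laxator_assoc[OF X Y Z] by (simp only: dDWD_simps fob_SF)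
  qed
qed

theorem proposition4p3:
  shows "\<exists>(SF :: ('a interface, 'a dwd_arrow, 'a diagram set univ set, 'a diagram set set_arrow) functor_data)
            \<mu> \<epsilon>.
     lax_monoidal_functor dDWD SET SF \<mu> \<epsilon> \<and>
     (\<forall>X. is_interface X \<longrightarrow>
        fob SF X = {Atom (diagram_class X D) | D. open_diagram X D}) \<and>
     (\<forall>X Y f D. is_dep_wiring X Y f \<longrightarrow> open_diagram X D \<longrightarrow>
        open_diagram Y (act Y f D) \<and>
        arrow_fun (far SF (dwd_arrow X f Y)) (Atom (diagram_class X D)) =
          Atom (diagram_class Y (act Y f D)))"
proof (intro exI conjI allI impI)
  show "lax_monoidal_functor dDWD SET SF laxator lax_unit" by (rule SF_lax_monoidal)
  show "fob SF X = {Atom (diagram_class X D) | D. open_diagram X D}" for X :: "'a interface"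
    by (simp add: fob_SF diagram_space_def)
qed (simp_all add: open_diagram_act SF_apply)

end
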